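(* Let $0 \to A \to E \to B\to 0$ be an extension (short exact sequence) of $C^*$-algebras. Then \[ \max \{ \operatorname{rr}(A), \operatorname{rr}(B) \} \leq \operatorname{rr}(E) \leq \max \{ \operatorname{xrr}(A), \operatorname{rr}(B) \}, \] where $\operatorname{rr}$ denotes the real rank and $\operatorname{xrr}$ the extension real rank.
   Context: For a unital $C^*$-algebra $D$, let $D_{\mathrm{sa}}$ be its set of self-adjoint elements and let $\operatorname{Lg}_n(D)_{\mathrm{sa}}$ be the set of tuples $(a_1,\ldots,a_n)\in (D_{\mathrm{sa}})^n$ such that $\sum_{k=1}^n a_k^2$ is invertible in $D$ (the zero algebra is regarded as unital, with $0=1$ invertible). The real rank $\operatorname{rr}(D)$ is the least integer $n\geq 0$ such that $\operatorname{Lg}_{n+1}(D)_{\mathrm{sa}}$ is dense in $(D_{\mathrm{sa}})^{n+1}$, and $\operatorname{rr}(D)=\infty$ if there is no such $n$. If $D$ is nonunital, $\operatorname{rr}(D):=\operatorname{rr}(\widetilde{D})$, where $\widetilde{D}$ is the minimal unitization. For a $C^*$-algebra $A$ let $M(A)$ be its multiplier algebra and $\pi_A\colon M(A)\to M(A)/A$ the quotient map. For $n\in\mathbb{N}=\{0,1,2,\ldots\}$, $A$ has property $(\Lambda_n)$ if for every $(a_0,\ldots,a_n)\in M(A)_{\mathrm{sa}}^{n+1}$ with $(\pi_A(a_0),\ldots,\pi_A(a_n))\in\operatorname{Lg}_{n+1}(M(A)/A)_{\mathrm{sa}}$ and every $\varepsilon>0$ there is $(b_0,\ldots,b_n)\in\operatorname{Lg}_{n+1}(M(A))_{\mathrm{sa}}$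 with $\|a_j-b_j\|<\varepsilon$ and $\pi_A(a_j)=\pi_A(b_j)$ for $j=0,\ldots,n$. The extension real rank $\operatorname{xrr}(A)$ is the smallest $n\in\mathbb{N}$ such that $A$ has $(\Lambda_m)$ for all $m\geq n$, and $\operatorname{xrr}(A)=\infty$ if no such $n$ exists. *)

theory Defs
  imports "HOL-Analysis.Analysis" "HOL-Library.Extended_Nat"
begin

section \<open>C*-algebras, not necessarily unital\<close>

class complex_star_algebra = ring +
  fixes scaleC :: "complex \<Rightarrow> 'a \<Rightarrow> 'a"  (infixr \<open>*\<^sub>C\<close> 75)
    and star :: "'a \<Rightarrow> 'a"
  assumes scaleC_add_right: "c *\<^sub>C (x + y) = c *\<^sub>C x + c *\<^sub>C y"
    and scaleC_add_left: "(c + d) *\<^sub>C x = c *\<^sub>C x + d *\<^sub>C x"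
    and scaleC_scaleC: "c *\<^sub>C d *\<^sub>C x = (c * d) *\<^sub>C x"
    and scaleC_one: "1 *\<^sub>C x = x"
    and mult_scaleC_left: "(c *\<^sub>C x) * y = c *\<^sub>C (x * y)"
    and mult_scaleC_right: "x * (c *\<^sub>C y) = c *\<^sub>C (x * y)"
    and star_star: "star (star x) = x"
    and star_add: "star (x + y) = star x + star y"
    and star_mult: "star (x * y) = star y * star x"
    and star_scaleC: "star (c *\<^sub>C x) = cnj c *\<^sub>C star x"

class cstar_algebra = complex_star_algebra + real_normed_algebra + banach +
  assumes scaleR_scaleC: "r *\<^sub>R x = complex_of_real r *\<^sub>C x"
    and norm_scaleC: "norm (c *\<^sub>C x) = cmod c * norm x"
    and cstar_identity: "norm (star x * x) = (norm x)\<^sup>2"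

instantiation complex :: cstar_algebra
begin

definition scaleC_complex :: "complex \<Rightarrow> complex \<Rightarrow> complex" where "scaleC_complex = (*)"

definition star_complex :: "complex \<Rightarrow> complex" where "star_complex = cnj"

instance
  by standard
    (simp_all add: scaleC_complex_def star_complex_def algebra_simps scaleR_conv_of_real
      norm_mult power2_eq_square)

end

context complex_star_algebra
begin

lemma star_zero: "star 0 = 0"
  using star_add[of 0 0] by simp

lemma star_minus: "star (- x) = - star x"
  by (rule sym, rule minus_unique) (simp add: star_add[symmetric] star_zero)

lemma star_diff: "star (x - y) = star x - star y"
  using star_add[of x "- y"] by (simp add: star_minus)

lemma scaleC_zero_right: "c *\<^sub>C 0 = 0"
  using scaleC_add_right[of c 0 0] by simp

lemma scaleC_zero_left: "0 *\<^sub>C x = 0"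
  using scaleC_add_left[of 0 0 x] by simp

lemma scaleC_minus_right: "c *\<^sub>C (- x) = - (c *\<^sub>C x)"
  by (rule sym, rule minus_unique) (simp add: scaleC_add_right[symmetric] scaleC_zero_right)

lemma scaleC_diff_right: "c *\<^sub>C (x - y) = c *\<^sub>C x - c *\<^sub>C y"
  using scaleC_add_right[of c x "- y"] by (simp add: scaleC_minus_right)

lemma scaleC_minus_left: "(- c) *\<^sub>C x = - (c *\<^sub>C x)"
  by (rule sym, rule minus_unique) (simp add: scaleC_add_left[symmetric] scaleC_zero_left)

lemma scaleC_diff_left: "(c - d) *\<^sub>C x = c *\<^sub>C x - d *\<^sub>C x"
  using scaleC_add_left[of c "- d" x] by (simp add: scaleC_minus_left)

end

lemma norm_star: "norm (star x) = norm (x :: 'a::cstar_algebra)"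
proof -
  have le: "norm y \<le> norm (star y)" for y :: 'a
  proof (cases "y = 0")
    case False
    have "norm y * norm y = norm (star y * y)"
      by (simp add: cstar_identity power2_eq_square)
    also have "\<dots> \<le> norm (star y) * norm y"
      by (rule norm_mult_ineq)
    finally show ?thesis
      using False by simp
  qed simp
  show ?thesis
    using le[of x] le[of "star x"] by (simp add: star_star)
qed

lemma bounded_linear_star: "bounded_linear (star :: 'a::cstar_algebra \<Rightarrow> 'a)"
  by (rule bounded_linear_intro[where K = 1])
    (simp_all add: star_add scaleR_scaleC star_scaleC norm_star)

lemma bounded_linear_scaleC: "bounded_linear (\<lambda>x :: 'a::cstar_algebra. c *\<^sub>C x)"
  by (rule bounded_linear_intro[where K = "cmod c"])
    (simp_all add: scaleC_add_right scaleR_scaleC scaleC_scaleC norm_scaleC mult.commute)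

lemma norm_le_by_left_mult:
  fixes z :: "'a::cstar_algebra"
  assumes "\<And>x. norm (x * z) \<le> K * norm x" and "K \<ge> 0"
  shows "norm z \<le> K"
proof (cases "z = 0")
  case False
  have "norm z * norm z = norm (star z * z)"
    by (simp add: cstar_identity power2_eq_square)
  also have "\<dots> \<le> K * norm z"
    using assms(1)[of "star z"] by (simp add: norm_star)
  finally show ?thesis
    using False by simp
qed (use assms in simp)

lemma norm_le_by_right_mult:
  fixes z :: "'a::cstar_algebra"
  assumes "\<And>x. norm (z * x) \<le> K * norm x" and "K \<ge> 0"
  shows "norm z \<le> K"
proof -
  have "norm (x * star z) \<le> K * norm x" for x
    using assms(1)[of "star x"] norm_star[of "z * star x"] norm_star[of x]
    by (simp add: star_mult star_star)
  then show ?thesis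
    using norm_le_by_left_mult[of "star z" K] assms(2) by (simp add: norm_star)
qed

definition is_star_hom :: "('a::complex_star_algebra \<Rightarrow> 'b::complex_star_algebra) \<Rightarrow> bool" where
  "is_star_hom f \<longleftrightarrow>
     (\<forall>x y. f (x + y) = f x + f y) \<and> (\<forall>c x. f (c *\<^sub>C x) = c *\<^sub>C f x) \<and>
     (\<forall>x y. f (x * y) = f x * f y) \<and> (\<forall>x. f (star x) = star (f x))"

definition cstar_extension ::
    "('a::cstar_algebra \<Rightarrow> 'e::cstar_algebra) \<Rightarrow> ('e \<Rightarrow> 'b::cstar_algebra) \<Rightarrow> bool" where
  "cstar_extension \<iota> \<pi> \<longleftrightarrow>
     is_star_hom \<iota> \<and> is_star_hom \<pi> \<and> inj \<iota> \<and> surj \<pi> \<and> range \<iota> = {x. \<pi> x = 0}"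


section \<open>The multiplier algebra\<close>

text \<open>
  The multiplier algebra is realised by double centralizers, i.e. pairs \<open>(L, R)\<close> of
  bounded complex linear maps with \<open>x L(y) = R(x) y\<close>.
\<close>

definition double_centralizers :: "(('a::cstar_algebra \<Rightarrow>\<^sub>L 'a) \<times> ('a \<Rightarrow>\<^sub>L 'a)) set" where
  "double_centralizers = {(L, R).
     (\<forall>c x. blinfun_apply L (c *\<^sub>C x) = c *\<^sub>C blinfun_apply L x) \<and>
     (\<forall>c x. blinfun_apply R (c *\<^sub>C x) = c *\<^sub>C blinfun_apply R x) \<and>
     (\<forall>x y. blinfun_apply L (x * y) = blinfun_apply L x * y) \<and>
     (\<forall>x y. blinfun_apply R (x * y) = x * blinfun_apply R y) \<and>
     (\<forall>x y. x * blinfun_apply L y = blinfun_apply R x * y)}"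

typedef (overloaded) 'a multiplier =
    "double_centralizers :: (('a::cstar_algebra \<Rightarrow>\<^sub>L 'a) \<times> ('a \<Rightarrow>\<^sub>L 'a)) set"
  by (rule exI[of _ "(0, 0)"]) (simp add: double_centralizers_def scaleC_zero_right)

setup_lifting type_definition_multiplier

lift_definition mult_left :: "'a::cstar_algebra multiplier \<Rightarrow> 'a \<Rightarrow> 'a"
  is "\<lambda>T. blinfun_apply (fst T)" .

lift_definition mult_right :: "'a::cstar_algebra multiplier \<Rightarrow> 'a \<Rightarrow> 'a"
  is "\<lambda>T. blinfun_apply (snd T)" .

lemma multiplier_eqI:
  assumes "\<And>x. mult_left S x = mult_left T x" "\<And>x. mult_right S x = mult_right T x"
  shows "S = T"
  using assms by transfer (auto intro!: blinfun_eqI prod_eqI)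

lemma
  shows mult_left_add: "mult_left T (x + y) = mult_left T x + mult_left T y"
    and mult_right_add: "mult_right T (x + y) = mult_right T x + mult_right T y"
    and mult_left_scaleC: "mult_left T (c *\<^sub>C x) = c *\<^sub>C mult_left T x"
    and mult_right_scaleC: "mult_right T (c *\<^sub>C x) = c *\<^sub>C mult_right T x"
    and mult_left_mult: "mult_left T (x * y) = mult_left T x * y"
    and mult_right_mult: "mult_right T (x * y) = x * mult_right T y"
    and mult_left_right: "x * mult_left T y = mult_right T x * y"
  by (transfer; auto simp: double_centralizers_def blinfun.bilinear_simps)+

text \<open>The map \<open>x \<mapsto> (f x\<^sup>*)\<^sup>*\<close>.\<close>

definition blinfun_star :: "('a::cstar_algebra \<Rightarrow>\<^sub>L 'a) \<Rightarrow> ('a \<Rightarrow>\<^sub>L 'a)" where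
  "blinfun_star f = Blinfun (\<lambda>x. star (blinfun_apply f (star x)))"

lemma blinfun_star_apply: "blinfun_apply (blinfun_star f) x = star (blinfun_apply f (star x))"
proof -
  have "bounded_linear (\<lambda>x. star (blinfun_apply f (star x)))"
    by (intro bounded_linear_compose[OF bounded_linear_star]
          bounded_linear_compose[OF blinfun.bounded_linear_right] bounded_linear_star)
  then show ?thesis
    by (simp add: blinfun_star_def bounded_linear_Blinfun_apply)
qed

definition blinfun_scaleC :: "complex \<Rightarrow> ('a::cstar_algebra \<Rightarrow>\<^sub>L 'a) \<Rightarrow> ('a \<Rightarrow>\<^sub>L 'a)" where
  "blinfun_scaleC c f = Blinfun (\<lambda>x. c *\<^sub>C blinfun_apply f x)"

lemma blinfun_scaleC_apply: "blinfun_apply (blinfun_scaleC c f) x = c *\<^sub>C blinfun_apply f x"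
proof -
  have "bounded_linear (\<lambda>x. c *\<^sub>C blinfun_apply f x)"
    by (intro bounded_linear_compose[OF bounded_linear_scaleC] blinfun.bounded_linear_right)
  then show ?thesis
    by (simp add: blinfun_scaleC_def bounded_linear_Blinfun_apply)
qed

instantiation multiplier :: (cstar_algebra) complex_star_algebra
begin

lift_definition zero_multiplier :: "'a multiplier" is "(0, 0)"
  by (simp add: double_centralizers_def scaleC_zero_right)

lift_definition plus_multiplier :: "'a multiplier \<Rightarrow> 'a multiplier \<Rightarrow> 'a multiplier"
  is "\<lambda>S T. (fst S + fst T, snd S + snd T)"
  by (auto simp: double_centralizers_def blinfun.bilinear_simps scaleC_add_right algebra_simps)

lift_definition uminus_multiplier :: "'a multiplier \<Rightarrow> 'a multiplier"
  is "\<lambda>T. (- fst T, - snd T)"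
  by (auto simp: double_centralizers_def blinfun.bilinear_simps scaleC_minus_right algebra_simps)

lift_definition minus_multiplier :: "'a multiplier \<Rightarrow> 'a multiplier \<Rightarrow> 'a multiplier"
  is "\<lambda>S T. (fst S - fst T, snd S - snd T)"
  by (auto simp: double_centralizers_def blinfun.bilinear_simps scaleC_diff_right algebra_simps)

lift_definition times_multiplier :: "'a multiplier \<Rightarrow> 'a multiplier \<Rightarrow> 'a multiplier"
  is "\<lambda>S T. (fst S o\<^sub>L fst T, snd T o\<^sub>L snd S)"
  by (auto simp: double_centralizers_def)

lift_definition scaleC_multiplier :: "complex \<Rightarrow> 'a multiplier \<Rightarrow> 'a multiplier"
  is "\<lambda>c T. (blinfun_scaleC c (fst T), blinfun_scaleC c (snd T))"
  by (auto simp: double_centralizers_def blinfun_scaleC_apply scaleC_scaleC mult.commute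
      mult_scaleC_left mult_scaleC_right)

lift_definition star_multiplier :: "'a multiplier \<Rightarrow> 'a multiplier"
  is "\<lambda>T. (blinfun_star (snd T), blinfun_star (fst T))"
proof -
  fix T :: "('a \<Rightarrow>\<^sub>L 'a) \<times> ('a \<Rightarrow>\<^sub>L 'a)"
  assume T: "T \<in> double_centralizers"
  have "x * star (blinfun_apply (snd T) (star y)) = star (blinfun_apply (fst T) (star x)) * y" for x y
  proof -
    have "star (x * star (blinfun_apply (snd T) (star y))) =
          star (star (blinfun_apply (fst T) (star x)) * y)"
      using T by (auto simp: double_centralizers_def star_mult star_star)
    then show ?thesis
      by (metis star_star)
  qed
  with T show "(blinfun_star (snd T), blinfun_star (fst T)) \<in> double_centralizers"
    by (auto simp: double_centralizers_def blinfun_star_apply star_scaleC star_mult star_star)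
qed

lemma
  shows mult_left_zero_mult: "mult_left 0 x = 0"
    and mult_left_plus: "mult_left (S + T) x = mult_left S x + mult_left T x"
    and mult_left_uminus: "mult_left (- T) x = - mult_left T x"
    and mult_left_minus: "mult_left (S - T) x = mult_left S x - mult_left T x"
    and mult_left_times: "mult_left (S * T) x = mult_left S (mult_left T x)"
    and mult_left_scaleC_mult: "mult_left (c *\<^sub>C T) x = c *\<^sub>C mult_left T x"
    and mult_left_star: "mult_left (star T) x = star (mult_right T (star x))"
  by (transfer; simp add: blinfun.bilinear_simps blinfun_scaleC_apply blinfun_star_apply)+

lemma
  shows mult_right_zero_mult: "mult_right 0 x = 0"
    and mult_right_plus: "mult_right (S + T) x = mult_right S x + mult_right T x"
    and mult_right_uminus: "mult_right (- T) x = - mult_right T x"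
    and mult_right_minus: "mult_right (S - T) x = mult_right S x - mult_right T x"
    and mult_right_times: "mult_right (S * T) x = mult_right T (mult_right S x)"
    and mult_right_scaleC_mult: "mult_right (c *\<^sub>C T) x = c *\<^sub>C mult_right T x"
    and mult_right_star: "mult_right (star T) x = star (mult_left T (star x))"
  by (transfer; simp add: blinfun.bilinear_simps blinfun_scaleC_apply blinfun_star_apply)+

instance
  by standard
    (rule multiplier_eqI; simp add: mult_left_zero_mult mult_left_plus mult_left_uminus
      mult_left_minus mult_left_times mult_left_scaleC_mult mult_left_star mult_right_zero_mult
      mult_right_plus mult_right_uminus mult_right_minus mult_right_times mult_right_scaleC_mult
      mult_right_star mult_left_add mult_right_add mult_left_scaleC mult_right_scaleC
      scaleC_add_right scaleC_add_left scaleC_scaleC scaleC_one star_star star_add star_scaleC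
      algebra_simps)+

end

instantiation multiplier :: (cstar_algebra) real_normed_vector
begin

lift_definition scaleR_multiplier :: "real \<Rightarrow> 'a multiplier \<Rightarrow> 'a multiplier"
  is "\<lambda>r T. (r *\<^sub>R fst T, r *\<^sub>R snd T)"
  by (auto simp: double_centralizers_def blinfun.bilinear_simps scaleR_scaleC scaleC_scaleC
      mult.commute mult_scaleC_left mult_scaleC_right)

text \<open>
  The two components of a double centralizer have the same norm; see
  \<open>norm_double_centralizer\<close>.
\<close>

lift_definition norm_multiplier :: "'a multiplier \<Rightarrow> real" is "\<lambda>T. norm (fst T)" .

definition dist_multiplier :: "'a multiplier \<Rightarrow> 'a multiplier \<Rightarrow> real" where
  "dist_multiplier S T = norm (S - T)"

definition sgn_multiplier :: "'a multiplier \<Rightarrow> 'a multiplier" where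
  "sgn_multiplier T = inverse (norm T) *\<^sub>R T"

definition uniformity_multiplier :: "('a multiplier \<times> 'a multiplier) filter" where
  "uniformity_multiplier = (INF e\<in>{0<..}. principal {(S, T). dist S T < e})"

definition open_multiplier :: "'a multiplier set \<Rightarrow> bool" where
  "open_multiplier U \<longleftrightarrow>
     (\<forall>S\<in>U. eventually (\<lambda>(S', T). S' = S \<longrightarrow> T \<in> U) uniformity)"

lemma norm_double_centralizer:
  "T \<in> double_centralizers \<Longrightarrow> norm (fst T) = norm (snd T)"
  for T :: "('a \<Rightarrow>\<^sub>L 'a) \<times> ('a \<Rightarrow>\<^sub>L 'a)"
proof -
  assume "T \<in> double_centralizers"
  then have *: "x * blinfun_apply (fst T) y = blinfun_apply (snd T) x * y" for x y
    by (auto simp: double_centralizers_def)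
  show ?thesis
  proof (rule antisym)
    show "norm (fst T) \<le> norm (snd T)"
    proof (rule norm_blinfun_bound)
      fix y
      show "norm (blinfun_apply (fst T) y) \<le> norm (snd T) * norm y"
      proof (rule norm_le_by_left_mult)
        fix x
        have "norm (x * blinfun_apply (fst T) y) \<le> norm (blinfun_apply (snd T) x) * norm y"
          unfolding * by (rule norm_mult_ineq)
        also have "\<dots> \<le> (norm (snd T) * norm x) * norm y"
          by (intro mult_right_mono norm_blinfun) simp
        finally show "norm (x * blinfun_apply (fst T) y) \<le> norm (snd T) * norm y * norm x"
          by (simp add: mult_ac)
      qed simp
    qed simp
    show "norm (snd T) \<le> norm (fst T)"
    proof (rule norm_blinfun_bound)
      fix y
      show "norm (blinfun_apply (snd T) y) \<le> norm (fst T) * norm y"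
      proof (rule norm_le_by_right_mult)
        fix x
        have "norm (blinfun_apply (snd T) y * x) \<le> norm y * norm (blinfun_apply (fst T) x)"
          unfolding *[symmetric] by (rule norm_mult_ineq)
        also have "\<dots> \<le> norm y * (norm (fst T) * norm x)"
          by (intro mult_left_mono norm_blinfun) simp
        finally show "norm (blinfun_apply (snd T) y * x) \<le> norm (fst T) * norm y * norm x"
          by (simp add: mult_ac)
      qed simp
    qed simp
  qed
qed

instance
proof
  fix S T :: "'a multiplier" and r s :: real
  show "norm T = 0 \<longleftrightarrow> T = 0"
    by transfer (metis fst_zero norm_double_centralizer norm_eq_zero prod_eq_iff snd_zero zero_prod_def)
  show "norm (S + T) \<le> norm S + norm T"
    by transfer (auto intro: norm_triangle_ineq)
  show "norm (r *\<^sub>R T) = \<bar>r\<bar> * norm T"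
    by transfer simp
  show "r *\<^sub>R (S + T) = r *\<^sub>R S + r *\<^sub>R T" "(r + s) *\<^sub>R T = r *\<^sub>R T + s *\<^sub>R T"
    "r *\<^sub>R s *\<^sub>R T = (r * s) *\<^sub>R T" "1 *\<^sub>R T = T"
    by (transfer; simp add: algebra_simps)+
qed (fact dist_multiplier_def sgn_multiplier_def uniformity_multiplier_def open_multiplier_def)+

end

lemma norm_mult_left: "norm (mult_left T x) \<le> norm T * norm x"
  by transfer (rule norm_blinfun)

lemma norm_mult_right: "norm (mult_right T x) \<le> norm T * norm x"
  by transfer (simp add: norm_double_centralizer norm_blinfun)

lemma norm_multiplier_bound:
  assumes "K \<ge> 0" "\<And>x. norm (mult_left T x) \<le> K * norm x"
  shows "norm T \<le> K"
  using assms by transfer (rule norm_blinfun_bound)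

instance multiplier :: (cstar_algebra) cstar_algebra
proof
  fix S T :: "'a multiplier" and r :: real and c :: complex
  show "r *\<^sub>R S * T = r *\<^sub>R (S * T)" "S * r *\<^sub>R T = r *\<^sub>R (S * T)"
    by (transfer; auto intro!: blinfun_eqI simp: blinfun.bilinear_simps)+
  show norm_mult: "norm (S * T) \<le> norm S * norm T" for S T :: "'a multiplier"
    by transfer (simp add: norm_blinfun_compose)
  show "r *\<^sub>R T = complex_of_real r *\<^sub>C T"
    by transfer (auto intro!: blinfun_eqI
        simp: blinfun.bilinear_simps blinfun_scaleC_apply scaleR_scaleC)
  show "norm (c *\<^sub>C T) = cmod c * norm T"
  proof (rule antisym)
    have le: "norm (d *\<^sub>C T) \<le> cmod d * norm T" for d and T :: "'a multiplier"
    proof (rule norm_multiplier_bound)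
      fix x
      show "norm (mult_left (d *\<^sub>C T) x) \<le> cmod d * norm T * norm x"
        using mult_left_mono[OF norm_mult_left[of T x], of "cmod d"]
        by (simp add: mult_left_scaleC_mult norm_scaleC mult.assoc)
    qed simp
    show "norm (c *\<^sub>C T) \<le> cmod c * norm T"
      by (rule le)
    show "cmod c * norm T \<le> norm (c *\<^sub>C T)"
    proof (cases "c = 0")
      case False
      have "norm T = norm (inverse c *\<^sub>C c *\<^sub>C T)"
        using False by (simp add: scaleC_scaleC scaleC_one)
      also have "\<dots> \<le> inverse (cmod c) * norm (c *\<^sub>C T)"
        using le[of "inverse c" "c *\<^sub>C T"] by (simp add: norm_inverse)
      finally show ?thesis
        using False by (simp add: field_simps)
    qed simp
  qed
  show "norm (star T * T) = (norm T)\<^sup>2"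
  proof (rule antisym)
    have star_le: "norm (star T) \<le> norm T"
    proof (rule norm_multiplier_bound)
      fix x
      show "norm (mult_left (star T) x) \<le> norm T * norm x"
        using norm_mult_right[of T "star x"] by (simp add: mult_left_star norm_star)
    qed simp
    have "norm (star T * T) \<le> norm (star T) * norm T"
      by (rule norm_mult)
    also have "\<dots> \<le> norm T * norm T"
      by (rule mult_right_mono[OF star_le]) simp
    finally show "norm (star T * T) \<le> (norm T)\<^sup>2"
      by (simp add: power2_eq_square)
    have "norm T \<le> sqrt (norm (star T * T))"
    proof (rule norm_multiplier_bound)
      fix x
      have "(norm (mult_left T x))\<^sup>2 = norm (star (mult_left T x) * mult_left T x)"
        by (simp add: cstar_identity)
      also have "star (mult_left T x) * mult_left T x = star x * mult_left (star T * T) x"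
        by (simp only: mult_left_times mult_left_right[of "star x" "star T"] mult_right_star star_star)
      also have "norm \<dots> \<le> norm (star x) * norm (mult_left (star T * T) x)"
        by (rule norm_mult_ineq)
      also have "\<dots> \<le> norm (star x) * (norm (star T * T) * norm x)"
        by (intro mult_left_mono norm_mult_left) simp
      also have "\<dots> = (sqrt (norm (star T * T)) * norm x)\<^sup>2"
        by (simp add: norm_star power_mult_distrib power2_eq_square)
      finally show "norm (mult_left T x) \<le> sqrt (norm (star T * T)) * norm x"
        by (rule power2_le_imp_le) simp
    qed simp
    then have "(norm T)\<^sup>2 \<le> (sqrt (norm (star T * T)))\<^sup>2"
      by (intro power_mono) simp_all
    then show "(norm T)\<^sup>2 \<le> norm (star T * T)"
      by simp
  qed
next
  fix X :: "nat \<Rightarrow> 'a multiplier"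
  assume X: "Cauchy X"
  define L where "L n = fst (Rep_multiplier (X n))" for n
  define R where "R n = snd (Rep_multiplier (X n))" for n
  have LR: "(L n, R n) \<in> double_centralizers" for n
    using Rep_multiplier[of "X n"] by (simp add: L_def R_def)
  have dist_L: "dist (L m) (L n) = dist (X m) (X n)" for m n
    by (simp add: L_def dist_norm norm_multiplier.rep_eq minus_multiplier.rep_eq)
  have dist_R: "dist (R m) (R n) = dist (X m) (X n)" for m n
    using norm_double_centralizer[OF Rep_multiplier[of "X m - X n"]]
    by (simp add: R_def dist_norm norm_multiplier.rep_eq minus_multiplier.rep_eq)
  have "Cauchy L" "Cauchy R"
    using X by (simp_all add: Cauchy_def dist_L dist_R)
  then obtain l r where l: "L \<longlonglongrightarrow> l" and r: "R \<longlonglongrightarrow> r"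
    by (meson Cauchy_convergent convergent_def)
  have lx: "(\<lambda>n. blinfun_apply (L n) x) \<longlonglongrightarrow> blinfun_apply l x"
    and rx: "(\<lambda>n. blinfun_apply (R n) x) \<longlonglongrightarrow> blinfun_apply r x" for x
    by (intro blinfun.tendsto l r tendsto_const)+
  have "(l, r) \<in> double_centralizers"
    unfolding double_centralizers_def
  proof (intro CollectI case_prodI conjI allI)
    fix c x y
    have Lc: "blinfun_apply (L n) (c *\<^sub>C x) = c *\<^sub>C blinfun_apply (L n) x"
      and Rc: "blinfun_apply (R n) (c *\<^sub>C x) = c *\<^sub>C blinfun_apply (R n) x"
      and Lm: "blinfun_apply (L n) (x * y) = blinfun_apply (L n) x * y"
      and Rm: "blinfun_apply (R n) (x * y) = x * blinfun_apply (R n) y"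
      and LRm: "x * blinfun_apply (L n) y = blinfun_apply (R n) x * y" for n
      using LR[of n] unfolding double_centralizers_def by blast+
    show "blinfun_apply l (c *\<^sub>C x) = c *\<^sub>C blinfun_apply l x"
      by (rule LIMSEQ_unique[OF lx]) (unfold Lc, intro bounded_linear.tendsto[OF bounded_linear_scaleC] lx)
    show "blinfun_apply r (c *\<^sub>C x) = c *\<^sub>C blinfun_apply r x"
      by (rule LIMSEQ_unique[OF rx]) (unfold Rc, intro bounded_linear.tendsto[OF bounded_linear_scaleC] rx)
    show "blinfun_apply l (x * y) = blinfun_apply l x * y"
      by (rule LIMSEQ_unique[OF lx]) (unfold Lm, intro tendsto_mult tendsto_const lx)
    show "blinfun_apply r (x * y) = x * blinfun_apply r y"
      by (rule LIMSEQ_unique[OF rx]) (unfold Rm, intro tendsto_mult tendsto_const rx)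
    show "x * blinfun_apply l y = blinfun_apply r x * y"
      by (rule LIMSEQ_unique[OF tendsto_mult[OF tendsto_const lx]])
        (unfold LRm, intro tendsto_mult tendsto_const rx)
  qed
  then have rep: "Rep_multiplier (Abs_multiplier (l, r)) = (l, r)"
    by (rule Abs_multiplier_inverse)
  have "dist (X n) (Abs_multiplier (l, r)) = dist (L n) l" for n
    by (simp add: dist_norm norm_multiplier.rep_eq minus_multiplier.rep_eq rep L_def)
  then have "X \<longlonglongrightarrow> Abs_multiplier (l, r)"
    using l unfolding tendsto_dist_iff[of X] tendsto_dist_iff[of L] by simp
  then show "convergent X"
    by (auto simp: convergent_def)
qed

instantiation multiplier :: (cstar_algebra) monoid_mult
begin

lift_definition one_multiplier :: "'a multiplier" is "(id_blinfun, id_blinfun)"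
  by (simp add: double_centralizers_def)

instance
  by standard (transfer; auto intro!: blinfun_eqI)+

end

lemma mult_left_one: "mult_left 1 x = x" and mult_right_one: "mult_right 1 x = x"
  by (transfer; simp)+

lift_definition mult_embed :: "'a::cstar_algebra \<Rightarrow> 'a multiplier"
  is "\<lambda>a. (blinfun_mult_right a, blinfun_mult_left a)"
  by (auto simp: double_centralizers_def mult.assoc mult_scaleC_left mult_scaleC_right)

lemma mult_left_embed: "mult_left (mult_embed a) x = a * x"
  and mult_right_embed: "mult_right (mult_embed a) x = x * a"
  by (transfer; simp)+

lemma embed_zero: "mult_embed 0 = 0"
  and embed_add: "mult_embed (a + b) = mult_embed a + mult_embed b"
  and embed_minus: "mult_embed (- a) = - mult_embed a"
  and embed_diff: "mult_embed (a - b) = mult_embed a - mult_embed b"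
  and embed_scaleC: "mult_embed (c *\<^sub>C a) = c *\<^sub>C mult_embed a"
  and embed_star: "mult_embed (star a) = star (mult_embed a)"
  by (rule multiplier_eqI; simp add: mult_left_embed mult_right_embed mult_left_zero_mult
      mult_right_zero_mult mult_left_plus mult_right_plus mult_left_uminus mult_right_uminus
      mult_left_minus mult_right_minus mult_left_scaleC_mult mult_right_scaleC_mult
      mult_left_star mult_right_star mult_scaleC_left mult_scaleC_right star_mult star_star
      distrib_left distrib_right left_diff_distrib right_diff_distrib)+

lemma embed_mult: "mult_embed (a * b) = mult_embed a * mult_embed b"
  and embed_absorb_left: "T * mult_embed a = mult_embed (mult_left T a)"
  and embed_absorb_right: "mult_embed a * T = mult_embed (mult_right T a)"
  by (rule multiplier_eqI; simp add: mult_left_embed mult_right_embed mult_left_times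
      mult_right_times mult_left_mult mult_right_mult mult_left_right mult.assoc)+

lemma norm_embed: "norm (mult_embed a) = norm a"
proof (rule antisym)
  show "norm (mult_embed a) \<le> norm a"
    by (rule norm_multiplier_bound) (simp_all add: mult_left_embed norm_mult_ineq)
  show "norm a \<le> norm (mult_embed a)"
    by (rule norm_le_by_right_mult)
      (simp_all add: mult_left_embed[symmetric] norm_mult_left)
qed

lifting_forget multiplier.lifting

lemma
  shows range_embed_zero: "0 \<in> range mult_embed"
    and range_embed_add: "S \<in> range mult_embed \<Longrightarrow> T \<in> range mult_embed \<Longrightarrow> S + T \<in> range mult_embed"
    and range_embed_minus: "S \<in> range mult_embed \<Longrightarrow> - S \<in> range mult_embed"
    and range_embed_diff: "S \<in> range mult_embed \<Longrightarrow> T \<in> range mult_embed \<Longrightarrow> S - T \<in> range mult_embed"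
    and range_embed_mult_right: "S \<in> range mult_embed \<Longrightarrow> S * T \<in> range mult_embed"
    and range_embed_mult_left: "T \<in> range mult_embed \<Longrightarrow> S * T \<in> range mult_embed"
    and range_embed_scaleC: "S \<in> range mult_embed \<Longrightarrow> c *\<^sub>C S \<in> range mult_embed"
    and range_embed_star: "S \<in> range mult_embed \<Longrightarrow> star S \<in> range mult_embed"
         apply (rule range_eqI[where f = mult_embed, OF embed_zero[symmetric]])
        apply (elim imageE, hypsubst, rule range_eqI[where f = mult_embed, OF embed_add[symmetric]])
       apply (elim imageE, hypsubst, rule range_eqI[where f = mult_embed, OF embed_minus[symmetric]])
      apply (elim imageE, hypsubst, rule range_eqI[where f = mult_embed, OF embed_diff[symmetric]])
     apply (elim imageE, hypsubst, rule range_eqI[where f = mult_embed, OF embed_absorb_right])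
    apply (elim imageE, hypsubst, rule range_eqI[where f = mult_embed, OF embed_absorb_left])
   apply (elim imageE, hypsubst, rule range_eqI[where f = mult_embed, OF embed_scaleC[symmetric]])
  apply (elim imageE, hypsubst, rule range_eqI[where f = mult_embed, OF embed_star[symmetric]])
  done

lemma eq_imp_diff_in_range_embed: "S = T \<Longrightarrow> S - T \<in> range mult_embed"
  by (simp add: range_embed_zero)


section \<open>The quotient of the multiplier algebra by the algebra\<close>

text \<open>
  Only the *-algebra structure of the quotient is set up: its norm does not
  enter the definition of the property \<open>(\<Lambda>\<^sub>n)\<close>.
\<close>

quotient_type (overloaded) 'a corona = "'a::cstar_algebra multiplier" / "\<lambda>S T. S - T \<in> range mult_embed"
proof (rule equivpI)
  show "reflp (\<lambda>S T :: 'a multiplier. S - T \<in> range mult_embed)"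
    by (auto simp: reflp_def intro: range_embed_zero)
  show "symp (\<lambda>S T :: 'a multiplier. S - T \<in> range mult_embed)"
    by (rule sympI, drule range_embed_minus) simp
  show "transp (\<lambda>S T :: 'a multiplier. S - T \<in> range mult_embed)"
  proof (rule transpI)
    fix S T U :: "'a multiplier"
    assume "S - T \<in> range mult_embed" "T - U \<in> range mult_embed"
    then have "(S - T) + (T - U) \<in> range mult_embed"
      by (rule range_embed_add)
    then show "S - U \<in> range mult_embed"
      by simp
  qed
qed

lift_definition corona_proj :: "'a::cstar_algebra multiplier \<Rightarrow> 'a corona" is "\<lambda>T. T" .

instantiation corona :: (cstar_algebra) complex_star_algebra
begin

lift_definition zero_corona :: "'a corona" is 0 .

lift_definition plus_corona :: "'a corona \<Rightarrow> 'a corona \<Rightarrow> 'a corona" is "(+)"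
  unfolding add_diff_add by (rule range_embed_add)

lift_definition uminus_corona :: "'a corona \<Rightarrow> 'a corona" is uminus
  unfolding minus_diff_minus by (rule range_embed_minus)

lift_definition minus_corona :: "'a corona \<Rightarrow> 'a corona \<Rightarrow> 'a corona" is "(-)"
proof -
  fix S S' T T' :: "'a multiplier"
  assume "S - S' \<in> range mult_embed" "T - T' \<in> range mult_embed"
  then have "(S - S') - (T - T') \<in> range mult_embed"
    by (rule range_embed_diff)
  then show "S - T - (S' - T') \<in> range mult_embed"
    by (simp add: algebra_simps)
qed

lift_definition times_corona :: "'a corona \<Rightarrow> 'a corona \<Rightarrow> 'a corona" is "(*)"
proof -
  fix S S' T T' :: "'a multiplier"
  assume "S - S' \<in> range mult_embed" "T - T' \<in> range mult_embed"
  then have "(S - S') * T + S' * (T - T') \<in> range mult_embed"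
    by (intro range_embed_add range_embed_mult_right range_embed_mult_left)
  then show "S * T - S' * T' \<in> range mult_embed"
    by (simp add: algebra_simps)
qed

lift_definition scaleC_corona :: "complex \<Rightarrow> 'a corona \<Rightarrow> 'a corona" is "scaleC"
  unfolding scaleC_diff_right[symmetric] by (rule range_embed_scaleC)

lift_definition star_corona :: "'a corona \<Rightarrow> 'a corona" is star
  unfolding star_diff[symmetric] by (rule range_embed_star)

instance
  by standard
    (transfer; rule eq_imp_diff_in_range_embed; simp add: scaleC_add_right scaleC_add_left
      scaleC_scaleC scaleC_one star_star star_add star_scaleC star_mult mult_scaleC_left
      mult_scaleC_right algebra_simps)+

end


lemma corona_proj_eq_0_iff: "corona_proj T = 0 \<longleftrightarrow> T \<in> range mult_embed"
  by transfer simp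

lemma is_star_hom_corona_proj: "is_star_hom corona_proj"
  unfolding is_star_hom_def
  by (intro conjI allI; transfer; rule eq_imp_diff_in_range_embed; rule refl)

lemma surj_corona_proj: "surj corona_proj"
  unfolding surj_def by (intro allI, transfer) (auto intro: eq_imp_diff_in_range_embed)


section \<open>The minimal unitization\<close>

lemma closed_range_embed: "closed (range (mult_embed :: 'a::cstar_algebra \<Rightarrow> 'a multiplier))"
  unfolding closed_sequential_limits
proof (intro allI impI, elim conjE)
  fix X and T :: "'a multiplier"
  assume "\<forall>n. X n \<in> range mult_embed" and lim: "X \<longlonglongrightarrow> T"
  then have "\<forall>n. \<exists>a. X n = mult_embed a"
    by blast
  then obtain a where X: "\<And>n. X n = mult_embed (a n)"
    by metis
  have dist_embed: "dist (mult_embed x) (mult_embed y) = dist x y" for x y :: 'a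
    by (simp add: dist_norm embed_diff[symmetric] norm_embed)
  have "Cauchy X"
    using lim by (rule LIMSEQ_imp_Cauchy)
  then have "Cauchy a"
    by (simp add: Cauchy_def X dist_embed)
  then obtain x where "a \<longlonglongrightarrow> x"
    by (auto simp: Cauchy_convergent_iff convergent_def)
  then have "X \<longlonglongrightarrow> mult_embed x"
    unfolding tendsto_dist_iff[of X] tendsto_dist_iff[of a] by (simp add: X dist_embed)
  then show "T \<in> range mult_embed"
    using LIMSEQ_unique[OF lim] by simp
qed

lemma bounded_linear_scaleC_left: "bounded_linear (\<lambda>c. c *\<^sub>C (x :: 'a::cstar_algebra))"
  by (rule bounded_linear_intro[where K = "norm x"])
    (simp_all add: scaleC_add_left scaleR_scaleC scaleC_scaleC norm_scaleC scaleC_complex_def)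

lemma closed_embed_plus_scalars:
  "closed {T :: 'a::cstar_algebra multiplier. \<exists>a c. T = mult_embed a + c *\<^sub>C 1}" (is "closed ?U")
proof (cases "1 \<in> range (mult_embed :: 'a \<Rightarrow> 'a multiplier)")
  case True
  then have "?U = range mult_embed"
  proof (intro equalityI subsetI)
    fix T assume "T \<in> ?U"
    then show "T \<in> range mult_embed"
      using True by (auto intro!: range_embed_add range_embed_scaleC rangeI)
  next
    fix T :: "'a multiplier" assume "T \<in> range mult_embed"
    then obtain a where "T = mult_embed a + 0 *\<^sub>C 1"
      by (auto simp: scaleC_zero_left)
    then show "T \<in> ?U" by blast
  qed
  then show ?thesis
    by (simp add: closed_range_embed)
next
  case False
  define d where "d = infdist 1 (range (mult_embed :: 'a \<Rightarrow> 'a multiplier))"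
  have d: "d > 0"
    unfolding d_def using False closed_range_embed by (intro infdist_pos_not_in_closed) auto
  have bound: "cmod c * d \<le> norm (mult_embed a + c *\<^sub>C 1)" for a :: 'a and c
  proof (cases "c = 0")
    case False
    have "d \<le> dist 1 (mult_embed (- (inverse c) *\<^sub>C a))"
      unfolding d_def by (rule infdist_le) simp
    also have "\<dots> = norm (inverse c *\<^sub>C (mult_embed a + c *\<^sub>C 1))"
      using False by (simp add: dist_norm embed_scaleC scaleC_add_right scaleC_scaleC
          scaleC_one scaleC_minus_left embed_minus add.commute)
    also have "\<dots> = norm (mult_embed a + c *\<^sub>C 1) / cmod c"
      by (simp add: norm_scaleC norm_inverse divide_inverse_commute)
    finally show ?thesis
      using False by (simp add: pos_le_divide_eq mult.commute)
  qed simp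
  show ?thesis
    unfolding closed_sequential_limits
  proof (intro allI impI, elim conjE)
    fix X and T :: "'a multiplier"
    assume "\<forall>n. X n \<in> ?U" and lim: "X \<longlonglongrightarrow> T"
    then have "\<forall>n. \<exists>a c. X n = mult_embed a + c *\<^sub>C 1"
      by simp
    then obtain a c where X: "\<And>n. X n = mult_embed (a n) + c n *\<^sub>C 1"
      by metis
    have c_dist: "dist (c m) (c n) * d \<le> dist (X m) (X n)" for m n
      using bound[of "c m - c n" "a m - a n"]
      by (simp add: dist_norm X embed_diff scaleC_diff_left algebra_simps)
    have "Cauchy X"
      using lim by (rule LIMSEQ_imp_Cauchy)
    have "Cauchy c"
      unfolding Cauchy_def
    proof (intro allI impI)
      fix e :: real assume "e > 0"
      then obtain M where "\<forall>m\<ge>M. \<forall>n\<ge>M. dist (X m) (X n) < e * d"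
        using metric_CauchyD[OF \<open>Cauchy X\<close>, of "e * d"] d by auto
      then have "dist (c m) (c n) * d < e * d" if "m \<ge> M" "n \<ge> M" for m n
        using c_dist[of m n] that by (simp add: le_less_trans)
      then show "\<exists>M. \<forall>m\<ge>M. \<forall>n\<ge>M. dist (c m) (c n) < e"
        using d by auto
    qed
    then obtain z where "c \<longlonglongrightarrow> z"
      by (auto simp: Cauchy_convergent_iff convergent_def)
    then have "(\<lambda>n. X n - c n *\<^sub>C 1) \<longlonglongrightarrow> T - z *\<^sub>C 1"
      by (intro tendsto_diff lim bounded_linear.tendsto[OF bounded_linear_scaleC_left])
    moreover have "X n - c n *\<^sub>C 1 \<in> range mult_embed" for n
      by (simp add: X)
    ultimately have "T - z *\<^sub>C 1 \<in> range mult_embed"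
      by (rule closed_sequentially[OF closed_range_embed, rotated])
    then obtain b where "T - z *\<^sub>C 1 = mult_embed b"
      by blast
    then have "T = mult_embed b + z *\<^sub>C 1"
      by (simp add: algebra_simps)
    then show "T \<in> ?U"
      by blast
  qed
qed

text \<open>
  For nonunital \<open>A\<close> the sum \<open>A + \<complex>1\<close> inside the multiplier algebra is the minimal unitization,
  with its unique C*-norm. (For unital \<open>A\<close> it is a copy of \<open>A\<close>.)
\<close>

typedef (overloaded) 'a unitization =
    "{T :: 'a::cstar_algebra multiplier. \<exists>a c. T = mult_embed a + c *\<^sub>C 1}"
  by blast

setup_lifting type_definition_unitization

instantiation unitization :: (cstar_algebra) complex_star_algebra
begin

lift_definition zero_unitization :: "'a unitization" is 0
  by (rule exI[of _ 0], rule exI[of _ 0]) (simp add: embed_zero scaleC_zero_left)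

lift_definition plus_unitization :: "'a unitization \<Rightarrow> 'a unitization \<Rightarrow> 'a unitization" is "(+)"
proof (elim exE)
  fix S T :: "'a multiplier" and a b c d
  assume "S = mult_embed a + c *\<^sub>C 1" "T = mult_embed b + d *\<^sub>C 1"
  then have "S + T = mult_embed (a + b) + (c + d) *\<^sub>C 1"
    by (simp add: embed_add scaleC_add_left algebra_simps)
  then show "\<exists>a c. S + T = mult_embed a + c *\<^sub>C 1" by blast
qed

lift_definition uminus_unitization :: "'a unitization \<Rightarrow> 'a unitization" is uminus
proof (elim exE)
  fix T :: "'a multiplier" and a c
  assume "T = mult_embed a + c *\<^sub>C 1"
  then have "- T = mult_embed (- a) + (- c) *\<^sub>C 1"
    by (simp add: embed_minus scaleC_minus_left)
  then show "\<exists>a c. - T = mult_embed a + c *\<^sub>C 1" by blast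
qed

lift_definition minus_unitization :: "'a unitization \<Rightarrow> 'a unitization \<Rightarrow> 'a unitization" is "(-)"
proof (elim exE)
  fix S T :: "'a multiplier" and a b c d
  assume "S = mult_embed a + c *\<^sub>C 1" "T = mult_embed b + d *\<^sub>C 1"
  then have "S - T = mult_embed (a - b) + (c - d) *\<^sub>C 1"
    by (simp add: embed_diff scaleC_diff_left algebra_simps)
  then show "\<exists>a c. S - T = mult_embed a + c *\<^sub>C 1" by blast
qed

lift_definition times_unitization :: "'a unitization \<Rightarrow> 'a unitization \<Rightarrow> 'a unitization" is "(*)"
proof (elim exE)
  fix S T :: "'a multiplier" and a b c d
  assume "S = mult_embed a + c *\<^sub>C 1" "T = mult_embed b + d *\<^sub>C 1"
  then have "S * T = mult_embed (a * b + d *\<^sub>C a + c *\<^sub>C b) + (c * d) *\<^sub>C 1"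
    by (simp add: embed_add embed_mult embed_scaleC distrib_left distrib_right mult_scaleC_left
        mult_scaleC_right scaleC_add_right scaleC_scaleC add_ac mult.commute[of c d])
  then show "\<exists>a c. S * T = mult_embed a + c *\<^sub>C 1" by blast
qed

lift_definition scaleC_unitization :: "complex \<Rightarrow> 'a unitization \<Rightarrow> 'a unitization" is scaleC
proof (elim exE)
  fix T :: "'a multiplier" and z a c
  assume "T = mult_embed a + c *\<^sub>C 1"
  then have "z *\<^sub>C T = mult_embed (z *\<^sub>C a) + (z * c) *\<^sub>C 1"
    by (simp add: embed_scaleC scaleC_add_right scaleC_scaleC)
  then show "\<exists>a c. z *\<^sub>C T = mult_embed a + c *\<^sub>C 1" by blast
qed

lift_definition star_unitization :: "'a unitization \<Rightarrow> 'a unitization" is star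
proof (elim exE)
  fix T :: "'a multiplier" and a c
  assume T: "T = mult_embed a + c *\<^sub>C 1"
  have "star (1 :: 'a multiplier) = 1"
    by (rule multiplier_eqI)
      (simp_all add: mult_left_star mult_right_star mult_left_one mult_right_one star_star)
  then have "star T = mult_embed (star a) + cnj c *\<^sub>C 1"
    by (simp add: T embed_star star_add star_scaleC)
  then show "\<exists>a c. star T = mult_embed a + c *\<^sub>C 1" by blast
qed

instance
  by standard
    (transfer; simp add: scaleC_add_right scaleC_add_left
      scaleC_scaleC scaleC_one star_star star_add star_scaleC star_mult mult_scaleC_left
      mult_scaleC_right algebra_simps)+

end

instantiation unitization :: (cstar_algebra) real_normed_vector
begin

definition scaleR_unitization :: "real \<Rightarrow> 'a unitization \<Rightarrow> 'a unitization" where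
  "scaleR_unitization r x = complex_of_real r *\<^sub>C x"

lift_definition norm_unitization :: "'a unitization \<Rightarrow> real" is norm .

definition dist_unitization :: "'a unitization \<Rightarrow> 'a unitization \<Rightarrow> real" where
  "dist_unitization x y = norm (x - y)"

definition sgn_unitization :: "'a unitization \<Rightarrow> 'a unitization" where
  "sgn_unitization x = inverse (norm x) *\<^sub>R x"

definition uniformity_unitization :: "('a unitization \<times> 'a unitization) filter" where
  "uniformity_unitization = (INF e\<in>{0<..}. principal {(x, y). dist x y < e})"

definition open_unitization :: "'a unitization set \<Rightarrow> bool" where
  "open_unitization U \<longleftrightarrow>
     (\<forall>x\<in>U. eventually (\<lambda>(x', y). x' = x \<longrightarrow> y \<in> U) uniformity)"

instance
proof
  fix x y :: "'a unitization" and r s :: real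
  show "norm x = 0 \<longleftrightarrow> x = 0"
    by transfer simp
  show "norm (x + y) \<le> norm x + norm y"
    by transfer (rule norm_triangle_ineq)
  show "norm (r *\<^sub>R x) = \<bar>r\<bar> * norm x"
    unfolding scaleR_unitization_def by transfer (simp add: norm_scaleC)
  show "r *\<^sub>R (x + y) = r *\<^sub>R x + r *\<^sub>R y" "(r + s) *\<^sub>R x = r *\<^sub>R x + s *\<^sub>R x"
    "r *\<^sub>R s *\<^sub>R x = (r * s) *\<^sub>R x" "1 *\<^sub>R x = x"
    by (simp_all add: scaleR_unitization_def scaleC_add_right scaleC_add_left scaleC_scaleC
        scaleC_one)
qed (fact dist_unitization_def sgn_unitization_def uniformity_unitization_def
      open_unitization_def)+

end

instance unitization :: (cstar_algebra) cstar_algebra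
proof
  fix x y :: "'a unitization" and r :: real and c :: complex
  show "r *\<^sub>R x * y = r *\<^sub>R (x * y)" "x * r *\<^sub>R y = r *\<^sub>R (x * y)"
    by (simp_all add: scaleR_unitization_def mult_scaleC_left mult_scaleC_right)
  show "norm (x * y) \<le> norm x * norm y"
    by transfer (rule norm_mult_ineq)
  show "r *\<^sub>R x = complex_of_real r *\<^sub>C x"
    by (rule scaleR_unitization_def)
  show "norm (c *\<^sub>C x) = cmod c * norm x"
    by transfer (rule norm_scaleC)
  show "norm (star x * x) = (norm x)\<^sup>2"
    by transfer (rule cstar_identity)
next
  fix X :: "nat \<Rightarrow> 'a unitization"
  assume X: "Cauchy X"
  have dist_Rep: "dist x y = dist (Rep_unitization x) (Rep_unitization y)" for x y :: "'a unitization"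
    by (simp add: dist_norm norm_unitization.rep_eq minus_unitization.rep_eq)
  have "Cauchy (\<lambda>n. Rep_unitization (X n))"
    using X by (simp add: Cauchy_def dist_Rep)
  then obtain T where T: "(\<lambda>n. Rep_unitization (X n)) \<longlonglongrightarrow> T"
    by (auto simp: Cauchy_convergent_iff convergent_def)
  have "T \<in> {T. \<exists>a c. T = mult_embed a + c *\<^sub>C 1}"
    by (rule closed_sequentially[OF closed_embed_plus_scalars Rep_unitization T])
  then have "Rep_unitization (Abs_unitization T) = T"
    by (rule Abs_unitization_inverse)
  then have "X \<longlonglongrightarrow> Abs_unitization T"
    using T unfolding tendsto_dist_iff[of X] tendsto_dist_iff[of "\<lambda>n. Rep_unitization (X n)"]
    by (simp add: dist_Rep)
  then show "convergent X"
    by (auto simp: convergent_def)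
qed


section \<open>Real rank and extension real rank\<close>

definition selfadjoint :: "'a::complex_star_algebra \<Rightarrow> bool" where
  "selfadjoint x \<longleftrightarrow> star x = x"

text \<open>The zero algebra is unital with identity \<open>0\<close>, and \<open>0\<close> is invertible in it.\<close>

definition is_identity :: "'a::complex_star_algebra \<Rightarrow> bool" where
  "is_identity e \<longleftrightarrow> (\<forall>x. e * x = x \<and> x * e = x)"

definition unital :: "'a::complex_star_algebra itself \<Rightarrow> bool" where
  "unital TYPE('a) \<longleftrightarrow> (\<exists>e :: 'a. is_identity e)"

definition alg_invertible :: "'a::complex_star_algebra \<Rightarrow> bool" where
  "alg_invertible x \<longleftrightarrow> (\<exists>e y. is_identity e \<and> x * y = e \<and> y * x = e)"

definition sa_tuples :: "nat \<Rightarrow> (nat \<Rightarrow> 'a::complex_star_algebra) set" where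
  "sa_tuples n = {..<n} \<rightarrow>\<^sub>E {x. selfadjoint x}"

definition Lg :: "nat \<Rightarrow> (nat \<Rightarrow> 'a::complex_star_algebra) set" where
  "Lg n = {a \<in> sa_tuples n. alg_invertible (\<Sum>k<n. a k * a k)}"

definition sa_tuples_topology :: "nat \<Rightarrow> (nat \<Rightarrow> 'a::cstar_algebra) topology" where
  "sa_tuples_topology n = product_topology (\<lambda>_. top_of_set {x. selfadjoint x}) {..<n}"

definition Lg_dense :: "'a::cstar_algebra itself \<Rightarrow> nat \<Rightarrow> bool" where
  "Lg_dense TYPE('a) n \<longleftrightarrow>
     sa_tuples_topology n closure_of (Lg n :: (nat \<Rightarrow> 'a) set) = sa_tuples n"

lemma topspace_sa_tuples_topology: "topspace (sa_tuples_topology n) = sa_tuples n"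
  by (simp add: sa_tuples_topology_def sa_tuples_def)

lemma Lg_dense_iff:
  "Lg_dense TYPE('a::cstar_algebra) n \<longleftrightarrow>
     (\<forall>a \<in> sa_tuples n. \<forall>\<epsilon>>0. \<exists>b \<in> Lg n. \<forall>k<n. norm (a k - b k :: 'a) < \<epsilon>)" (is "_ \<longleftrightarrow> ?R")
proof
  assume dense: "Lg_dense TYPE('a) n"
  show ?R
  proof (intro ballI allI impI)
    fix a :: "nat \<Rightarrow> 'a" and \<epsilon> :: real
    assume a: "a \<in> sa_tuples n" and \<epsilon>: "\<epsilon> > 0"
    let ?U = "Pi\<^sub>E {..<n} (\<lambda>k. {x. selfadjoint x} \<inter> ball (a k) \<epsilon>)"
    have "openin (sa_tuples_topology n) ?U"
      unfolding sa_tuples_topology_def by (simp add: openin_PiE openin_open_Int)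
    moreover have "a \<in> ?U"
      using a \<epsilon> by (auto simp: sa_tuples_def PiE_iff)
    moreover have "a \<in> sa_tuples_topology n closure_of Lg n"
      using dense a by (simp add: Lg_dense_def)
    ultimately obtain b where "b \<in> Lg n" "b \<in> ?U"
      unfolding in_closure_of by blast
    then show "\<exists>b \<in> Lg n. \<forall>k<n. norm (a k - b k) < \<epsilon>"
      by (auto simp: PiE_iff dist_norm)
  qed
next
  assume R: ?R
  have "a \<in> sa_tuples_topology n closure_of Lg n" if a: "a \<in> sa_tuples n" for a :: "nat \<Rightarrow> 'a"
    unfolding in_closure_of
  proof (intro conjI allI impI)
    show "a \<in> topspace (sa_tuples_topology n)"
      using a by (simp add: topspace_sa_tuples_topology)
    fix W assume W: "a \<in> W \<and> openin (sa_tuples_topology n) W"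
    then obtain U where U: "\<forall>k\<in>{..<n}. openin (top_of_set {x. selfadjoint x}) (U k)"
      and aU: "a \<in> Pi\<^sub>E {..<n} U" and UW: "Pi\<^sub>E {..<n} U \<subseteq> W"
      unfolding sa_tuples_topology_def openin_product_topology_alt by blast
    have "\<exists>e>0. \<forall>x. selfadjoint x \<and> dist x (a k) < e \<longrightarrow> x \<in> U k" if "k < n" for k
    proof -
      have "openin (top_of_set {x. selfadjoint x}) (U k)" and "a k \<in> U k"
        using U PiE_mem[OF aU] that by auto
      then show ?thesis
        unfolding openin_euclidean_subtopology_iff by blast
    qed
    then obtain e where e: "\<And>k. k < n \<Longrightarrow> e k > 0"
        "\<And>k x. k < n \<Longrightarrow> selfadjoint x \<Longrightarrow> dist x (a k) < e k \<Longrightarrow> x \<in> U k"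
      by metis
    define \<epsilon> where "\<epsilon> = Min (insert 1 (e ` {..<n}))"
    have "\<epsilon> > 0" and \<epsilon>: "\<And>k. k < n \<Longrightarrow> \<epsilon> \<le> e k"
      using e(1) by (auto simp: \<epsilon>_def)
    then obtain b where b: "b \<in> Lg n" "\<forall>k<n. norm (a k - b k) < \<epsilon>"
      using R a by blast
    have "b \<in> Pi\<^sub>E {..<n} U"
    proof (rule PiE_I)
      fix k assume "k \<in> {..<n}"
      then have k: "k < n"
        by simp
      have "dist (b k) (a k) < e k"
        using b(2)[rule_format, OF k] \<epsilon>[OF k] by (simp add: dist_norm norm_minus_commute)
      moreover have "selfadjoint (b k)"
        using b(1) k by (auto simp: Lg_def sa_tuples_def PiE_iff)
      ultimately show "b k \<in> U k"
        using e(2)[OF k] by simp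
    next
      fix k assume "k \<notin> {..<n}"
      then show "b k = undefined"
        using b(1) by (auto simp: Lg_def sa_tuples_def PiE_iff extensional_def)
    qed
    then show "\<exists>b. b \<in> Lg n \<and> b \<in> W"
      using b(1) UW by blast
  qed
  then show "Lg_dense TYPE('a) n"
    using closure_of_subset_topspace[of "sa_tuples_topology n"]
    by (auto simp: Lg_dense_def topspace_sa_tuples_topology)
qed

definition unital_real_rank :: "'a::cstar_algebra itself \<Rightarrow> enat" where
  "unital_real_rank TYPE('a) =
     (if \<exists>n. Lg_dense TYPE('a) (Suc n) then enat (LEAST n. Lg_dense TYPE('a) (Suc n)) else \<infinity>)"

definition real_rank :: "'a::cstar_algebra itself \<Rightarrow> enat" where
  "real_rank TYPE('a) =
     (if unital TYPE('a) then unital_real_rank TYPE('a)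
      else unital_real_rank TYPE('a unitization))"

definition property_Lambda :: "'a::cstar_algebra itself \<Rightarrow> nat \<Rightarrow> bool" where
  "property_Lambda TYPE('a) n \<longleftrightarrow>
     (\<forall>a \<in> (sa_tuples (Suc n) :: (nat \<Rightarrow> 'a multiplier) set).
        (\<lambda>k\<in>{..<Suc n}. corona_proj (a k)) \<in> Lg (Suc n) \<longrightarrow>
        (\<forall>\<epsilon>>0. \<exists>b \<in> Lg (Suc n). \<forall>j<Suc n.
           norm (a j - b j) < \<epsilon> \<and> corona_proj (a j) = corona_proj (b j)))"

definition ext_real_rank :: "'a::cstar_algebra itself \<Rightarrow> enat" where
  "ext_real_rank TYPE('a) =
     (if \<exists>n. \<forall>m\<ge>n. property_Lambda TYPE('a) m
      then enat (LEAST n. \<forall>m\<ge>n. property_Lambda TYPE('a) m) else \<infinity>)"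

end

theory Submission
  imports Defs
begin

text \<open>
  Every statement about the real rank of \<open>A\<close> is moved to \<open>A\<^sup>+ = A \<oplus> \<complex>\<close>, a unit being adjoined even if
  \<open>A\<close> is already unital. Density of tuples with invertible sum of squares passes to quotients since
  *-homomorphisms are contractive. It passes to an ideal because a tuple in \<open>E\<^sup>+\<close> that is close to
  one in \<open>A\<^sup>+\<close> can be moved back into \<open>A\<^sup>+\<close> by a conjugation and a shear that both preserve
  invertibility of the sum of squares. For the upper bound, a tuple is first perturbed modulo \<open>A\<close>;
  property \<open>(\<Lambda>\<^sub>n)\<close> then repairs its image in \<open>M(A)\<close> under the Busby map without changing it modulo \<open>A\<close>,
  and \<open>E\<^sup>+\<close> is the pullback of \<open>B\<^sup>+\<close> and \<open>M(A)\<close> over \<open>M(A)/A\<close>.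

  No spectral theory is used. Square roots come from the power series of \<open>\<surd>(1 - x)\<close>, and norm estimates
  from the fact that \<open>a + \<i>c\<close> is unitary if \<open>a\<close>, \<open>c\<close> are commuting and self-adjoint with \<open>a\<^sup>2 + c\<^sup>2 = 1\<close>.
\<close>

section \<open>Adjoining a unit\<close>

text \<open>Adjoining a unit to every algebra treats all combinations of unital and nonunital A, E,
  B alike: the quotient of E^+ by A is always B^+, and every map in play becomes unital. The
  obstacle in the ideal half is that a tuple in E^+ near A^+ has only nearly scalar entries in B^+.
  So entry 0 is first given a nonzero scalar part t. Once its image modulo A is exactly t,
  multiplying by it on both sides reaches, modulo A, every correction that the other entries
  require, and the square of such a correction is dominated by a multiple of the square of entry 0.
  Domination needs an order, and at the start only squares of self-adjoint elements are known to be
  positive. An element such as \<open>y * r * y\<close> is of the form \<open>star x * x\<close>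
  with \<open>x\<close> not self-adjoint, which is why its positivity takes a deformation argument.
  The norm of B is not defined as a quotient norm. A small difference in B^+ therefore has to be
  lifted to E^+ with norm control by a construction of its own, which imitates the formula for the
  sine in terms of the tangent of the half angle.\<close>

datatype 'a adjoined = Adjoin (body: 'a) (scalar: complex)

instantiation adjoined :: (cstar_algebra) complex_star_algebra
begin

definition zero_adjoined :: "'a adjoined" where "zero_adjoined = Adjoin 0 0"

definition plus_adjoined :: "'a adjoined \<Rightarrow> 'a adjoined \<Rightarrow> 'a adjoined" where
  "x + y = Adjoin (body x + body y) (scalar x + scalar y)"

definition uminus_adjoined :: "'a adjoined \<Rightarrow> 'a adjoined" where
  "- x = Adjoin (- body x) (- scalar x)"

definition minus_adjoined :: "'a adjoined \<Rightarrow> 'a adjoined \<Rightarrow> 'a adjoined" where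
  "x - y = Adjoin (body x - body y) (scalar x - scalar y)"

definition times_adjoined :: "'a adjoined \<Rightarrow> 'a adjoined \<Rightarrow> 'a adjoined" where
  "x * y = Adjoin (body x * body y + scalar x *\<^sub>C body y + scalar y *\<^sub>C body x)
     (scalar x * scalar y)"

definition scaleC_adjoined :: "complex \<Rightarrow> 'a adjoined \<Rightarrow> 'a adjoined" where
  "c *\<^sub>C x = Adjoin (c *\<^sub>C body x) (c * scalar x)"

definition star_adjoined :: "'a adjoined \<Rightarrow> 'a adjoined" where
  "star x = Adjoin (star (body x)) (cnj (scalar x))"

lemmas adjoined_defs = zero_adjoined_def plus_adjoined_def uminus_adjoined_def minus_adjoined_def
  times_adjoined_def scaleC_adjoined_def star_adjoined_def

instance
  by standard
    (auto simp: adjoined_defs algebra_simps scaleC_add_right scaleC_add_left scaleC_scaleC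
      scaleC_one mult_scaleC_left mult_scaleC_right star_star star_add star_mult star_scaleC
      scaleC_minus_right scaleC_diff_right)

end

lemma
  fixes x :: "'a::cstar_algebra adjoined"
  shows body_zero [simp]: "body 0 = 0"
    and body_plus [simp]: "body (x + y) = body x + body y"
    and body_minus [simp]: "body (x - y) = body x - body y"
    and body_times: "body (x * y) = body x * body y + scalar x *\<^sub>C body y + scalar y *\<^sub>C body x"
    and body_scaleC [simp]: "body (c *\<^sub>C x) = c *\<^sub>C body x"
    and body_star [simp]: "body (star x) = star (body x)"
    and scalar_zero [simp]: "scalar 0 = 0"
    and scalar_plus [simp]: "scalar (x + y) = scalar x + scalar y"
    and scalar_minus [simp]: "scalar (x - y) = scalar x - scalar y"
    and scalar_times [simp]: "scalar (x * y) = scalar x * scalar y"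
    and scalar_scaleC [simp]: "scalar (c *\<^sub>C x) = c * scalar x"
    and scalar_star [simp]: "scalar (star x) = cnj (scalar x)"
  by (simp_all add: adjoined_defs)

definition adjoined_to_multiplier :: "'a::cstar_algebra adjoined \<Rightarrow> 'a multiplier" where
  "adjoined_to_multiplier x = mult_embed (body x) + scalar x *\<^sub>C 1"

lemma star_one: "star 1 = (1 :: 'a::{complex_star_algebra, monoid_mult})"
proof -
  have "star 1 = star (1 * star (star 1)) * (1::'a)"
    by (simp add: star_star)
  also have "\<dots> = 1"
    by (metis mult_1_left mult_1_right star_mult star_star)
  finally show ?thesis .
qed

lemma
  shows adjoined_to_multiplier_add:
      "adjoined_to_multiplier (x + y) = adjoined_to_multiplier x + adjoined_to_multiplier y"
    and adjoined_to_multiplier_mult: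
      "adjoined_to_multiplier (x * y) = adjoined_to_multiplier x * adjoined_to_multiplier y"
    and adjoined_to_multiplier_scaleC:
      "adjoined_to_multiplier (c *\<^sub>C x) = c *\<^sub>C adjoined_to_multiplier x"
    and adjoined_to_multiplier_star:
      "adjoined_to_multiplier (star x) = star (adjoined_to_multiplier x)"
  by (simp_all add: adjoined_to_multiplier_def body_times embed_add embed_mult embed_scaleC
      embed_star star_add star_scaleC star_one scaleC_add_right scaleC_add_left scaleC_scaleC
      mult_scaleC_left mult_scaleC_right distrib_left distrib_right algebra_simps)

lemma norm_one_multiplier_le: "norm (1 :: 'a::cstar_algebra multiplier) \<le> 1"
  by (rule norm_multiplier_bound) (simp_all add: mult_left_one)

instantiation adjoined :: (cstar_algebra) real_normed_vector
begin

definition scaleR_adjoined :: "real \<Rightarrow> 'a adjoined \<Rightarrow> 'a adjoined" where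
  "scaleR_adjoined r x = complex_of_real r *\<^sub>C x"

text \<open>The norm of \<open>M(A) \<oplus> \<complex>\<close>; the second component is what keeps it a norm for unital \<open>A\<close>.\<close>

definition norm_adjoined :: "'a adjoined \<Rightarrow> real" where
  "norm_adjoined x = max (norm (adjoined_to_multiplier x)) (cmod (scalar x))"

definition dist_adjoined :: "'a adjoined \<Rightarrow> 'a adjoined \<Rightarrow> real" where
  "dist_adjoined x y = norm (x - y)"

definition sgn_adjoined :: "'a adjoined \<Rightarrow> 'a adjoined" where
  "sgn_adjoined x = inverse (norm x) *\<^sub>R x"

definition uniformity_adjoined :: "('a adjoined \<times> 'a adjoined) filter" where
  "uniformity_adjoined = (INF e\<in>{0<..}. principal {(x, y). dist x y < e})"

definition open_adjoined :: "'a adjoined set \<Rightarrow> bool" where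
  "open_adjoined U \<longleftrightarrow>
     (\<forall>x\<in>U. eventually (\<lambda>(x', y). x' = x \<longrightarrow> y \<in> U) uniformity)"

instance
proof
  fix x y :: "'a adjoined" and r s :: real
  show "norm x = 0 \<longleftrightarrow> x = 0"
  proof
    assume "norm x = 0"
    then have "cmod (scalar x) \<le> 0" "norm (adjoined_to_multiplier x) \<le> 0"
      unfolding norm_adjoined_def by (metis max.cobounded2, metis max.cobounded1)
    then have "scalar x = 0" "mult_embed (body x) = 0"
      by (auto simp: adjoined_to_multiplier_def scaleC_zero_left)
    then show "x = 0"
      by (metis adjoined.collapse norm_eq_zero norm_embed zero_adjoined_def)
  qed (simp add: norm_adjoined_def adjoined_to_multiplier_def embed_zero scaleC_zero_left)
  show "norm (x + y) \<le> norm x + norm y"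
    using norm_triangle_ineq[of "adjoined_to_multiplier x" "adjoined_to_multiplier y"]
      norm_triangle_ineq[of "scalar x" "scalar y"]
    unfolding norm_adjoined_def adjoined_to_multiplier_add scalar_plus by linarith
  show "norm (r *\<^sub>R x) = \<bar>r\<bar> * norm x"
    by (simp add: norm_adjoined_def scaleR_adjoined_def adjoined_to_multiplier_scaleC norm_scaleC
        norm_mult max_mult_distrib_left)
  show "r *\<^sub>R (x + y) = r *\<^sub>R x + r *\<^sub>R y" "(r + s) *\<^sub>R x = r *\<^sub>R x + s *\<^sub>R x"
    "r *\<^sub>R s *\<^sub>R x = (r * s) *\<^sub>R x" "1 *\<^sub>R x = x"
    by (simp_all add: scaleR_adjoined_def scaleC_add_right scaleC_add_left scaleC_scaleC
        scaleC_one)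
qed (fact dist_adjoined_def sgn_adjoined_def uniformity_adjoined_def open_adjoined_def)+

end

lemma
  fixes x :: "'a::cstar_algebra adjoined"
  shows body_scaleR [simp]: "body (r *\<^sub>R x) = r *\<^sub>R body x"
    and scalar_scaleR [simp]: "scalar (r *\<^sub>R x) = r *\<^sub>R scalar x"
  by (simp_all add: scaleR_adjoined_def scaleR_scaleC scaleC_complex_def)

lemma norm_scalar_le: "cmod (scalar x) \<le> norm x"
  and norm_adjoined_to_multiplier_le: "norm (adjoined_to_multiplier x) \<le> norm x"
  by (simp_all add: norm_adjoined_def)

text \<open>Together with \<open>norm_adjoined_le\<close> and \<open>norm_scalar_le\<close> this
  makes the norm equivalent to the sum of the norms of the two components, which yields
  completeness.\<close>

lemma norm_body_le: "norm (body x) \<le> 2 * norm x"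
proof -
  have "norm (body x) = norm (adjoined_to_multiplier x - scalar x *\<^sub>C 1)"
    by (simp add: adjoined_to_multiplier_def norm_embed)
  also have "\<dots> \<le> norm (adjoined_to_multiplier x) + cmod (scalar x) * norm (1 :: 'a multiplier)"
    by (rule order_trans[OF norm_triangle_ineq4]) (simp add: norm_scaleC)
  also have "\<dots> \<le> norm x + norm x * 1"
    by (intro add_mono mult_mono norm_adjoined_to_multiplier_le norm_scalar_le
        norm_one_multiplier_le) auto
  finally show ?thesis by simp
qed

lemma norm_adjoined_le: "norm x \<le> norm (body x) + cmod (scalar x)"
proof -
  have "norm (adjoined_to_multiplier x) \<le> norm (body x) + cmod (scalar x) * norm (1 :: 'a multiplier)"
    unfolding adjoined_to_multiplier_def
    by (rule order_trans[OF norm_triangle_ineq]) (simp add: norm_embed norm_scaleC)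
  also have "\<dots> \<le> norm (body x) + cmod (scalar x)"
    using mult_left_mono[OF norm_one_multiplier_le, of "cmod (scalar x)"] by simp
  finally show ?thesis
    by (simp add: norm_adjoined_def)
qed

lemma norm_Adjoin_zero: "norm (Adjoin a 0) = norm a"
  by (simp add: norm_adjoined_def adjoined_to_multiplier_def scaleC_zero_left norm_embed)

instance adjoined :: (cstar_algebra) cstar_algebra
proof
  fix x y :: "'a adjoined" and r :: real and c :: complex
  show "r *\<^sub>R x * y = r *\<^sub>R (x * y)" "x * r *\<^sub>R y = r *\<^sub>R (x * y)"
    by (simp_all add: scaleR_adjoined_def mult_scaleC_left mult_scaleC_right)
  show "norm (x * y) \<le> norm x * norm y"
    unfolding norm_adjoined_def[of "x * y"] adjoined_to_multiplier_mult scalar_times norm_mult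
    by (intro max.boundedI order_trans[OF norm_mult_ineq] mult_mono
        norm_adjoined_to_multiplier_le norm_scalar_le norm_ge_zero)
  show "r *\<^sub>R x = complex_of_real r *\<^sub>C x"
    by (rule scaleR_adjoined_def)
  show "norm (c *\<^sub>C x) = cmod c * norm x"
    by (simp add: norm_adjoined_def adjoined_to_multiplier_scaleC norm_scaleC norm_mult
        max_mult_distrib_left)
  have "max (a\<^sup>2) (b\<^sup>2) = (max a b)\<^sup>2" if "a \<ge> 0" "b \<ge> 0" for a b :: real
    using that by (auto simp: max_def power_mono_iff)
  then show "norm (star x * x) = (norm x)\<^sup>2"
    by (simp add: norm_adjoined_def adjoined_to_multiplier_mult adjoined_to_multiplier_star
        cstar_identity norm_mult power2_eq_square[of "cmod _", symmetric])
next
  fix X :: "nat \<Rightarrow> 'a adjoined"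
  assume X: "Cauchy X"
  have "Cauchy (\<lambda>n. body (X n))"
    unfolding Cauchy_def
  proof (intro allI impI)
    fix e :: real assume "e > 0"
    then obtain M where M: "\<forall>m\<ge>M. \<forall>n\<ge>M. dist (X m) (X n) < e / 2"
      using metric_CauchyD[OF X, of "e / 2"] by auto
    have "dist (body (X m)) (body (X n)) < e" if "m \<ge> M" "n \<ge> M" for m n
      using norm_body_le[of "X m - X n"] M that by (fastforce simp: dist_norm)
    then show "\<exists>M. \<forall>m\<ge>M. \<forall>n\<ge>M. dist (body (X m)) (body (X n)) < e"
      by blast
  qed
  then obtain a where a: "(\<lambda>n. body (X n)) \<longlonglongrightarrow> a"
    by (auto simp: Cauchy_convergent_iff convergent_def)
  have "Cauchy (\<lambda>n. scalar (X n))"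
    unfolding Cauchy_def
  proof (intro allI impI)
    fix e :: real assume "e > 0"
    then obtain M where M: "\<forall>m\<ge>M. \<forall>n\<ge>M. dist (X m) (X n) < e"
      using metric_CauchyD[OF X, of e] by auto
    have "dist (scalar (X m)) (scalar (X n)) < e" if "m \<ge> M" "n \<ge> M" for m n
      using norm_scalar_le[of "X m - X n"] M that by (fastforce simp: dist_norm)
    then show "\<exists>M. \<forall>m\<ge>M. \<forall>n\<ge>M. dist (scalar (X m)) (scalar (X n)) < e"
      by blast
  qed
  then obtain c where c: "(\<lambda>n. scalar (X n)) \<longlonglongrightarrow> c"
    by (auto simp: Cauchy_convergent_iff convergent_def)
  have "(\<lambda>n. norm (body (X n) - a) + cmod (scalar (X n) - c)) \<longlonglongrightarrow> 0"
    using tendsto_add[OF tendsto_norm[OF LIM_zero[OF a]] tendsto_norm[OF LIM_zero[OF c]]] by simp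
  then have "(\<lambda>n. norm (X n - Adjoin a c)) \<longlonglongrightarrow> 0"
    by (rule Lim_null_comparison[rotated])
      (use norm_adjoined_le[of "X _ - Adjoin a c"] in simp)
  then have "X \<longlonglongrightarrow> Adjoin a c"
    by (rule LIM_zero_cancel[OF tendsto_norm_zero_cancel])
  then show "convergent X"
    by (auto simp: convergent_def)
qed

instantiation adjoined :: (cstar_algebra) real_normed_algebra_1
begin

definition one_adjoined :: "'a adjoined" where "one_adjoined = Adjoin 0 1"

instance
proof
  fix x :: "'a adjoined"
  show "1 * x = x" "x * 1 = x"
    by (simp_all add: one_adjoined_def times_adjoined_def scaleC_one scaleC_zero_right)
  show "(0 :: 'a adjoined) \<noteq> 1"
    by (simp add: one_adjoined_def zero_adjoined_def)
  show "norm (1 :: 'a adjoined) = 1"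
    by (simp add: norm_adjoined_def one_adjoined_def adjoined_to_multiplier_def embed_zero
        scaleC_one norm_one_multiplier_le max_absorb2)
qed

end

lemma body_one [simp]: "body 1 = 0" and scalar_one [simp]: "scalar 1 = 1"
  by (simp_all add: one_adjoined_def)

section \<open>Square roots and positivity in unital C*-algebras\<close>

lemma star_scaleR: "star (r *\<^sub>R x) = r *\<^sub>R star (x :: 'a::cstar_algebra)"
  by (simp add: scaleR_scaleC star_scaleC)

lemma star_power: "star (x ^ n) = star x ^ n"
  for x :: "'a::{complex_star_algebra, monoid_mult}"
  by (induction n) (simp_all add: star_one star_mult power_commutes)

lemma star_sum: "star (sum f A) = (\<Sum>k\<in>A. star (f k))"
  for f :: "_ \<Rightarrow> 'a::complex_star_algebra"
  by (induction A rule: infinite_finite_induct) (simp_all add: star_zero star_add)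

lemma
  shows selfadjoint_zero: "selfadjoint (0 :: 'a::complex_star_algebra)"
    and selfadjoint_one: "selfadjoint (1 :: 'b::{complex_star_algebra, monoid_mult})"
  by (simp_all add: selfadjoint_def star_zero star_one)

lemma
  fixes x y :: "'a::complex_star_algebra"
  assumes "selfadjoint x" "selfadjoint y"
  shows selfadjoint_add: "selfadjoint (x + y)"
    and selfadjoint_diff: "selfadjoint (x - y)"
    and selfadjoint_sandwich: "selfadjoint (x * y * x)"
    and selfadjoint_mult_commute: "x * y = y * x \<Longrightarrow> selfadjoint (x * y)"
  using assms by (simp_all add: selfadjoint_def star_add star_diff star_mult mult.assoc)

lemma
  fixes x :: "'a::complex_star_algebra"
  assumes "selfadjoint x"
  shows selfadjoint_minus: "selfadjoint (- x)"
    and selfadjoint_square: "selfadjoint (x * x)"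
  using assms by (simp_all add: selfadjoint_def star_minus star_mult)

lemma selfadjoint_star_mult_self: "selfadjoint (star x * x)"
  by (simp add: selfadjoint_def star_mult star_star)

lemma selfadjoint_scaleR: "selfadjoint x \<Longrightarrow> selfadjoint (r *\<^sub>R x)"
  for x :: "'a::cstar_algebra"
  by (simp add: selfadjoint_def star_scaleR)

lemma selfadjoint_sum: "(\<And>k. k \<in> A \<Longrightarrow> selfadjoint (f k)) \<Longrightarrow> selfadjoint (sum f A)"
  for f :: "_ \<Rightarrow> 'a::complex_star_algebra"
  by (simp add: selfadjoint_def star_sum)

lemmas selfadjoint_intros = selfadjoint_zero selfadjoint_one selfadjoint_add selfadjoint_diff
  selfadjoint_sandwich selfadjoint_minus selfadjoint_square selfadjoint_scaleR selfadjoint_sum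

lemma closed_selfadjoint: "closed {x :: 'a::cstar_algebra. selfadjoint x}"
  unfolding selfadjoint_def
  by (intro closed_Collect_eq linear_continuous_on bounded_linear_star continuous_on_id)

lemma norm_square_selfadjoint: "norm (x * x) = (norm x)\<^sup>2"
  if "selfadjoint x" for x :: "'a::cstar_algebra"
  using cstar_identity[of x] that by (simp add: selfadjoint_def)

section \<open>Neumann series and the power series of the square root\<close>

lemma Neumann_inverse:
  fixes x :: "'a::{real_normed_algebra_1, banach}"
  assumes "norm (1 - x) < 1"
  obtains y where "x * y = 1" "y * x = 1"
proof -
  define z where "z = 1 - x"
  have s: "summable (\<lambda>n. z ^ n)"
    using assms by (simp add: z_def complete_algebra_summable_geometric)
  have *: "(\<Sum>n. z ^ n) = 1 + (\<Sum>n. z ^ Suc n)"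
    using suminf_split_head[OF s] by simp
  have "z * (\<Sum>n. z ^ n) = (\<Sum>n. z ^ Suc n)" "(\<Sum>n. z ^ n) * z = (\<Sum>n. z ^ Suc n)"
    using suminf_mult[OF s, of z] suminf_mult2[OF s, of z] by (simp_all add: power_commutes)
  with * have "(1 - z) * (\<Sum>n. z ^ n) = 1" "(\<Sum>n. z ^ n) * (1 - z) = 1"
    by (simp_all add: left_diff_distrib right_diff_distrib)
  then show ?thesis
    using that by (simp add: z_def)
qed

text \<open>The Taylor coefficients of \<open>\<lambda>t. sqrt (1 - t)\<close>.\<close>

definition sqrt_coeff :: "nat \<Rightarrow> real" where
  "sqrt_coeff n = (1 / 2 gchoose n) * (- 1) ^ n"

lemma sqrt_coeff_0 [simp]: "sqrt_coeff 0 = 1"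
  by (simp add: sqrt_coeff_def)

lemma sqrt_coeff_Suc: "sqrt_coeff (Suc n) = sqrt_coeff n * ((real n - 1 / 2) / (real n + 1))"
proof -
  have "(1 / 2 gchoose Suc n) = (1 / 2 gchoose n) * ((1 / 2 - real n) / (real n + 1))"
    by (simp add: gbinomial_prod_rev lessThan_Suc field_simps atLeast0LessThan)
  then have "sqrt_coeff (Suc n) = sqrt_coeff n * - ((1 / 2 - real n) / (real n + 1))"
    unfolding sqrt_coeff_def power_Suc by (simp only: mult_ac mult_minus1 mult_minus_left mult_minus_right)
  also have "- ((1 / 2 - real n) / (real n + 1)) = (real n - 1 / 2) / (real n + 1)"
    unfolding minus_divide_left by simp
  finally show ?thesis .
qed

lemma sqrt_coeff_Suc_nonpos: "sqrt_coeff (Suc n) \<le> 0"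
proof (induction n)
  case (Suc n)
  then show ?case
    by (subst sqrt_coeff_Suc) (intro mult_nonpos_nonneg; simp)
qed (simp add: sqrt_coeff_Suc)

text \<open>These are the partial sums of the series at \<open>t = 1\<close>. The coefficient on the
  right is \<le> 0, so they are nonnegative; this bounds the absolute sum of all coefficients after
  the first by 1.\<close>

lemma sum_sqrt_coeff: "(\<Sum>n\<le>m. sqrt_coeff n) = - (2 * real (Suc m)) * sqrt_coeff (Suc m)"
proof (induction m)
  case (Suc m)
  have "- (2 * real (Suc (Suc m))) * sqrt_coeff (Suc (Suc m)) =
      - (2 * real m + 1) * sqrt_coeff (Suc m)"
    by (subst sqrt_coeff_Suc) (simp add: field_simps)
  then show ?case
    using Suc by (simp add: algebra_simps)
qed (simp add: sqrt_coeff_Suc)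

lemma sum_abs_sqrt_coeff_le: "(\<Sum>n<m. \<bar>sqrt_coeff (Suc n)\<bar>) \<le> 1"
proof -
  have "(\<Sum>n<m. \<bar>sqrt_coeff (Suc n)\<bar>) = 1 - (\<Sum>n\<le>m. sqrt_coeff n)"
    using sum.atMost_shift[of sqrt_coeff m] sqrt_coeff_Suc_nonpos
    by (simp add: sum_negf abs_of_nonpos)
  moreover have "0 \<le> (\<Sum>n\<le>m. sqrt_coeff n)"
    unfolding sum_sqrt_coeff by (intro mult_nonpos_nonpos sqrt_coeff_Suc_nonpos) simp
  ultimately show ?thesis by simp
qed

lemma summable_sqrt_coeff: "summable (\<lambda>n. \<bar>sqrt_coeff n\<bar>)"
  by (subst summable_Suc_iff[symmetric], rule summableI_nonneg_bounded[where x = 1])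
    (use sum_abs_sqrt_coeff_le in auto)

text \<open>Vandermonde for 1/2 + 1/2 = 1: the formal square of the series is the polynomial
  \<open>1 - t\<close>.\<close>

lemma sqrt_coeff_convolution:
  "(\<Sum>i\<le>n. sqrt_coeff i * sqrt_coeff (n - i)) = (if n = 0 then 1 else if n = 1 then - 1 else 0)"
proof -
  have "(\<Sum>i\<le>n. sqrt_coeff i * sqrt_coeff (n - i)) =
      (\<Sum>i\<le>n. (1 / 2 gchoose i) * (1 / 2 gchoose (n - i))) * (- 1) ^ n"
    unfolding sum_distrib_right
    by (rule sum.cong) (auto simp: sqrt_coeff_def power_add[symmetric])
  also have "(\<Sum>i\<le>n. (1 / 2 gchoose i) * (1 / 2 gchoose (n - i))) = ((1 :: real) gchoose n)"
    using gbinomial_Vandermonde[of "1 / 2 :: real" "1 / 2" n] by (simp add: atLeast0AtMost)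
  also have "((1 :: real) gchoose n) = real (1 choose n)"
    using binomial_gbinomial[of 1 n, where ?'a = real] by simp
  finally show ?thesis
    by (cases n rule: nat.exhaust; cases "n - 1") (auto simp: numeral_eq_Suc)
qed

text \<open>Absolutely summable coefficients let the series converge on the closed unit ball, so
  that normalized elements of norm exactly 1 are covered. The estimate on \<open>1 - q\<close> comes
  from taking one factor \<open>x\<close> out of each term after the first.\<close>

lemma sqrt_one_minus:
  fixes x :: "'a::{cstar_algebra, real_normed_algebra_1}"
  assumes x: "norm x \<le> 1" "selfadjoint x"
  obtains q where "selfadjoint q" "q * q = 1 - x" "norm (1 - q) \<le> norm x"
    "\<And>y. y * x = x * y \<Longrightarrow> y * q = q * y"
proof -
  define f where "f n = sqrt_coeff n *\<^sub>R x ^ n" for n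
  have pow: "norm (x ^ n) \<le> 1" for n
    using norm_power_ineq[of x n] power_le_one[OF norm_ge_zero x(1), of n] by linarith
  have nf: "norm (f n) \<le> \<bar>sqrt_coeff n\<bar>" for n
    using mult_left_mono[OF pow, of "\<bar>sqrt_coeff n\<bar>" n] by (simp add: f_def)
  have snf: "summable (\<lambda>n. norm (f n))"
    by (rule summable_comparison_test'[OF summable_sqrt_coeff, of 0]) (use nf in auto)
  then have sf: "summable f"
    by (rule summable_norm_cancel)
  define q where "q = suminf f"
  have star_f: "star (f n) = f n" for n
    using x(2) by (simp add: f_def star_scaleR star_power selfadjoint_def)
  have "star q = (\<Sum>n. star (f n))"
    unfolding q_def by (rule bounded_linear.suminf[OF bounded_linear_star sf])
  then have sa: "selfadjoint q"
    by (simp add: selfadjoint_def q_def star_f)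
  have conv: "(\<Sum>i\<le>n. f i * f (n - i)) = (\<Sum>i\<le>n. sqrt_coeff i * sqrt_coeff (n - i)) *\<^sub>R x ^ n" for n
    unfolding scaleR_sum_left by (rule sum.cong) (auto simp: f_def power_add[symmetric])
  have "q * q = (\<Sum>n. \<Sum>i\<le>n. f i * f (n - i))"
    unfolding q_def by (rule Cauchy_product[OF snf snf])
  also have "\<dots> = (\<Sum>n. (\<Sum>i\<le>n. sqrt_coeff i * sqrt_coeff (n - i)) *\<^sub>R x ^ n)"
    by (simp only: conv)
  also have "(\<Sum>n. (\<Sum>i\<le>n. sqrt_coeff i * sqrt_coeff (n - i)) *\<^sub>R x ^ n) =
      (\<Sum>n\<in>{0, 1}. (\<Sum>i\<le>n. sqrt_coeff i * sqrt_coeff (n - i)) *\<^sub>R x ^ n)"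
    unfolding sqrt_coeff_convolution by (rule suminf_finite) auto
  also have "\<dots> = 1 - x"
    unfolding sqrt_coeff_convolution by simp
  finally have qq: "q * q = 1 - x" .
  have "norm (f (Suc n)) \<le> \<bar>sqrt_coeff (Suc n)\<bar> * norm x" for n
  proof -
    have "norm (x ^ Suc n) \<le> norm x * norm (x ^ n)"
      by (simp add: norm_mult_ineq)
    also have "\<dots> \<le> norm x"
      using mult_left_mono[OF pow norm_ge_zero[of x]] by simp
    finally show ?thesis
      by (simp add: f_def mult_left_mono)
  qed
  note nS = this
  have sS: "summable (\<lambda>n. \<bar>sqrt_coeff (Suc n)\<bar>)"
    using summable_sqrt_coeff by (subst summable_Suc_iff)
  have "q = 1 + (\<Sum>n. f (Suc n))"
    using suminf_split_head[OF sf] by (simp add: q_def f_def)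
  then have "norm (1 - q) = norm (\<Sum>n. f (Suc n))"
    by (simp add: norm_minus_commute[of 1])
  also have "\<dots> \<le> (\<Sum>n. \<bar>sqrt_coeff (Suc n)\<bar> * norm x)"
    by (rule norm_suminf_le[OF nS summable_mult2[OF sS]])
  also have "\<dots> = (\<Sum>n. \<bar>sqrt_coeff (Suc n)\<bar>) * norm x"
    by (rule suminf_mult2[OF sS, symmetric])
  also have "\<dots> \<le> 1 * norm x"
    by (intro mult_right_mono suminf_le_const[OF sS] sum_abs_sqrt_coeff_le) simp
  finally have nq: "norm (1 - q) \<le> norm x"
    by simp
  have "y * q = q * y" if "y * x = x * y" for y
  proof -
    have "y * x ^ n = x ^ n * y" for n
      using that by (metis power_commuting_commutes)
    then have "y * f n = f n * y" for n
      by (simp add: f_def)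
    then show ?thesis
      unfolding q_def using suminf_mult[OF sf, of y] suminf_mult2[OF sf, of y] by simp
  qed
  with sa qq nq show ?thesis
    by (rule that)
qed

lemma sqrt_one_minus_square:
  fixes x :: "'a::{cstar_algebra, real_normed_algebra_1}"
  assumes x: "selfadjoint x" "norm x \<le> 1"
  obtains c where "selfadjoint c" "c * c = 1 - x * x" "norm (1 - c) \<le> (norm x)\<^sup>2" "x * c = c * x"
proof -
  have "norm (x * x) \<le> 1" "selfadjoint (x * x)"
    using x by (simp_all add: norm_square_selfadjoint power_le_one selfadjoint_square)
  then obtain c where "selfadjoint c" "c * c = 1 - x * x" "norm (1 - c) \<le> norm (x * x)"
      "\<And>y. y * (x * x) = x * x * y \<Longrightarrow> y * c = c * y"
    by (rule sqrt_one_minus) blast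
  then show ?thesis
    using that x by (simp add: norm_square_selfadjoint mult.assoc)
qed

lemma norm_le_one_if_squares_sum_one:
  fixes a c :: "'a::{cstar_algebra, real_normed_algebra_1}"
  assumes sa: "selfadjoint a" "selfadjoint c" and comm: "a * c = c * a" and sum: "a * a + c * c = 1"
  shows "norm a \<le> 1"
proof -
  define u where "u = a + \<i> *\<^sub>C c"
  have star_u: "star u = a - \<i> *\<^sub>C c"
    using sa by (simp add: u_def star_add star_scaleC selfadjoint_def scaleC_minus_left)
  have "star u * u = a * a + c * c"
    unfolding star_u unfolding u_def
    by (simp add: algebra_simps mult_scaleC_left mult_scaleC_right scaleC_scaleC comm
        scaleC_minus_left scaleC_diff_right scaleC_one)
  then have "(norm u)\<^sup>2 = 1"
    using cstar_identity[of u] sum by simp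
  then have u: "norm u = 1"
    by (simp add: power2_eq_1_iff) (use norm_ge_zero[of u] in linarith)
  have "2 *\<^sub>R a = u + star u"
    unfolding star_u by (simp add: u_def scaleR_2)
  then have "2 * norm a = norm (u + star u)"
    by (metis abs_numeral norm_scaleR)
  also have "\<dots> \<le> norm u + norm (star u)"
    by (rule norm_triangle_ineq)
  finally show ?thesis
    using u by (simp add: norm_star)
qed

text \<open>If \<open>c\<close> is the root of \<open>1 - b * b\<close>, then \<open>c\<close> and
  \<open>b\<close> have squares summing to 1, so \<open>norm c \<le> 1\<close>. This stands in for
  the fact that \<open>b * b\<close> has its spectrum in [0, 1].\<close>

lemma norm_one_minus_square_le:
  fixes b :: "'a::{cstar_algebra, real_normed_algebra_1}"
  assumes b: "selfadjoint b" "norm b \<le> 1"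
  shows "norm (1 - b * b) \<le> 1"
proof -
  obtain c where c: "selfadjoint c" "c * c = 1 - b * b" "b * c = c * b"
    using b by (rule sqrt_one_minus_square)
  then have "norm c \<le> 1"
    using b by (intro norm_le_one_if_squares_sum_one[of c b]) auto
  then show ?thesis
    using c norm_square_selfadjoint[of c] by (simp add: power_le_one)
qed

section \<open>Invertible and positive elements\<close>

lemma alg_invertible_iff: "alg_invertible x \<longleftrightarrow> (\<exists>y. x * y = 1 \<and> y * x = 1)"
  for x :: "'a::{complex_star_algebra, monoid_mult}"
proof -
  have "e = 1" if "is_identity e" for e :: 'a
    using that unfolding is_identity_def by (metis mult_1_right)
  moreover have "is_identity (1 :: 'a)"
    by (simp add: is_identity_def)
  ultimately show ?thesis
    unfolding alg_invertible_def by metis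
qed

lemma alg_invertible_mult:
  fixes x y :: "'a::{complex_star_algebra, monoid_mult}"
  assumes "alg_invertible x" "alg_invertible y"
  shows "alg_invertible (x * y)"
proof -
  obtain x' y' where "x * x' = 1" "x' * x = 1" "y * y' = 1" "y' * y = 1"
    using assms unfolding alg_invertible_iff by blast
  then have "x * y * (y' * x') = 1" "(y' * x') * (x * y) = 1"
    by (metis mult.assoc mult_1_right)+
  then show ?thesis
    unfolding alg_invertible_iff by blast
qed

lemma alg_invertible_scaleR:
  fixes x :: "'a::{cstar_algebra, real_normed_algebra_1}"
  assumes "alg_invertible x" "t \<noteq> 0"
  shows "alg_invertible (t *\<^sub>R x)"
proof -
  obtain y where "x * y = 1" "y * x = 1"
    using assms unfolding alg_invertible_iff by blast
  then show ?thesis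
    using assms(2) unfolding alg_invertible_iff by (intro exI[of _ "inverse t *\<^sub>R y"]) simp
qed

lemma alg_invertible_near_scalar:
  fixes x :: "'a::{cstar_algebra, real_normed_algebra_1}"
  assumes "norm (t *\<^sub>R 1 - x) < t"
  shows "alg_invertible x"
proof -
  have t: "t > 0"
    using assms norm_ge_zero le_less_trans by blast
  have *: "1 - inverse t *\<^sub>R x = inverse t *\<^sub>R (t *\<^sub>R 1 - x)"
    using t by (simp add: scaleR_right_diff_distrib)
  then have "norm (1 - inverse t *\<^sub>R x) < 1"
    using assms t unfolding * norm_scaleR by (simp add: field_simps)
  then have "alg_invertible (inverse t *\<^sub>R x)"
    unfolding alg_invertible_iff by (metis Neumann_inverse)
  then show ?thesis
    using alg_invertible_scaleR[of "inverse t *\<^sub>R x" t] t by simp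
qed

text \<open>This form of positivity is stable under sums and limits without any spectral theory.\<close>

definition positive :: "'a::{cstar_algebra, real_normed_algebra_1} \<Rightarrow> bool" where
  "positive p \<longleftrightarrow> selfadjoint p \<and> norm (norm p *\<^sub>R 1 - p) \<le> norm p"

lemma positive_imp_selfadjoint: "positive p \<Longrightarrow> selfadjoint p"
  by (simp add: positive_def)

lemma positive_square:
  assumes "selfadjoint b"
  shows "positive (b * b)"
proof (cases "b = 0")
  case False
  define c where "c = inverse (norm b) *\<^sub>R b"
  have "norm (1 - c * c) \<le> 1"
    using assms False by (intro norm_one_minus_square_le) (auto simp: c_def selfadjoint_scaleR)
  moreover have "(norm b)\<^sup>2 * (inverse (norm b) * inverse (norm b)) = 1"
    using False by (simp add: power2_eq_square field_simps)
  then have "(norm b)\<^sup>2 *\<^sub>R (1 - c * c) = (norm b)\<^sup>2 *\<^sub>R 1 - b * b"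
    by (simp add: c_def scaleR_right_diff_distrib)
  ultimately have "norm ((norm b)\<^sup>2 *\<^sub>R 1 - b * b) \<le> (norm b)\<^sup>2"
    using mult_left_mono[of "norm (1 - c * c)" 1 "(norm b)\<^sup>2"]
    by (metis mult_1_right norm_scaleR abs_of_nonneg zero_le_power2)
  then show ?thesis
    using assms by (simp add: positive_def selfadjoint_square norm_square_selfadjoint)
qed (simp add: positive_def selfadjoint_zero)

text \<open>Dividing by \<open>t\<close> turns \<open>p\<close> into \<open>1 - x\<close> with
  \<open>norm x \<le> 1\<close>. The freedom to take \<open>t\<close> different from
  \<open>norm p\<close> is what makes sums of positive elements positive.\<close>

lemma sqrt_near_scalar:
  fixes p :: "'a::{cstar_algebra, real_normed_algebra_1}"
  assumes p: "selfadjoint p" "norm (t *\<^sub>R 1 - p) \<le> t"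
  obtains q where "selfadjoint q" "q * q = p" "\<And>y. y * p = p * y \<Longrightarrow> y * q = q * y"
proof (cases "t = 0")
  case True
  then show ?thesis
    using p(2) that[of 0] by (simp add: selfadjoint_zero)
next
  case False
  with p(2) have t: "t > 0"
    using norm_ge_zero[of "t *\<^sub>R 1 - p"] by linarith
  define x where "x = 1 - inverse t *\<^sub>R p"
  have x: "x = inverse t *\<^sub>R (t *\<^sub>R 1 - p)"
    using t by (simp add: x_def scaleR_right_diff_distrib)
  have "norm x \<le> 1"
    using p t unfolding x norm_scaleR by (simp add: field_simps)
  moreover have "selfadjoint x"
    using p(1) by (simp add: x_def selfadjoint_intros)
  ultimately obtain q where q: "selfadjoint q" "q * q = 1 - x" "\<And>y. y * x = x * y \<Longrightarrow> y * q = q * y"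
    by (metis sqrt_one_minus)
  show ?thesis
  proof (rule that[of "sqrt t *\<^sub>R q"])
    show "selfadjoint (sqrt t *\<^sub>R q)"
      using q(1) by (rule selfadjoint_scaleR)
    have "sqrt t *\<^sub>R q * sqrt t *\<^sub>R q = t *\<^sub>R (q * q)"
      using t by simp
    also have "\<dots> = p"
      using q(2) t by (simp add: x_def)
    finally show "sqrt t *\<^sub>R q * sqrt t *\<^sub>R q = p" .
    show "y * sqrt t *\<^sub>R q = sqrt t *\<^sub>R q * y" if "y * p = p * y" for y
      using q(3)[of y] that by (simp add: x_def algebra_simps)
  qed
qed

lemma positive_near_scalar: "selfadjoint p \<Longrightarrow> norm (t *\<^sub>R 1 - p) \<le> t \<Longrightarrow> positive p"
  by (metis sqrt_near_scalar positive_square)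

lemma positive_sqrt:
  assumes "positive p"
  obtains q where "selfadjoint q" "q * q = p" "\<And>y. y * p = p * y \<Longrightarrow> y * q = q * y"
proof -
  have "selfadjoint p" "norm (norm p *\<^sub>R 1 - p) \<le> norm p"
    using assms by (simp_all add: positive_def)
  then show ?thesis
    by (rule sqrt_near_scalar) (rule that)
qed

lemma positive_one: "positive 1"
  by (simp add: positive_def selfadjoint_one)

lemma positive_zero: "positive 0"
  by (simp add: positive_def selfadjoint_zero)

lemma positive_add:
  assumes "positive p" "positive q"
  shows "positive (p + q)"
proof (rule positive_near_scalar)
  have "norm ((norm p + norm q) *\<^sub>R 1 - (p + q)) =
      norm ((norm p *\<^sub>R 1 - p) + (norm q *\<^sub>R 1 - q))"
    by (simp add: algebra_simps)
  also have "\<dots> \<le> norm p + norm q"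
    using assms by (intro order_trans[OF norm_triangle_ineq] add_mono) (auto simp: positive_def)
  finally show "norm ((norm p + norm q) *\<^sub>R 1 - (p + q)) \<le> norm p + norm q" .
qed (use assms in \<open>auto simp: positive_def selfadjoint_add\<close>)

lemma positive_scaleR:
  assumes "positive p" "t \<ge> 0"
  shows "positive (t *\<^sub>R p)"
proof -
  obtain q where "selfadjoint q" "q * q = p"
    using positive_sqrt[OF assms(1)] by blast
  then have "t *\<^sub>R p = (sqrt t *\<^sub>R q) * (sqrt t *\<^sub>R q)" "selfadjoint (sqrt t *\<^sub>R q)"
    using assms(2) by (auto simp: selfadjoint_scaleR)
  then show ?thesis
    by (metis positive_square)
qed

lemma positive_sum: "(\<And>k. k \<in> A \<Longrightarrow> positive (f k)) \<Longrightarrow> positive (sum f A)"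
  by (induction A rule: infinite_finite_induct) (auto simp: positive_zero positive_add)

lemma positive_scalar_minus:
  assumes "selfadjoint x" "norm x \<le> t"
  shows "positive (t *\<^sub>R 1 - x)"
  by (rule positive_near_scalar[of _ t]) (use assms in \<open>auto simp: selfadjoint_intros\<close>)

lemma closed_positive: "closed {p :: 'a::{cstar_algebra, real_normed_algebra_1}. positive p}"
  unfolding positive_def
  by (intro closed_Collect_conj closed_selfadjoint closed_Collect_le continuous_intros)

lemma positive_add_scalar_invertible:
  assumes "positive p" "d > 0"
  shows "alg_invertible (p + d *\<^sub>R 1)"
proof (rule alg_invertible_near_scalar)
  have "norm ((norm p + d) *\<^sub>R 1 - (p + d *\<^sub>R 1)) = norm (norm p *\<^sub>R 1 - p)"
    by (simp add: algebra_simps)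
  also have "\<dots> < norm p + d"
    using assms by (simp add: positive_def)
  finally show "norm ((norm p + d) *\<^sub>R 1 - (p + d *\<^sub>R 1)) < norm p + d" .
qed

lemma commute_inverse:
  fixes x :: "'a::monoid_mult"
  assumes "x * v = 1" "v * x = 1" "y * x = x * y"
  shows "y * v = v * y"
  by (metis assms mult.assoc mult_1_left mult_1_right)

lemma selfadjoint_inverse:
  fixes x :: "'a::{complex_star_algebra, monoid_mult}"
  assumes "x * v = 1" "v * x = 1" "selfadjoint x"
  shows "selfadjoint v"
  using assms unfolding selfadjoint_def by (metis mult.assoc mult_1_left mult_1_right star_mult star_one)

text \<open>The root \<open>q\<close> of \<open>p\<close> commutes with \<open>v\<close>, so
  \<open>v = v * p * v\<close> is the square of \<open>v * q\<close>.\<close>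

lemma positive_inverse:
  assumes "positive p" and v: "p * v = 1" "v * p = 1"
  shows "positive v"
proof -
  obtain q where q: "selfadjoint q" "q * q = p"
    using positive_sqrt[OF assms(1)] by blast
  have vq: "q * v = v * q"
    by (rule commute_inverse[OF v]) (simp add: q(2)[symmetric] mult.assoc)
  have "v = v * (q * q) * v"
    by (simp add: q v)
  also have "\<dots> = (v * q) * (v * q)"
    by (metis vq mult.assoc)
  finally have "v = (v * q) * (v * q)" .
  moreover have "selfadjoint (v * q)"
    using q(1) selfadjoint_inverse[OF v positive_imp_selfadjoint[OF assms(1)]] vq
    by (metis selfadjoint_mult_commute)
  ultimately show ?thesis
    by (metis positive_square)
qed

lemma positive_mult_commute:
  assumes "positive p" "positive q" "p * q = q * p"
  shows "positive (p * q)"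
proof -
  obtain r where r: "selfadjoint r" "r * r = p" "\<And>y. y * p = p * y \<Longrightarrow> y * r = r * y"
    using positive_sqrt[OF assms(1)] by blast
  obtain s where s: "selfadjoint s" "s * s = q" "\<And>y. y * q = q * y \<Longrightarrow> y * s = s * y"
    using positive_sqrt[OF assms(2)] by blast
  have "r * s = s * r"
    using assms(3) r(3) s(3) by metis
  then have "p * q = (r * s) * (r * s)" "selfadjoint (r * s)"
    using r s by (metis mult.assoc, metis selfadjoint_mult_commute)
  then show ?thesis
    by (metis positive_square)
qed

text \<open>With \<open>v\<close> the inverse of \<open>p\<close> and \<open>K = \<parallel>v\<parallel>\<close>, one has \<open>p - 1/K = p (1 - v/K)\<close>.\<close>

lemma positive_invertible_lower_bound:
  assumes p: "positive p" "alg_invertible p"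
  obtains d where "d > 0" "positive (p - d *\<^sub>R 1)"
proof -
  obtain v where v: "p * v = 1" "v * p = 1"
    using p(2) unfolding alg_invertible_iff by blast
  define K where "K = norm v"
  have K: "K > 0"
    using v by (auto simp: K_def)
  have "positive v"
    by (rule positive_inverse[OF p(1) v])
  then have "positive (1 - inverse K *\<^sub>R v)"
    using positive_scalar_minus[of "inverse K *\<^sub>R v" 1] K
    by (simp add: K_def selfadjoint_scaleR positive_imp_selfadjoint)
  then have "positive (p * (1 - inverse K *\<^sub>R v))"
    by (intro positive_mult_commute p) (simp_all add: v left_diff_distrib right_diff_distrib)
  also have "p * (1 - inverse K *\<^sub>R v) = p - inverse K *\<^sub>R 1"
    by (simp add: v algebra_simps)
  finally show ?thesis
    using K that[of "inverse K"] by simp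
qed

lemma invertible_add_positive:
  assumes "positive p" "alg_invertible p" "positive q"
  shows "alg_invertible (p + q)"
proof -
  obtain d where d: "d > 0" "positive (p - d *\<^sub>R 1)"
    using positive_invertible_lower_bound[OF assms(1,2)] .
  then have "alg_invertible ((p - d *\<^sub>R 1) + q + d *\<^sub>R 1)"
    by (intro positive_add_scalar_invertible positive_add assms)
  then show ?thesis
    by simp
qed

text \<open>Among invertible self-adjoint elements, being positive is an open and closed condition.\<close>

lemma positive_path:
  fixes F :: "real \<Rightarrow> 'a::{cstar_algebra, real_normed_algebra_1}"
  assumes cont: "continuous_on {0..1} F" and sa: "\<And>s. s \<in> {0..1} \<Longrightarrow> selfadjoint (F s)"
    and inv: "\<And>s. s \<in> {0..1} \<Longrightarrow> alg_invertible (F s)" and start: "positive (F 0)"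
  shows "positive (F 1)"
proof -
  define S where "S = {0..1} \<inter> F -` {p. positive p}"
  have "closedin (top_of_set {0..1}) S"
    unfolding S_def by (rule continuous_closedin_preimage[OF cont closed_positive])
  moreover have "openin (top_of_set {0..1}) S"
    unfolding openin_euclidean_subtopology_iff
  proof (intro conjI ballI)
    show "S \<subseteq> {0..1}"
      by (simp add: S_def)
    fix s assume "s \<in> S"
    then have s: "s \<in> {0..1}" "positive (F s)"
      by (auto simp: S_def)
    obtain d where d: "d > 0" "positive (F s - d *\<^sub>R 1)"
      using positive_invertible_lower_bound[OF s(2) inv[OF s(1)]] .
    obtain e where e: "e > 0" "\<And>r. r \<in> {0..1} \<Longrightarrow> dist r s < e \<Longrightarrow> dist (F r) (F s) < d"
      using cont s(1) d(1) unfolding continuous_on_iff by metis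
    have "r \<in> S" if r: "r \<in> {0..1}" "dist r s < e" for r
    proof -
      \<comment> \<open>\<open>F r\<close> is the sum of \<open>F s - d\<close> and
        \<open>d - (F s - F r)\<close>, both positive.\<close>
      have "positive (d *\<^sub>R 1 - (F s - F r))"
        using e(2)[OF r] r s
        by (intro positive_scalar_minus selfadjoint_diff sa)
          (auto simp: dist_norm norm_minus_commute intro: less_imp_le)
      from positive_add[OF d(2) this] show ?thesis
        using r by (simp add: S_def)
    qed
    with e(1) show "\<exists>e>0. \<forall>r\<in>{0..1}. dist r s < e \<longrightarrow> r \<in> S"
      by blast
  qed
  moreover have "0 \<in> S"
    using start by (simp add: S_def)
  ultimately have "S = {0..1}"
    using connected_Icc[of 0 "1 :: real"] unfolding connected_clopen by blast
  then have "1 \<in> S"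
    by simp
  then show ?thesis
    by (simp add: S_def)
qed

section \<open>Positivity of sandwiched elements\<close>

text \<open>If \<open>w\<close> inverts \<open>t + b * a\<close>, then \<open>1 - a * w * b\<close>
  divided by \<open>t\<close> inverts \<open>t + a * b\<close>.\<close>

lemma Jacobson_invertible:
  fixes a b :: "'a::{cstar_algebra, real_normed_algebra_1}"
  assumes inv: "alg_invertible (t *\<^sub>R 1 + b * a)" and t: "t \<noteq> 0"
  shows "alg_invertible (t *\<^sub>R 1 + a * b)"
proof -
  obtain w where w: "(t *\<^sub>R 1 + b * a) * w = 1" "w * (t *\<^sub>R 1 + b * a) = 1"
    using inv unfolding alg_invertible_iff by blast
  have "(t *\<^sub>R 1 + a * b) * (1 - a * w * b) =
      t *\<^sub>R 1 + a * b - a * ((t *\<^sub>R 1 + b * a) * w) * b"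
    by (simp add: algebra_simps)
  then have 1: "(t *\<^sub>R 1 + a * b) * (1 - a * w * b) = t *\<^sub>R 1"
    by (simp add: w)
  have "(1 - a * w * b) * (t *\<^sub>R 1 + a * b) =
      t *\<^sub>R 1 + a * b - a * (w * (t *\<^sub>R 1 + b * a)) * b"
    by (simp add: algebra_simps)
  then have 2: "(1 - a * w * b) * (t *\<^sub>R 1 + a * b) = t *\<^sub>R 1"
    by (simp add: w)
  show ?thesis
    unfolding alg_invertible_iff
    using 1 2 t by (intro exI[of _ "inverse t *\<^sub>R (1 - a * w * b)"]) simp
qed

text \<open>
  By the Jacobson lemma \<open>y r y + t\<close> is invertible because
  \<open>r y y + t = r (y y + t r\<^sup>-\<^sup>1)\<close> is; then deform \<open>r\<close> to \<open>1\<close>.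
\<close>

lemma positive_sandwich:
  fixes y r :: "'a::{cstar_algebra, real_normed_algebra_1}"
  assumes y: "selfadjoint y" and r: "selfadjoint r" "norm (1 - r) < 1"
  shows "positive (y * r * y)"
proof -
  \<comment> \<open>The shift by \<open>t\<close> keeps the path invertible even if \<open>y\<close>
    is not. It is removed at the end by letting \<open>t\<close> tend to 0, since limits of positive
    elements are positive.\<close>
  have pos: "positive (y * r * y + t *\<^sub>R 1)" if t: "t > 0" for t
  proof -
    define R where "R s = 1 - s *\<^sub>R (1 - r)" for s
    have "positive (y * R 1 * y + t *\<^sub>R 1)"
    proof (rule positive_path)
      show "continuous_on {0..1} (\<lambda>s. y * R s * y + t *\<^sub>R 1)"
        unfolding R_def by (intro continuous_intros)
      show "positive (y * R 0 * y + t *\<^sub>R 1)"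
        unfolding R_def using y t
        by (simp add: positive_add positive_square positive_scaleR positive_one)
      fix s :: real assume s: "s \<in> {0..1}"
      have sa: "selfadjoint (R s)"
        using r by (simp add: R_def selfadjoint_intros)
      show "selfadjoint (y * R s * y + t *\<^sub>R 1)"
        using sa y by (simp add: selfadjoint_intros)
      have "norm (1 - R s) \<le> norm (1 - r)"
        using s mult_right_mono[of s 1 "norm (1 - r)"] by (simp add: R_def)
      with r have lt: "norm (1 *\<^sub>R 1 - R s) < 1"
        by simp
      then obtain v where v: "R s * v = 1" "v * R s = 1"
        using alg_invertible_near_scalar alg_invertible_iff by metis
      have "positive v"
        using positive_near_scalar[OF sa less_imp_le[OF lt]] v by (rule positive_inverse)
      moreover have "alg_invertible v"
        using v alg_invertible_iff by blast
      ultimately have "alg_invertible (t *\<^sub>R v + y * y)"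
        using t y by (intro invertible_add_positive positive_scaleR alg_invertible_scaleR
            positive_square) auto
      then have "alg_invertible (R s * (t *\<^sub>R v + y * y))"
        using v alg_invertible_iff by (intro alg_invertible_mult) blast
      also have "R s * (t *\<^sub>R v + y * y) = t *\<^sub>R 1 + (R s * y) * y"
        by (simp add: v distrib_left mult.assoc)
      finally have "alg_invertible (t *\<^sub>R 1 + y * (R s * y))"
        by (rule Jacobson_invertible) (use t in simp)
      then show "alg_invertible (y * R s * y + t *\<^sub>R 1)"
        by (simp add: add.commute mult.assoc)
    qed
    then show ?thesis
      by (simp add: R_def)
  qed
  have "(\<lambda>n. y * r * y + (1 / real (Suc n)) *\<^sub>R 1) \<longlonglongrightarrow> y * r * y + 0 *\<^sub>R 1"
    by (intro tendsto_intros lim_1_over_n[THEN LIMSEQ_Suc])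
  then have "y * r * y + 0 *\<^sub>R 1 \<in> {p. positive p}"
    by (rule closed_sequentially[OF closed_positive, rotated]) (simp add: pos)
  then show ?thesis
    by simp
qed

text \<open>The order estimate \<open>y * c * y \<le> K *\<^sub>R (y * y)\<close>. Strictness of
  \<open>norm c < K\<close> puts \<open>1 - c / K\<close> at distance less than 1 from 1, where
  \<open>positive_sandwich\<close> applies.\<close>

lemma positive_sandwich_scalar_minus:
  fixes y c :: "'a::{cstar_algebra, real_normed_algebra_1}"
  assumes "selfadjoint y" "selfadjoint c" "norm c < K"
  shows "positive (K *\<^sub>R (y * y) - y * c * y)"
proof -
  have K: "K > 0"
    using assms(3) norm_ge_zero le_less_trans by blast
  have "positive (y * (1 - inverse K *\<^sub>R c) * y)"
    using assms K by (intro positive_sandwich) (auto simp: selfadjoint_intros field_simps)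
  then have "positive (K *\<^sub>R (y * (1 - inverse K *\<^sub>R c) * y))"
    using K by (intro positive_scaleR) auto
  also have "K *\<^sub>R (y * (1 - inverse K *\<^sub>R c) * y) = K *\<^sub>R (y * y) - y * c * y"
    using K by (simp add: algebra_simps)
  finally show ?thesis .
qed

section \<open>Tuples with invertible sum of squares\<close>

lemma positive_sum_squares:
  "(\<And>k. k \<in> A \<Longrightarrow> selfadjoint (y k)) \<Longrightarrow> positive (\<Sum>k\<in>A. y k * y k)"
  by (simp add: positive_sum positive_square)

lemma sa_tuples_selfadjoint: "a \<in> sa_tuples n \<Longrightarrow> k < n \<Longrightarrow> selfadjoint (a k)"
  by (auto simp: sa_tuples_def)

lemma restrict_in_sa_tuples: "(\<And>k. k < n \<Longrightarrow> selfadjoint (a k)) \<Longrightarrow> restrict a {..<n} \<in> sa_tuples n"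
  by (auto simp: sa_tuples_def)

lemma restrict_in_Lg:
  assumes "\<And>k. k < n \<Longrightarrow> selfadjoint (a k)" "alg_invertible (\<Sum>k<n. a k * a k)"
  shows "restrict a {..<n} \<in> Lg n"
  using assms by (simp add: Lg_def restrict_in_sa_tuples)

text \<open>Only the first \<open>n\<close> entries are perturbed; the squares of the others add a
  positive element to an invertible positive one.\<close>

lemma Lg_dense_mono:
  assumes dense: "Lg_dense TYPE('a::{cstar_algebra, real_normed_algebra_1}) n" and "n \<le> m"
  shows "Lg_dense TYPE('a) m"
  unfolding Lg_dense_iff
proof (intro ballI allI impI)
  fix a :: "nat \<Rightarrow> 'a" and e :: real
  assume a: "a \<in> sa_tuples m" and e: "e > 0"
  have "restrict a {..<n} \<in> sa_tuples n"
    using a \<open>n \<le> m\<close> by (intro restrict_in_sa_tuples sa_tuples_selfadjoint[of a m]) auto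
  then obtain b where b: "b \<in> Lg n" "\<forall>k<n. norm (restrict a {..<n} k - b k) < e"
    using dense e unfolding Lg_dense_iff by blast
  define c where "c k = (if k < n then b k else a k)" for k
  have "{..<m} = {..<n} \<union> {n..<m}"
    using \<open>n \<le> m\<close> by auto
  then have "(\<Sum>k<m. c k * c k) = (\<Sum>k<n. c k * c k) + (\<Sum>k\<in>{n..<m}. c k * c k)"
    by (metis finite_atLeastLessThan finite_lessThan ivl_disj_int_one(2) sum.union_disjoint)
  also have "\<dots> = (\<Sum>k<n. b k * b k) + (\<Sum>k\<in>{n..<m}. a k * a k)"
    by (simp add: c_def)
  finally have sum: "(\<Sum>k<m. c k * c k) = (\<Sum>k<n. b k * b k) + (\<Sum>k\<in>{n..<m}. a k * a k)" .
  have "alg_invertible (\<Sum>k<m. c k * c k)"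
    unfolding sum using a b(1)
    by (intro invertible_add_positive positive_sum_squares)
      (auto simp: Lg_def sa_tuples_selfadjoint)
  moreover have "selfadjoint (c k)" if "k < m" for k
    using a b(1) that by (auto simp: c_def Lg_def sa_tuples_selfadjoint)
  ultimately have "restrict c {..<m} \<in> Lg m"
    by (intro restrict_in_Lg)
  moreover have "\<forall>k<m. norm (a k - restrict c {..<m} k) < e"
    using b(2) e by (auto simp: c_def)
  ultimately show "\<exists>b\<in>Lg m. \<forall>k<m. norm (a k - b k) < e"
    by blast
qed

text \<open>The inner factors combine to \<open>g * g\<close>, leaving
  \<open>y k * (g * g) * y k\<close> between two invertible factors. The bound 1/2 puts
  \<open>r = 2 *\<^sub>R (g * g) - 1\<close> at distance less than 1 from 1, so this term is half of
  \<open>y k * y k\<close> plus a positive element.\<close>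

lemma invertible_sum_squares_sandwich:
  fixes y :: "'i \<Rightarrow> 'a::{cstar_algebra, real_normed_algebra_1}"
  assumes y: "\<And>k. k \<in> A \<Longrightarrow> selfadjoint (y k)" and inv: "alg_invertible (\<Sum>k\<in>A. y k * y k)"
    and g: "selfadjoint g" "alg_invertible g" "norm (1 - g * g) < 1 / 2"
  shows "alg_invertible (\<Sum>k\<in>A. (g * y k * g) * (g * y k * g))"
proof -
  define r where "r = 2 *\<^sub>R (g * g) - 1"
  have "1 - r = 2 *\<^sub>R (1 - g * g)"
    by (simp add: r_def scaleR_2 algebra_simps)
  then have r: "selfadjoint r" "norm (1 - r) < 1"
    using g by (simp_all add: r_def selfadjoint_intros)
  have "y k * (g * g) * y k = (1 / 2) *\<^sub>R (y k * y k) + (1 / 2) *\<^sub>R (y k * r * y k)" for k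
    by (simp add: r_def algebra_simps scaleR_add_right[symmetric] scaleR_2[symmetric])
  then have eq: "(\<Sum>k\<in>A. y k * (g * g) * y k) =
      (1 / 2) *\<^sub>R (\<Sum>k\<in>A. y k * y k) + (1 / 2) *\<^sub>R (\<Sum>k\<in>A. y k * r * y k)"
    by (simp add: sum.distrib scaleR_sum_right)
  have "alg_invertible (\<Sum>k\<in>A. y k * (g * g) * y k)"
    unfolding eq using y r inv
    by (intro invertible_add_positive positive_scaleR alg_invertible_scaleR positive_sum
        positive_sandwich positive_square) auto
  then have "alg_invertible (g * (\<Sum>k\<in>A. y k * (g * g) * y k) * g)"
    using g by (intro alg_invertible_mult)
  also have "g * (\<Sum>k\<in>A. y k * (g * g) * y k) * g = (\<Sum>k\<in>A. (g * y k * g) * (g * y k * g))"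
    by (simp add: sum_distrib_left sum_distrib_right mult.assoc)
  finally show ?thesis .
qed

text \<open>With \<open>w = x * c * x\<close> and \<open>z = y - w\<close>, the order gives y^2
  \<le> 2 z^2 + 2 w^2 and w^2 \<le> K x^2. So a multiple of the new sum of squares dominates the
  old, invertible one.\<close>

lemma invertible_sum_squares_shear:
  fixes y c :: "'i \<Rightarrow> 'a::{cstar_algebra, real_normed_algebra_1}"
  assumes x: "selfadjoint x" and y: "\<And>k. k \<in> A \<Longrightarrow> selfadjoint (y k)"
    and c: "\<And>k. k \<in> A \<Longrightarrow> selfadjoint (c k)"
    and inv: "alg_invertible (x * x + (\<Sum>k\<in>A. y k * y k))"
  shows "alg_invertible (x * x + (\<Sum>k\<in>A. (y k - x * c k * x) * (y k - x * c k * x)))"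
proof -
  define w where "w k = x * c k * x" for k
  define z where "z k = y k - w k" for k
  \<comment> \<open>The \<open>+ 1\<close> makes the bound on the norm strict, as
    \<open>positive_sandwich_scalar_minus\<close> demands.\<close>
  define K where "K k = norm (c k * (x * x) * c k) + 1" for k
  \<comment> \<open>The gap in the two inequalities together: 2 K x^2 + 2 z^2 - y^2.\<close>
  define P where "P k = 2 *\<^sub>R (K k *\<^sub>R (x * x) - w k * w k) + (z k - w k) * (z k - w k)" for k
  \<comment> \<open>Large enough that, after the old sum and all \<open>P k\<close> are split off,
    only nonnegative multiples of squares remain.\<close>
  define C where "C = 2 + 2 * (\<Sum>k\<in>A. K k)"
  have K: "K k > 0" for k
    by (simp add: K_def add_nonneg_pos)
  have w: "selfadjoint (w k)" if "k \<in> A" for k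
    using x c[OF that] by (simp add: w_def selfadjoint_sandwich)
  have z: "selfadjoint (z k)" if "k \<in> A" for k
    using w[OF that] y[OF that] by (simp add: z_def selfadjoint_diff)
  have P: "positive (P k)" if k: "k \<in> A" for k
  proof -
    have "positive (K k *\<^sub>R (x * x) - x * (c k * (x * x) * c k) * x)"
      using x c[OF k] by (intro positive_sandwich_scalar_minus) (auto simp: K_def selfadjoint_intros)
    also have "x * (c k * (x * x) * c k) * x = w k * w k"
      by (simp add: w_def mult.assoc)
    finally show ?thesis
      unfolding P_def using z[OF k] w[OF k]
      by (intro positive_add positive_scaleR positive_square selfadjoint_diff) auto
  qed
  have "(2 * K k) *\<^sub>R (x * x) = K k *\<^sub>R (x * x) + K k *\<^sub>R (x * x)" for k
    by (simp add: scaleR_add_left[symmetric])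
  then have yP: "y k * y k + P k = (2 * K k) *\<^sub>R (x * x) + 2 *\<^sub>R (z k * z k)" for k
    by (simp add: P_def z_def scaleR_2 algebra_simps)
  have "x * x + (\<Sum>k\<in>A. y k * y k) + (\<Sum>k\<in>A. P k) =
      (1 + 2 * (\<Sum>k\<in>A. K k)) *\<^sub>R (x * x) + 2 *\<^sub>R (\<Sum>k\<in>A. z k * z k)"
    unfolding add.assoc sum.distrib[symmetric] yP
    by (simp add: sum.distrib scaleR_sum_left[symmetric] scaleR_sum_right[symmetric]
        sum_distrib_left[symmetric] scaleR_add_left)
  then have eq: "C *\<^sub>R (x * x + (\<Sum>k\<in>A. z k * z k)) =
      (x * x + (\<Sum>k\<in>A. y k * y k)) +
      ((\<Sum>k\<in>A. P k) + (x * x + (2 * (\<Sum>k\<in>A. K k)) *\<^sub>R (\<Sum>k\<in>A. z k * z k)))"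
    unfolding add.assoc[symmetric] by (simp add: C_def algebra_simps scaleR_2)
  have "alg_invertible (C *\<^sub>R (x * x + (\<Sum>k\<in>A. z k * z k)))"
    unfolding eq
  proof (rule invertible_add_positive[OF _ inv])
    show "positive (x * x + (\<Sum>k\<in>A. y k * y k))"
      using x y by (intro positive_add positive_square positive_sum_squares)
    show "positive ((\<Sum>k\<in>A. P k) + (x * x + (2 * (\<Sum>k\<in>A. K k)) *\<^sub>R (\<Sum>k\<in>A. z k * z k)))"
      using x z K
      by (intro positive_add positive_scaleR positive_sum_squares positive_square
          positive_sum P mult_nonneg_nonneg sum_nonneg) (auto intro: less_imp_le)
  qed
  moreover have "C > 0"
    unfolding C_def using K by (intro add_pos_nonneg mult_nonneg_nonneg sum_nonneg) (auto intro: less_imp_le)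
  ultimately have "alg_invertible (inverse C *\<^sub>R (C *\<^sub>R (x * x + (\<Sum>k\<in>A. z k * z k))))"
    by (intro alg_invertible_scaleR[where t = "inverse C"]) auto
  then show ?thesis
    using \<open>C > 0\<close> by (simp add: z_def w_def)
qed

section \<open>Homomorphisms\<close>

lemma
  assumes "is_star_hom f"
  shows hom_add: "f (x + y) = f x + f y"
    and hom_scaleC: "f (c *\<^sub>C x) = c *\<^sub>C f x"
    and hom_mult: "f (x * y) = f x * f y"
    and hom_star: "f (star x) = star (f x)"
  using assms by (auto simp: is_star_hom_def)

lemma hom_zero: "is_star_hom f \<Longrightarrow> f 0 = 0"
  using hom_scaleC[of f 0 0] by (simp add: scaleC_zero_left)

lemma hom_minus: "is_star_hom f \<Longrightarrow> f (- x) = - f x"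
  using hom_scaleC[of f "- 1" x] by (simp add: scaleC_minus_left scaleC_one)

lemma hom_diff: "is_star_hom f \<Longrightarrow> f (x - y) = f x - f y"
  using hom_add[of f x "- y"] by (simp add: hom_minus)

lemma hom_scaleR: "is_star_hom f \<Longrightarrow> f (r *\<^sub>R x) = r *\<^sub>R f x"
  for f :: "'a::cstar_algebra \<Rightarrow> 'b::cstar_algebra"
  by (simp add: scaleR_scaleC hom_scaleC)

lemma hom_sum: "is_star_hom f \<Longrightarrow> f (sum g A) = (\<Sum>k\<in>A. f (g k))"
  by (induction A rule: infinite_finite_induct) (simp_all add: hom_zero hom_add)

lemma hom_selfadjoint: "is_star_hom f \<Longrightarrow> selfadjoint x \<Longrightarrow> selfadjoint (f x)"
  by (metis hom_star selfadjoint_def)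

lemmas hom_simps = hom_add hom_scaleC hom_mult hom_star hom_zero hom_minus hom_diff hom_sum

lemma inj_selfadjoint_iff: "is_star_hom f \<Longrightarrow> inj f \<Longrightarrow> selfadjoint (f x) \<longleftrightarrow> selfadjoint x"
  by (metis hom_star injD selfadjoint_def)

lemma surj_selfadjoint_lift:
  fixes f :: "'a::cstar_algebra \<Rightarrow> 'b::cstar_algebra"
  assumes f: "is_star_hom f" "surj f" and y: "selfadjoint y"
  obtains x where "selfadjoint x" "f x = y"
proof -
  obtain x where x: "f x = y"
    using f(2) by (metis surjD)
  show ?thesis
  proof (rule that)
    show "selfadjoint ((1 / 2) *\<^sub>R (x + star x))"
      by (simp add: selfadjoint_def star_scaleR star_add star_star add.commute)
    show "f ((1 / 2) *\<^sub>R (x + star x)) = y"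
      using y by (simp add: hom_scaleR[OF f(1)] hom_simps[OF f(1)] x selfadjoint_def
          scaleR_half_double)
  qed
qed

lemma is_star_hom_inv:
  assumes f: "is_star_hom f" "bij f"
  shows "is_star_hom (inv f)"
proof -
  have *: "inv f y = x \<longleftrightarrow> y = f x" for x y
    using f(2) by (metis bij_inv_eq_iff)
  have "f (inv f y) = y" for y
    using f(2) by (simp add: bij_is_surj surj_f_inv_f)
  then show ?thesis
    unfolding is_star_hom_def * by (simp add: hom_simps[OF f(1)])
qed

lemma surj_hom_invertible:
  assumes f: "is_star_hom f" "surj f" and x: "alg_invertible x"
  shows "alg_invertible (f x)"
proof -
  obtain e y where e: "is_identity e" and y: "x * y = e" "y * x = e"
    using x unfolding alg_invertible_def by blast
  have "is_identity (f e)"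
    unfolding is_identity_def
  proof
    fix b
    obtain a where "b = f a"
      using f(2) by (metis surjD)
    then show "f e * b = b \<and> b * f e = b"
      using e hom_mult[OF f(1)] unfolding is_identity_def by metis
  qed
  then show ?thesis
    unfolding alg_invertible_def using y hom_mult[OF f(1)] by metis
qed

section \<open>Homomorphisms between algebras with adjoined units\<close>

definition adjoin_map :: "('a::cstar_algebra \<Rightarrow> 'b::cstar_algebra) \<Rightarrow> 'a adjoined \<Rightarrow> 'b adjoined" where
  "adjoin_map f x = Adjoin (f (body x)) (scalar x)"

lemma body_adjoin_map [simp]: "body (adjoin_map f x) = f (body x)"
  and scalar_adjoin_map [simp]: "scalar (adjoin_map f x) = scalar x"
  by (simp_all add: adjoin_map_def)

lemma is_star_hom_adjoin_map: "is_star_hom f \<Longrightarrow> is_star_hom (adjoin_map f)"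
  unfolding is_star_hom_def[of "adjoin_map f"]
  by (auto intro!: adjoined.expand simp: hom_simps body_times)

lemma adjoin_map_one: "is_star_hom f \<Longrightarrow> adjoin_map f 1 = 1"
  by (auto intro!: adjoined.expand simp: hom_zero)

text \<open>If \<open>x = x\<^sup>*\<close> has norm at most one, then \<open>f x\<close> is the real part of the image of the
  unitary \<open>x + \<i> \<surd>(1 - x\<^sup>2)\<close>.\<close>

lemma star_hom_contractive:
  fixes f :: "'a::cstar_algebra \<Rightarrow> 'b::cstar_algebra"
  assumes f: "is_star_hom f"
  shows "norm (f x) \<le> norm x"
proof -
  note F = is_star_hom_adjoin_map[OF f]
  have unit: "norm (f x) \<le> 1" if x: "selfadjoint x" "norm x \<le> 1" for x
  proof -
    define X where "X = Adjoin x 0"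
    have X: "selfadjoint X" "norm X \<le> 1"
      using x by (auto simp: X_def norm_Adjoin_zero selfadjoint_def star_adjoined_def)
    then obtain c where c: "selfadjoint c" "c * c = 1 - X * X" "X * c = c * X"
      by (rule sqrt_one_minus_square)
    have "norm (adjoin_map f X) \<le> 1"
    proof (rule norm_le_one_if_squares_sum_one)
      show "adjoin_map f X * adjoin_map f c = adjoin_map f c * adjoin_map f X"
        using c(3) hom_mult[OF F] by metis
      have "adjoin_map f X * adjoin_map f X + adjoin_map f c * adjoin_map f c =
          adjoin_map f (X * X + c * c)"
        by (simp only: hom_simps[OF F])
      then show "adjoin_map f X * adjoin_map f X + adjoin_map f c * adjoin_map f c = 1"
        using c(2) by (simp add: adjoin_map_one[OF f])
    qed (use X c F in \<open>auto intro: hom_selfadjoint\<close>)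
    then show ?thesis
      by (simp add: X_def adjoin_map_def norm_Adjoin_zero)
  qed
  have sa: "norm (f x) \<le> norm x" if x: "selfadjoint x" for x
  proof (cases "x = 0")
    case False
    then have "norm (f (inverse (norm x) *\<^sub>R x)) \<le> 1"
      using x by (intro unit selfadjoint_scaleR) auto
    then show ?thesis
      using False by (simp add: hom_scaleR[OF f] field_simps)
  qed (simp add: hom_zero[OF f])
  have "(norm (f x))\<^sup>2 = norm (f (star x * x))"
    by (simp add: hom_simps[OF f] cstar_identity)
  also have "\<dots> \<le> (norm x)\<^sup>2"
    using sa[OF selfadjoint_star_mult_self[of x]] by (simp add: cstar_identity)
  finally show ?thesis
    by (rule power2_le_imp_le) simp
qed

lemma Lg_dense_surj_hom:
  fixes f :: "'a::cstar_algebra \<Rightarrow> 'b::cstar_algebra"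
  assumes f: "is_star_hom f" "surj f" and dense: "Lg_dense TYPE('a) n"
  shows "Lg_dense TYPE('b) n"
  unfolding Lg_dense_iff
proof (intro ballI allI impI)
  fix b :: "nat \<Rightarrow> 'b" and e :: real
  assume b: "b \<in> sa_tuples n" and e: "e > 0"
  have "\<exists>x. selfadjoint x \<and> f x = b k" if "k < n" for k
    using surj_selfadjoint_lift[OF f sa_tuples_selfadjoint[OF b that]] by metis
  then obtain a where a: "\<And>k. k < n \<Longrightarrow> selfadjoint (a k) \<and> f (a k) = b k"
    by metis
  then have "restrict a {..<n} \<in> sa_tuples n"
    by (simp add: restrict_in_sa_tuples)
  then obtain a' where a': "a' \<in> Lg n" "\<forall>k<n. norm (restrict a {..<n} k - a' k) < e"
    using dense e unfolding Lg_dense_iff by blast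
  have "alg_invertible (f (\<Sum>k<n. a' k * a' k))"
    using a'(1) by (intro surj_hom_invertible[OF f]) (simp add: Lg_def)
  then have "restrict (\<lambda>k. f (a' k)) {..<n} \<in> Lg n"
    using a'(1)
    by (intro restrict_in_Lg) (auto simp: hom_simps[OF f(1)] Lg_def sa_tuples_selfadjoint
        intro: hom_selfadjoint[OF f(1)])
  moreover have "norm (b k - f (a' k)) < e" if k: "k < n" for k
  proof -
    have "b k - f (a' k) = f (a k - a' k)"
      using a[OF k] by (simp add: hom_diff[OF f(1)])
    then show ?thesis
      using a'(2) k star_hom_contractive[OF f(1), of "a k - a' k"] by fastforce
  qed
  ultimately show "\<exists>c\<in>Lg n. \<forall>k<n. norm (b k - c k) < e"
    by (intro bexI[of _ "restrict (\<lambda>k. f (a' k)) {..<n}"]) auto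
qed

section \<open>Real rank through the adjoined unit\<close>

lemma is_star_hom_adjoined_to_multiplier: "is_star_hom adjoined_to_multiplier"
  by (simp add: is_star_hom_def adjoined_to_multiplier_add adjoined_to_multiplier_mult
      adjoined_to_multiplier_scaleC adjoined_to_multiplier_star)

lemma inj_mult_embed: "inj mult_embed"
  by (rule injI) (metis embed_diff norm_embed norm_eq_zero right_minus_eq)

text \<open>A kernel element with nonzero scalar part would express the unit of the multiplier
  algebra as an element of A, which would then be an identity of A.\<close>

lemma inj_adjoined_to_multiplier:
  assumes "\<not> unital TYPE('a::cstar_algebra)"
  shows "inj (adjoined_to_multiplier :: 'a adjoined \<Rightarrow> _)"
proof (rule injI)
  fix x y :: "'a adjoined"
  assume eq: "adjoined_to_multiplier x = adjoined_to_multiplier y"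
  define a where "a = body x - body y"
  define c where "c = scalar x - scalar y"
  have z: "mult_embed a + c *\<^sub>C 1 = 0"
    using eq by (simp add: a_def c_def adjoined_to_multiplier_def embed_diff scaleC_diff_left
        algebra_simps)
  have c0: "c = 0"
  proof (rule ccontr)
    assume "c \<noteq> 0"
    then have "1 = inverse c *\<^sub>C (c *\<^sub>C (1 :: 'a multiplier))"
      by (simp add: scaleC_scaleC scaleC_one)
    also have "c *\<^sub>C 1 = mult_embed (- a)"
      using z by (simp add: embed_minus eq_neg_iff_add_eq_0 add.commute)
    also have "inverse c *\<^sub>C mult_embed (- a) = mult_embed (inverse c *\<^sub>C (- a))"
      by (simp add: embed_scaleC)
    finally have one: "1 = mult_embed (inverse c *\<^sub>C (- a))" .
    have "is_identity (inverse c *\<^sub>C (- a))"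
      unfolding is_identity_def
      by (intro allI conjI; rule injD[OF inj_mult_embed])
        (simp_all only: embed_mult one[symmetric] mult_1_left mult_1_right)
    then show False
      using assms by (auto simp: unital_def)
  qed
  with z have "mult_embed a = 0"
    by (simp add: scaleC_zero_left)
  then have "a = 0"
    by (metis norm_embed norm_eq_zero)
  with c0 show "x = y"
    by (auto intro: adjoined.expand simp: a_def c_def)
qed

lemma nonunital_unitization_iso:
  assumes "\<not> unital TYPE('a::cstar_algebra)"
  obtains f :: "'a::cstar_algebra adjoined \<Rightarrow> 'a unitization" where "is_star_hom f" "bij f"
proof -
  define f :: "'a adjoined \<Rightarrow> 'a unitization" where "f x = Abs_unitization (adjoined_to_multiplier x)" for x
  have Rep: "Rep_unitization (f x) = adjoined_to_multiplier x" for x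
    unfolding f_def by (rule Abs_unitization_inverse) (auto simp: adjoined_to_multiplier_def)
  have "is_star_hom f"
    unfolding is_star_hom_def Rep_unitization_inject[symmetric]
    by (simp add: Rep plus_unitization.rep_eq times_unitization.rep_eq scaleC_unitization.rep_eq
        star_unitization.rep_eq hom_simps[OF is_star_hom_adjoined_to_multiplier])
  moreover have "inj f"
    by (rule injI) (metis Rep injD[OF inj_adjoined_to_multiplier[OF assms]])
  moreover have "surj f"
  proof (rule surjI)
    fix T :: "'a unitization"
    obtain a c where "Rep_unitization T = mult_embed a + c *\<^sub>C 1"
      using Rep_unitization[of T] by auto
    then have "f (Adjoin a c) = T"
      by (simp add: Rep_unitization_inject[symmetric] Rep adjoined_to_multiplier_def)
    then show "f (SOME x. f x = T) = T"
      by (rule someI)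
  qed
  ultimately show ?thesis
    using that by (simp add: bij_def)
qed

lemma Lg_dense_adjoined_nonunital:
  assumes "\<not> unital TYPE('a::cstar_algebra)"
  shows "Lg_dense TYPE('a unitization) n \<longleftrightarrow> Lg_dense TYPE('a adjoined) n"
proof -
  obtain f :: "'a adjoined \<Rightarrow> 'a unitization" where f: "is_star_hom f" "bij f"
    using nonunital_unitization_iso[OF assms] .
  show ?thesis
    using Lg_dense_surj_hom[OF f(1) bij_is_surj[OF f(2)]]
      Lg_dense_surj_hom[OF is_star_hom_inv[OF f] bij_is_surj[OF bij_imp_bij_inv[OF f(2)]]]
    by blast
qed

text \<open>Serves to make the scalar part of entry 0 of a tuple nonzero at small cost.\<close>

lemma real_number_perturbation:
  fixes t :: real
  assumes "e > 0"
  obtains s where "s \<noteq> 0" "\<bar>t - s\<bar> < e"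
  using assms that[of t] that[of "e / 2"] by (cases "t = 0") auto

lemma selfadjoint_scalar_real:
  fixes x :: "'a::cstar_algebra adjoined"
  assumes "selfadjoint x"
  shows "scalar x = complex_of_real (Re (scalar x))"
proof -
  have "cnj (scalar x) = scalar x"
    using assms unfolding selfadjoint_def by (metis scalar_star)
  then show ?thesis
    by (metis Reals_cnj_iff of_real_Re)
qed

lemma selfadjoint_adjoined_iff:
  "selfadjoint x \<longleftrightarrow> selfadjoint (body x) \<and> cnj (scalar x) = scalar x"
  by (cases x) (auto simp: selfadjoint_def star_adjoined_def)

text \<open>For unital \<open>A\<close> the algebra \<open>A\<^sup>+\<close> is \<open>A \<oplus> \<complex>\<close> through \<open>x \<mapsto> (body x + scalar x e, scalar x)\<close>.\<close>

lemma Lg_dense_adjoined_unital: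
  assumes e: "is_identity (e :: 'a::cstar_algebra)"
  shows "Lg_dense TYPE('a) (Suc n) \<longleftrightarrow> Lg_dense TYPE('a adjoined) (Suc n)"
proof -
  define f :: "'a adjoined \<Rightarrow> 'a" where "f x = body x + scalar x *\<^sub>C e" for x
  have id: "e * x = x" "x * e = x" for x
    using e by (auto simp: is_identity_def)
  have "star e = e"
    by (metis id star_mult star_star)
  then have f: "is_star_hom f"
    by (auto simp: is_star_hom_def f_def body_times scaleC_add_left scaleC_add_right scaleC_scaleC
        star_add star_scaleC mult_scaleC_left mult_scaleC_right id algebra_simps)
  have f_eq: "f (Adjoin (a - c *\<^sub>C e) c) = a" for a c
    by (simp add: f_def)
  then have surj: "surj f"
    by (rule surjI)
  have ext: "x = y" if "f x = f y" "scalar x = scalar y" for x y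
    using that by (auto intro: adjoined.expand simp: f_def)
  have f1: "f 1 = e"
    by (simp add: f_def scaleC_one)
  have inv: "alg_invertible x" if fx: "alg_invertible (f x)" and sx: "scalar x \<noteq> 0" for x
  proof -
    obtain e' w where "is_identity e'" "f x * w = e'" "w * f x = e'"
      using fx unfolding alg_invertible_def by blast
    then have w: "f x * w = e" "w * f x = e"
      unfolding is_identity_def by (metis id)+
    define c where "c = inverse (scalar x)"
    have "x * Adjoin (w - c *\<^sub>C e) c = 1" "Adjoin (w - c *\<^sub>C e) c * x = 1"
      using sx by (auto intro!: ext simp: hom_mult[OF f] f_eq f1 w c_def)
    then show ?thesis
      unfolding alg_invertible_iff by blast
  qed
  have "Lg_dense TYPE('a adjoined) (Suc n)" if dense: "Lg_dense TYPE('a) (Suc n)"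
    unfolding Lg_dense_iff
  proof (intro ballI allI impI)
    fix a :: "nat \<Rightarrow> 'a adjoined" and \<epsilon> :: real
    assume a: "a \<in> sa_tuples (Suc n)" and \<epsilon>: "\<epsilon> > 0"
    \<comment> \<open>The error \<open>d\<close> below satisfies
      \<open>norm d \<le> norm (f d) + cmod (scalar d) * (1 + norm e)\<close>, whence the factor
      \<open>2 + norm e\<close>.\<close>
    define \<delta> where "\<delta> = \<epsilon> / (2 + norm e)"
    have pos: "2 + norm e > 0"
      by (simp add: add_pos_nonneg)
    then have \<delta>: "\<delta> > 0"
      using \<epsilon> by (simp add: \<delta>_def)
    have "restrict (\<lambda>k. f (a k)) {..<Suc n} \<in> sa_tuples (Suc n)"
      using a by (intro restrict_in_sa_tuples hom_selfadjoint[OF f] sa_tuples_selfadjoint)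
    then obtain b where b: "b \<in> Lg (Suc n)"
        "\<forall>k<Suc n. norm (restrict (\<lambda>k. f (a k)) {..<Suc n} k - b k) < \<delta>"
      using dense \<delta> unfolding Lg_dense_iff by blast
    obtain s0 where s0: "s0 \<noteq> 0" "\<bar>Re (scalar (a 0)) - s0\<bar> < \<delta>"
      using real_number_perturbation[OF \<delta>] .
    \<comment> \<open>The scalars are real, so one nonzero entry makes their sum of squares nonzero.
      This is where the tuple must be nonempty.\<close>
    define s where "s k = (if k = 0 then s0 else Re (scalar (a k)))" for k
    define c where "c k = Adjoin (b k - complex_of_real (s k) *\<^sub>C e) (complex_of_real (s k))" for k
    have c: "f (c k) = b k" "scalar (c k) = of_real (s k)" for k
      by (simp_all add: c_def f_eq)
    have sa: "selfadjoint (c k)" if "k < Suc n" for k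
      using b(1) that \<open>star e = e\<close>
      by (auto simp: Lg_def c_def selfadjoint_adjoined_iff selfadjoint_def star_diff star_scaleC
          dest: sa_tuples_selfadjoint)
    have "alg_invertible (\<Sum>k<Suc n. c k * c k)"
    proof (rule inv)
      show "alg_invertible (f (\<Sum>k<Suc n. c k * c k))"
        using b(1) by (simp add: hom_simps[OF f] c Lg_def)
      have hom_sc: "scalar (sum g A) = (\<Sum>k\<in>A. scalar (g k))" for g :: "nat \<Rightarrow> 'a adjoined" and A
        by (induction A rule: infinite_finite_induct) auto
      have "0 < s 0 * s 0"
        using s0(1) by (simp add: s_def) (metis not_square_less_zero linorder_neqE_linordered_idom mult_eq_0_iff)
      also have "s 0 * s 0 \<le> (\<Sum>k<Suc n. s k * s k)"
        by (rule member_le_sum) auto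
      finally have "(\<Sum>k<Suc n. s k * s k) \<noteq> 0"
        by simp
      moreover have "scalar (\<Sum>k<Suc n. c k * c k) = complex_of_real (\<Sum>k<Suc n. s k * s k)"
        unfolding hom_sc by (simp add: c)
      ultimately show "scalar (\<Sum>k<Suc n. c k * c k) \<noteq> 0"
        by (simp only: of_real_eq_0_iff not_False_eq_True)
    qed
    then have "restrict c {..<Suc n} \<in> Lg (Suc n)"
      using sa by (intro restrict_in_Lg)
    moreover have "norm (a k - c k) < \<epsilon>" if k: "k < Suc n" for k
    proof -
      define d where "d = a k - c k"
      have "f d = f (a k) - b k"
        by (simp add: d_def hom_diff[OF f] c)
      then have fd: "norm (f d) < \<delta>"
        using b(2) k by auto
      have "scalar d = complex_of_real (Re (scalar (a k)) - s k)"
        using selfadjoint_scalar_real[OF sa_tuples_selfadjoint[OF a k]] by (simp add: d_def c)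
      then have sd: "cmod (scalar d) < \<delta>"
        using s0 \<delta> by (simp only: norm_of_real) (simp add: s_def)
      have "norm d \<le> norm (body d) + cmod (scalar d)"
        by (rule norm_adjoined_le)
      also have "body d = f d - scalar d *\<^sub>C e"
        by (simp add: f_def)
      also have "norm (f d - scalar d *\<^sub>C e) \<le> norm (f d) + cmod (scalar d) * norm e"
        by (rule order_trans[OF norm_triangle_ineq4]) (simp add: norm_scaleC)
      also have "norm (f d) + cmod (scalar d) * norm e + cmod (scalar d) < \<delta> + \<delta> * norm e + \<delta>"
        using fd sd by (intro add_less_le_mono add_less_le_mono mult_right_mono) auto
      also have "\<delta> + \<delta> * norm e + \<delta> = \<delta> * (2 + norm e)"
        by (simp add: algebra_simps)
      also have "\<dots> = \<epsilon>"
        using pos by (simp add: \<delta>_def)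
      finally show ?thesis
        by (simp add: d_def)
    qed
    ultimately show "\<exists>b\<in>Lg (Suc n). \<forall>k<Suc n. norm (a k - b k) < \<epsilon>"
      by (intro bexI[of _ "restrict c {..<Suc n}"]) auto
  qed
  then show ?thesis
    using Lg_dense_surj_hom[OF f surj] by blast
qed

text \<open>The least \<open>n\<close> is a threshold because density persists for longer tuples.
  \<open>Lg_dense_mono\<close> is stated for algebras whose type carries a unit, so it is applied to
  A^+ and carried over to \<open>'b\<close>.\<close>

lemma unital_real_rank_le_iff:
  assumes "\<And>n. Lg_dense TYPE('b::cstar_algebra) (Suc n) \<longleftrightarrow> Lg_dense TYPE('a::cstar_algebra adjoined) (Suc n)"
  shows "unital_real_rank TYPE('b) \<le> enat n \<longleftrightarrow> Lg_dense TYPE('a adjoined) (Suc n)"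
proof
  assume le: "unital_real_rank TYPE('b) \<le> enat n"
  then have ex: "\<exists>n. Lg_dense TYPE('b) (Suc n)"
    by (auto simp: unital_real_rank_def split: if_splits)
  define m where "m = (LEAST n. Lg_dense TYPE('b) (Suc n))"
  have "Lg_dense TYPE('b) (Suc m)"
    unfolding m_def using ex by (rule LeastI_ex)
  moreover have "m \<le> n"
    using le ex by (simp add: unital_real_rank_def m_def)
  ultimately show "Lg_dense TYPE('a adjoined) (Suc n)"
    using assms Lg_dense_mono by (metis Suc_le_mono)
next
  assume "Lg_dense TYPE('a adjoined) (Suc n)"
  then have n: "Lg_dense TYPE('b) (Suc n)"
    by (simp add: assms)
  then have "(LEAST n. Lg_dense TYPE('b) (Suc n)) \<le> n"
    by (rule Least_le)
  with n show "unital_real_rank TYPE('b) \<le> enat n"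
    by (auto simp: unital_real_rank_def)
qed

lemma real_rank_le_iff: "real_rank TYPE('a::cstar_algebra) \<le> enat n \<longleftrightarrow> Lg_dense TYPE('a adjoined) (Suc n)"
proof (cases "unital TYPE('a)")
  case True
  then obtain e :: 'a where "is_identity e"
    by (auto simp: unital_def)
  with True show ?thesis
    by (simp add: real_rank_def unital_real_rank_le_iff[OF Lg_dense_adjoined_unital])
next
  case False
  then show ?thesis
    by (simp add: real_rank_def unital_real_rank_le_iff[OF Lg_dense_adjoined_nonunital])
qed

section \<open>Extensions\<close>

lemma surj_adjoin_map: "surj f \<Longrightarrow> surj (adjoin_map f)"
  by (rule surjI[where f = "\<lambda>y. Adjoin (inv f (body y)) (scalar y)"])
    (simp add: adjoin_map_def surj_f_inv_f)

lemma inj_adjoin_map: "inj f \<Longrightarrow> inj (adjoin_map f)"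
  by (rule injI) (auto simp: adjoin_map_def inj_eq intro: adjoined.expand)

section \<open>Inverse square roots and the double angle\<close>

text \<open>\<open>g\<close> is the inverse of the root \<open>q\<close> of \<open>p\<close>. As
  \<open>1 - q\<close> has norm at most 1/2, \<open>norm g \<le> 2\<close>, which is the constant in
  the last estimate.\<close>

lemma inverse_sqrt_near_one:
  fixes p :: "'a::{cstar_algebra, real_normed_algebra_1}"
  assumes p: "selfadjoint p" "norm (1 - p) \<le> 1 / 2"
  obtains g where "selfadjoint g" "g * p * g = 1" "alg_invertible g" "norm (1 - g) \<le> 2 * norm (1 - p)"
proof -
  have "norm (1 - p) \<le> 1" "selfadjoint (1 - p)"
    using p by (auto intro: selfadjoint_intros)
  then obtain q where q: "selfadjoint q" "q * q = 1 - (1 - p)" "norm (1 - q) \<le> norm (1 - p)"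
    using sqrt_one_minus[of "1 - p"] by blast
  have "norm (1 - q) < 1"
    using q(3) p(2) by simp
  then obtain g where g: "q * g = 1" "g * q = 1"
    by (rule Neumann_inverse)
  have "norm g = norm (1 + g * (1 - q))"
    using g by (simp add: right_diff_distrib)
  also have "\<dots> \<le> 1 + norm g * norm (1 - q)"
    by (rule order_trans[OF norm_triangle_ineq]) (simp add: norm_mult_ineq)
  also have "\<dots> \<le> 1 + norm g * (1 / 2)"
    using q(3) p(2) by (intro add_mono mult_left_mono) auto
  finally have ng: "norm g \<le> 2"
    by simp
  have "norm (1 - g) = norm (g * (1 - q))"
    using g by (simp add: right_diff_distrib norm_minus_commute)
  also have "\<dots> \<le> norm g * norm (1 - q)"
    by (rule norm_mult_ineq)
  also have "\<dots> \<le> 2 * norm (1 - p)"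
    using ng q(3) by (intro mult_mono) auto
  finally have n: "norm (1 - g) \<le> 2 * norm (1 - p)" .
  have "g * p * g = g * (q * q) * g"
    by (simp add: q(2))
  also have "\<dots> = (g * q) * (q * g)"
    by (simp add: mult.assoc)
  finally have "g * p * g = 1"
    by (simp add: g)
  moreover have "selfadjoint g"
    by (rule selfadjoint_inverse[OF g q(1)])
  moreover have "alg_invertible g"
    using g alg_invertible_iff by blast
  ultimately show ?thesis
    using n that by blast
qed

text \<open>Read \<open>h\<close> as a tangent and \<open>w\<close> as the squared cosine:
  \<open>2 *\<^sub>R (h * w)\<close> and \<open>2 *\<^sub>R w - 1\<close> are sine and cosine of the
  double angle, so their squares sum to 1.\<close>

lemma norm_double_angle_le:
  fixes h w :: "'a::{cstar_algebra, real_normed_algebra_1}"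
  assumes h: "selfadjoint h" and w: "(1 + h * h) * w = 1" "w * (1 + h * h) = 1"
  shows "norm (2 *\<^sub>R (h * w)) \<le> 1" "selfadjoint (2 *\<^sub>R (h * w))"
proof -
  have hw: "h * w = w * h"
    by (rule commute_inverse[OF w]) (simp add: algebra_simps)
  have sw: "selfadjoint w"
    by (rule selfadjoint_inverse[OF w]) (use h in \<open>auto intro: selfadjoint_intros\<close>)
  have hh: "h * h * w = 1 - w" "w * (h * h) = 1 - w"
    using w by (simp_all add: algebra_simps eq_diff_eq)
  show sa: "selfadjoint (2 *\<^sub>R (h * w))"
    using h sw hw by (intro selfadjoint_scaleR selfadjoint_mult_commute)
  have k: "(1 - h * h) * w = 2 *\<^sub>R w - 1"
    by (simp add: left_diff_distrib hh scaleR_2)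
  show "norm (2 *\<^sub>R (h * w)) \<le> 1"
  proof (rule norm_le_one_if_squares_sum_one[OF sa])
    show "selfadjoint (2 *\<^sub>R w - 1)"
      using sw by (intro selfadjoint_intros)
    show "2 *\<^sub>R (h * w) * (2 *\<^sub>R w - 1) = (2 *\<^sub>R w - 1) * 2 *\<^sub>R (h * w)"
      using hw by (simp add: algebra_simps)
    have "(h * w) * (h * w) = (h * h * w) * w"
      by (metis hw mult.assoc)
    then have *: "(h * w) * (h * w) = w - w * w"
      by (simp add: hh left_diff_distrib)
    have "2 *\<^sub>R (h * w) * 2 *\<^sub>R (h * w) = 4 *\<^sub>R ((h * w) * (h * w))"
      by simp
    moreover have "(2 *\<^sub>R w - 1) * (2 *\<^sub>R w - 1) = 4 *\<^sub>R (w * w) - 4 *\<^sub>R w + 1"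
      by (simp add: algebra_simps scaleR_add_left[symmetric])
    ultimately show "2 *\<^sub>R (h * w) * 2 *\<^sub>R (h * w) + (2 *\<^sub>R w - 1) * (2 *\<^sub>R w - 1) = 1"
      unfolding * by (simp add: scaleR_right_diff_distrib)
  qed
qed

section \<open>An extension after adjoining units\<close>

locale cstar_ext =
  fixes \<iota> :: "'a::cstar_algebra \<Rightarrow> 'e::cstar_algebra"
    and \<pi> :: "'e \<Rightarrow> 'b::cstar_algebra"
  assumes ext: "cstar_extension \<iota> \<pi>"
begin

lemma hom_\<iota>: "is_star_hom \<iota>" and hom_\<pi>: "is_star_hom \<pi>"
  and inj_\<iota>: "inj \<iota>" and surj_\<pi>: "surj \<pi>" and kernel_\<pi>: "\<pi> x = 0 \<longleftrightarrow> x \<in> range \<iota>"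
  using ext by (auto simp: cstar_extension_def)

abbreviation I :: "'a adjoined \<Rightarrow> 'e adjoined" where "I \<equiv> adjoin_map \<iota>"

abbreviation P :: "'e adjoined \<Rightarrow> 'b adjoined" where "P \<equiv> adjoin_map \<pi>"

lemma hom_I: "is_star_hom I" and hom_P: "is_star_hom P" and inj_I: "inj I" and surj_P: "surj P"
  and I_one: "I 1 = 1" and P_one: "P 1 = 1"
  by (simp_all add: is_star_hom_adjoin_map hom_\<iota> hom_\<pi> inj_\<iota> surj_\<pi> inj_adjoin_map surj_adjoin_map
      adjoin_map_one)

lemma P_I: "P (I x) = scalar x *\<^sub>C 1"
  using kernel_\<pi> by (auto intro!: adjoined.expand simp: scaleC_zero_right)

lemma range_I:
  assumes "body (P z) = 0"
  obtains x where "z = I x" "scalar x = scalar z"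
proof -
  obtain a where "body z = \<iota> a"
    using assms kernel_\<pi> by auto
  then have "z = I (Adjoin a (scalar z))"
    by (auto intro: adjoined.expand)
  then show ?thesis
    using that by simp
qed

text \<open>A as an ideal of E^+: the range is the kernel of \<open>P\<close>.\<close>

definition j :: "'a \<Rightarrow> 'e adjoined" where "j a = Adjoin (\<iota> a) 0"

lemma hom_j: "is_star_hom j"
  unfolding is_star_hom_def
  by (auto intro!: adjoined.expand simp: j_def hom_simps[OF hom_\<iota>] body_times scaleC_zero_left)

lemma inj_j: "inj j"
  using inj_\<iota> by (auto simp: j_def inj_def)

lemma P_j: "P (j a) = 0"
  using kernel_\<pi> by (auto intro!: adjoined.expand simp: j_def)

lemma range_j: "P z = 0 \<Longrightarrow> z \<in> range j"
proof -
  assume z: "P z = 0"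
  then have "\<pi> (body z) = 0" "scalar z = 0"
    by (metis body_adjoin_map body_zero, metis scalar_adjoin_map scalar_zero)
  moreover from this obtain a where "body z = \<iota> a"
    using kernel_\<pi> by auto
  ultimately have "z = j a"
    by (auto simp: j_def intro: adjoined.expand)
  then show "z \<in> range j"
    by simp
qed

text \<open>The unitary that proves contractivity is pulled back to A^+. This works because the root
  \<open>c\<close> of \<open>1 - I Y * I Y\<close> has image 1 in B^+ and so lies in the range of
  \<open>I\<close>.\<close>

lemma norm_\<iota>: "norm (\<iota> a) = norm a"
proof (rule antisym[OF star_hom_contractive[OF hom_\<iota>]])
  have unit: "norm x \<le> 1" if x: "selfadjoint x" "norm (\<iota> x) < 1" for x
  proof -
    define Y where "Y = Adjoin x 0"
    have sY: "selfadjoint Y"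
      using x by (simp add: Y_def selfadjoint_adjoined_iff)
    have nY: "norm (I Y) < 1"
      using x by (simp add: Y_def adjoin_map_def norm_Adjoin_zero)
    have sa: "selfadjoint (I Y)"
      using sY hom_I by (rule hom_selfadjoint[rotated])
    have lt: "(norm (I Y))\<^sup>2 < 1"
      using nY by (simp add: power_less_one_iff)
    obtain c where c: "selfadjoint c" "c * c = 1 - I Y * I Y" "norm (1 - c) \<le> (norm (I Y))\<^sup>2"
        "I Y * c = c * I Y"
      using sa nY by (meson sqrt_one_minus_square less_imp_le)
    have PY: "P (I Y) = 0"
      by (simp add: P_I Y_def scaleC_zero_left)
    have "P c * P c = P (c * c)"
      by (simp add: hom_mult[OF hom_P])
    also have "\<dots> = 1"
      unfolding c(2) by (simp add: hom_simps[OF hom_P] PY P_one)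
    finally have PcPc: "P c * P c = 1" .
    \<comment> \<open>\<open>P c\<close> squares to 1 and is near 1. Hence \<open>1 + P c\<close> is
      invertible, and cancelling it in \<open>(1 - P c) * (1 + P c) = 0\<close> gives
      \<open>P c = 1\<close>.\<close>
    have "2 *\<^sub>R 1 - (1 + P c) = P (1 - c)"
      by (simp add: hom_simps[OF hom_P] P_one scaleR_2)
    then have "norm (2 *\<^sub>R 1 - (1 + P c)) < 2"
      using star_hom_contractive[OF hom_P, of "1 - c"] c(3) lt by simp
    then obtain v where v: "(1 + P c) * v = 1"
      using alg_invertible_near_scalar alg_invertible_iff by metis
    have "(1 - P c) = (1 - P c) * ((1 + P c) * v)"
      by (simp add: v)
    also have "\<dots> = (1 - P c * P c) * v"
      by (simp add: algebra_simps)
    finally have "P c = 1"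
      by (simp add: PcPc)
    then have "body (P c) = 0"
      by simp
    then obtain d where d: "c = I d"
      by (rule range_I)
    have "norm Y \<le> 1"
    proof (rule norm_le_one_if_squares_sum_one)
      show "selfadjoint d"
        using c(1) by (simp add: d inj_selfadjoint_iff[OF hom_I inj_I])
      show "Y * d = d * Y"
        using c(4) by (intro injD[OF inj_I]) (simp add: hom_mult[OF hom_I] d)
      show "Y * Y + d * d = 1"
        using c(2) by (intro injD[OF inj_I]) (simp add: hom_simps[OF hom_I] d I_one)
    qed (fact sY)
    then show ?thesis
      by (simp add: Y_def norm_Adjoin_zero)
  qed
  have sa: "norm x \<le> norm (\<iota> x)" if x: "selfadjoint x" for x
  proof (rule dense_ge)
    fix s assume s: "norm (\<iota> x) < s"
    then have "s > 0"
      using norm_ge_zero le_less_trans by blast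
    moreover from this have "norm (inverse s *\<^sub>R x) \<le> 1"
      using s by (intro unit selfadjoint_scaleR x) (simp add: hom_scaleR[OF hom_\<iota>] field_simps)
    ultimately show "norm x \<le> s"
      by (simp add: field_simps)
  qed
  have "(norm a)\<^sup>2 \<le> norm (\<iota> (star a * a))"
    using sa[OF selfadjoint_star_mult_self[of a]] by (simp add: cstar_identity)
  also have "\<dots> = (norm (\<iota> a))\<^sup>2"
    by (simp add: hom_simps[OF hom_\<iota>] cstar_identity)
  finally show "norm a \<le> norm (\<iota> a)"
    by (rule power2_le_imp_le) simp
qed

lemma norm_j: "norm (j a) = norm a"
  by (simp add: j_def norm_Adjoin_zero norm_\<iota>)

text \<open>Modulo A the inverse of \<open>I x\<close> is the inverse of a scalar, hence itself a
  scalar, so the inverse comes from A^+.\<close>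

lemma invertible_I:
  assumes "alg_invertible (I x)"
  shows "alg_invertible x"
proof -
  obtain v where v: "I x * v = 1" "v * I x = 1"
    using assms alg_invertible_iff by blast
  have Pv: "scalar x *\<^sub>C P v = 1"
    using arg_cong[OF v(1), of P] by (simp add: hom_mult[OF hom_P] P_I P_one mult_scaleC_left)
  then have "scalar x \<noteq> 0" "scalar x *\<^sub>C body (P v) = 0"
    by (auto simp: scaleC_zero_left dest: arg_cong[of _ _ body])
  then have "inverse (scalar x) *\<^sub>C scalar x *\<^sub>C body (P v) = 0"
    by (simp add: scaleC_zero_right)
  then have "body (P v) = 0"
    using \<open>scalar x \<noteq> 0\<close> by (simp add: scaleC_scaleC scaleC_one)
  then obtain w where "v = I w"
    by (rule range_I)
  then have "x * w = 1" "w * x = 1"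
    using v by (auto intro!: injD[OF inj_I] simp: hom_mult[OF hom_I] I_one)
  then show ?thesis
    using alg_invertible_iff by blast
qed

subsection \<open>Ideals\<close>

text \<open>
  Approximate the tuple \<open>x k \<in> A + t k\<close>, \<open>t 0 \<noteq> 0\<close>, by \<open>y k = x k + d k\<close> with invertible sum of
  squares. Conjugating by \<open>g = (1 + d 0 / t 0)\<^sup>-\<^sup>1\<^sup>/\<^sup>2\<close> makes the image of \<open>y 0\<close> modulo \<open>A\<close> equal to
  \<open>t 0\<close>; then subtracting \<open>z 0 * c k * z 0\<close> makes the image of the k-th entry equal to \<open>t k\<close>.
  Both operations preserve invertibility of the sum of squares.
\<close>

lemma Lg_dense_ideal:
  assumes dense: "Lg_dense TYPE('e adjoined) (Suc n)"
  shows "Lg_dense TYPE('a adjoined) (Suc n)"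
  unfolding Lg_dense_iff
proof (intro ballI allI impI)
  fix a :: "nat \<Rightarrow> 'a adjoined" and \<epsilon> :: real
  assume a: "a \<in> sa_tuples (Suc n)" and \<epsilon>: "\<epsilon> > 0"
  obtain t0 where t0: "t0 \<noteq> 0" "\<bar>Re (scalar (a 0)) - t0\<bar> < \<epsilon> / 2"
    using real_number_perturbation[of "\<epsilon> / 2"] \<epsilon> by auto
  define t where "t k = (if k = 0 then t0 else Re (scalar (a k)))" for k
  define a' where "a' k = Adjoin (body (a k)) (complex_of_real (t k))" for k
  have a': "norm (a k - a' k) < \<epsilon> / 2" "selfadjoint (a' k)" if k: "k < Suc n" for k
  proof -
    have "a k - a' k = complex_of_real (Re (scalar (a k)) - t k) *\<^sub>C 1"
      using selfadjoint_scalar_real[OF sa_tuples_selfadjoint[OF a k]]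
      by (auto intro!: adjoined.expand simp: a'_def scaleC_zero_right)
    then have "norm (a k - a' k) = \<bar>Re (scalar (a k)) - t k\<bar>"
      by (simp only: norm_scaleC norm_of_real norm_one mult_1_right)
    then show "norm (a k - a' k) < \<epsilon> / 2"
      using t0 \<epsilon> by (auto simp: t_def)
    show "selfadjoint (a' k)"
      using sa_tuples_selfadjoint[OF a k] by (auto simp: a'_def selfadjoint_adjoined_iff)
  qed
  define x where "x k = I (a' k)" for k
  have x: "selfadjoint (x k)" if "k < Suc n" for k
    using a'(2)[OF that] by (simp add: x_def hom_selfadjoint[OF hom_I])
  have Px: "P (x k) = t k *\<^sub>R 1" for k
    by (simp add: x_def P_I a'_def scaleR_scaleC)
  have "restrict x {..<Suc n} \<in> sa_tuples (Suc n)"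
    using x by (rule restrict_in_sa_tuples)
  note approx = dense[unfolded Lg_dense_iff, rule_format, OF this]
  \<comment> \<open>A whole sequence of approximations is taken: all derived quantities converge,
    and a good index \<open>m\<close> is picked at the end in place of explicit estimates.\<close>
  have "\<exists>y\<in>Lg (Suc n). \<forall>k<Suc n. norm (x k - y k) < 1 / real (Suc m)" for m
    using approx[of "1 / real (Suc m)"] by simp
  then obtain y where y_Lg: "\<And>m. y m \<in> Lg (Suc n)"
      and y_near: "\<And>m k. k < Suc n \<Longrightarrow> norm (x k - y m k) < 1 / real (Suc m)"
    by metis
  have y: "selfadjoint (y m k)" if "k < Suc n" for m k
    using y_Lg[of m] that by (auto simp: Lg_def sa_tuples_selfadjoint)
  have y_lim: "(\<lambda>m. y m k) \<longlonglongrightarrow> x k" if k: "k < Suc n" for k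
  proof (rule LIM_zero_cancel, rule Lim_null_comparison)
    show "\<forall>\<^sub>F m in sequentially. norm (y m k - x k) \<le> 1 / real (Suc m)"
      using y_near[OF k] by (intro always_eventually) (auto simp: norm_minus_commute intro: less_imp_le)
    show "(\<lambda>m. 1 / real (Suc m)) \<longlonglongrightarrow> 0"
      by (rule lim_1_over_n[THEN LIMSEQ_Suc])
  qed
  define d where "d m k = y m k - x k" for m k
  have d_lim: "(\<lambda>m. d m k) \<longlonglongrightarrow> 0" if "k < Suc n" for k
    unfolding d_def using y_lim[OF that] by (rule LIM_zero)
  \<comment> \<open>\<open>t0 *\<^sub>R p m\<close> has the same image under \<open>P\<close> as
    \<open>y m 0\<close> but tends to a scalar.\<close>
  define p where "p m = 1 + (1 / t0) *\<^sub>R d m 0" for m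
  have "(\<lambda>m. p m) \<longlonglongrightarrow> 1 + (1 / t0) *\<^sub>R 0"
    unfolding p_def by (intro tendsto_intros d_lim) simp
  then have p_lim: "p \<longlonglongrightarrow> 1"
    by simp
  have sp: "selfadjoint (p m)" for m
    unfolding p_def d_def using x y by (intro selfadjoint_intros) auto
  have "\<exists>g. norm (1 - p m) \<le> 1 / 2 \<longrightarrow> selfadjoint g \<and> g * p m * g = 1 \<and> alg_invertible g \<and>
      norm (1 - g) \<le> 2 * norm (1 - p m)" for m
    using inverse_sqrt_near_one[OF sp] by metis
  then obtain g where g: "\<And>m. norm (1 - p m) \<le> 1 / 2 \<Longrightarrow> selfadjoint (g m) \<and> g m * p m * g m = 1 \<and>
      alg_invertible (g m) \<and> norm (1 - g m) \<le> 2 * norm (1 - p m)"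
    by metis
  have np_lim: "(\<lambda>m. norm (1 - p m)) \<longlonglongrightarrow> 0"
    using tendsto_norm[OF tendsto_diff[OF tendsto_const p_lim, of 1]] by simp
  have p_near: "\<forall>\<^sub>F m in sequentially. norm (1 - p m) < 1 / 2"
    by (rule order_tendstoD(2)[OF np_lim]) simp
  have "(\<lambda>m. 1 - g m) \<longlonglongrightarrow> 0"
  proof (rule Lim_null_comparison)
    show "\<forall>\<^sub>F m in sequentially. norm (1 - g m) \<le> 2 * norm (1 - p m)"
      using p_near by eventually_elim (use g in auto)
    show "(\<lambda>m. 2 * norm (1 - p m)) \<longlonglongrightarrow> 0"
      using tendsto_mult_right_zero[OF np_lim, of 2] by simp
  qed
  from tendsto_diff[OF tendsto_const this, of 1] have g_lim: "g \<longlonglongrightarrow> 1"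
    by simp
  \<comment> \<open>\<open>t k + d m k\<close> replaces \<open>y m k\<close>: it has the same image
    under \<open>P\<close>, and with it \<open>c m k\<close> tends to 0. The factor
    \<open>1 / (t0 * t0)\<close> cancels the two copies of \<open>z0 m\<close>, each with image
    \<open>t0\<close>.\<close>
  define c where "c m k = (1 / (t0 * t0)) *\<^sub>R (g m * (t k *\<^sub>R 1 + d m k) * g m - t k *\<^sub>R 1)" for m k
  have c_lim: "(\<lambda>m. c m k) \<longlonglongrightarrow> 0" if "k < Suc n" for k
  proof -
    have "(\<lambda>m. c m k) \<longlonglongrightarrow> (1 / (t0 * t0)) *\<^sub>R (1 * (t k *\<^sub>R 1 + 0) * 1 - t k *\<^sub>R 1)"
      unfolding c_def by (intro tendsto_intros g_lim d_lim[OF that])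
    then show ?thesis by simp
  qed
  define z0 where "z0 m = g m * y m 0 * g m" for m
  define z where "z m k = (if k = 0 then z0 m else g m * y m k * g m - z0 m * c m k * z0 m)" for m k
  have "z0 \<longlonglongrightarrow> 1 * x 0 * 1"
    unfolding z0_def by (intro tendsto_intros g_lim y_lim) simp
  then have z0_lim: "z0 \<longlonglongrightarrow> x 0"
    by simp
  have z_lim: "(\<lambda>m. z m k) \<longlonglongrightarrow> x k" if k: "k < Suc n" for k
  proof (cases "k = 0")
    case False
    have "(\<lambda>m. g m * y m k * g m - z0 m * c m k * z0 m) \<longlonglongrightarrow> 1 * x k * 1 - x 0 * 0 * x 0"
      by (intro tendsto_intros g_lim y_lim z0_lim c_lim k)
    with False show ?thesis
      by (simp add: z_def)
  qed (simp add: z_def z0_lim)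
  have "\<forall>\<^sub>F m in sequentially. \<forall>k\<in>{..<Suc n}. dist (z m k) (x k) < \<epsilon> / 2"
    using \<epsilon> by (intro eventually_ball_finite ballI tendstoD[OF z_lim]) auto
  moreover have "(\<lambda>m. norm (1 - g m * g m)) \<longlonglongrightarrow> norm (1 - 1 * (1 :: 'e adjoined))"
    by (intro tendsto_intros g_lim)
  then have "\<forall>\<^sub>F m in sequentially. norm (1 - g m * g m) < 1 / 2"
    by (rule order_tendstoD(2)) simp
  ultimately have "\<forall>\<^sub>F m in sequentially. (\<forall>k\<in>{..<Suc n}. dist (z m k) (x k) < \<epsilon> / 2) \<and>
      norm (1 - g m * g m) < 1 / 2 \<and> norm (1 - p m) < 1 / 2"
    using p_near by eventually_elim simp
  then obtain m where zm: "\<And>k. k < Suc n \<Longrightarrow> norm (z m k - x k) < \<epsilon> / 2"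
      and gg: "norm (1 - g m * g m) < 1 / 2" and pm: "norm (1 - p m) < 1 / 2"
    unfolding eventually_sequentially by (auto simp: dist_norm)
  have gm: "selfadjoint (g m)" "g m * p m * g m = 1" "alg_invertible (g m)"
    using g pm by auto
  have sc: "selfadjoint (c m k)" if "k < Suc n" for k
    unfolding c_def d_def using x[OF that] y[OF that] gm by (intro selfadjoint_intros)
  have sz0: "selfadjoint (z0 m)"
    unfolding z0_def using gm y by (intro selfadjoint_sandwich) auto
  have sz: "selfadjoint (z m k)" if "k < Suc n" for k
    unfolding z_def using gm y[OF that] sc[OF that] sz0
    by (auto intro!: selfadjoint_sandwich selfadjoint_diff)
  have "alg_invertible (\<Sum>k<Suc n. (g m * y m k * g m) * (g m * y m k * g m))"
    using y y_Lg[of m] gm gg by (intro invertible_sum_squares_sandwich) (auto simp: Lg_def)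
  then have inv: "alg_invertible (z0 m * z0 m +
      (\<Sum>k<n. (g m * y m (Suc k) * g m) * (g m * y m (Suc k) * g m)))"
    unfolding sum.lessThan_Suc_shift z0_def .
  have "selfadjoint (g m * y m (Suc k) * g m)" "selfadjoint (c m (Suc k))" if "k \<in> {..<n}" for k
    using gm y sc that by (auto intro: selfadjoint_sandwich)
  from invertible_sum_squares_shear[OF sz0 this inv]
  have z_inv: "alg_invertible (\<Sum>k<Suc n. z m k * z m k)"
    unfolding sum.lessThan_Suc_shift by (simp add: z_def)
  have Py: "P (y m k) = t k *\<^sub>R 1 + P (d m k)" for k
    by (simp add: d_def hom_diff[OF hom_P] Px)
  have "P (y m 0) = P (t0 *\<^sub>R p m)"
    using t0(1) by (simp add: Py t_def p_def hom_add[OF hom_P] hom_scaleR[OF hom_P] P_one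
        scaleR_right_distrib)
  then have "P (z0 m) = P (t0 *\<^sub>R (g m * p m * g m))"
    by (simp add: z0_def hom_mult[OF hom_P] hom_scaleR[OF hom_P])
  then have Pz0: "P (z0 m) = t0 *\<^sub>R 1"
    by (simp add: gm hom_scaleR[OF hom_P] P_one)
  have Pz: "P (z m k) = t k *\<^sub>R 1" for k
  proof (cases "k = 0")
    case False
    have "P (z0 m * c m k * z0 m) = (t0 * t0) *\<^sub>R P (c m k)"
      by (simp add: hom_mult[OF hom_P] Pz0)
    also have "\<dots> = P (g m) * P (y m k) * P (g m) - t k *\<^sub>R 1"
      using t0(1) by (simp add: c_def hom_simps[OF hom_P] hom_scaleR[OF hom_P] P_one Py)
    finally show ?thesis
      using False by (simp add: z_def hom_simps[OF hom_P])
  qed (simp add: z_def Pz0 t_def)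
  have "\<exists>w. z m k = I w" for k
    using range_I[of "z m k"] by (metis Pz body_scaleR body_one scaleR_zero_right)
  then obtain b where b: "\<And>k. z m k = I (b k)"
    by metis
  have "selfadjoint (b k)" if "k < Suc n" for k
    using sz[OF that] by (simp add: b inj_selfadjoint_iff[OF hom_I inj_I])
  moreover have "alg_invertible (\<Sum>k<Suc n. b k * b k)"
    using z_inv by (intro invertible_I) (simp add: b hom_simps[OF hom_I])
  ultimately have "restrict b {..<Suc n} \<in> Lg (Suc n)"
    by (intro restrict_in_Lg)
  moreover have "norm (a k - b k) < \<epsilon>" if k: "k < Suc n" for k
  proof -
    have sb: "scalar (b k) = complex_of_real (t k)"
      using arg_cong[OF Pz[of k], of scalar] unfolding b scalar_adjoin_map scalar_scaleR scalar_one
      by (simp add: scaleR_conv_of_real)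
    \<comment> \<open>Equal scalar parts put the difference into A, where \<open>j\<close> is
      isometric.\<close>
    have "b k - a' k = Adjoin (body (b k) - body (a' k)) 0"
      by (auto intro: adjoined.expand simp: sb a'_def)
    then have "norm (b k - a' k) = norm (j (body (b k) - body (a' k)))"
      by (simp add: norm_Adjoin_zero norm_j)
    also have "j (body (b k) - body (a' k)) = z m k - x k"
      by (auto intro!: adjoined.expand simp: j_def b x_def hom_diff[OF hom_\<iota>] sb a'_def)
    finally have "norm (a' k - b k) < \<epsilon> / 2"
      using zm[OF k] by (simp add: norm_minus_commute)
    then show ?thesis
      using norm_triangle_ineq[of "a k - a' k" "a' k - b k"] a'(1)[OF k] by simp
  qed
  ultimately show "\<exists>b\<in>Lg (Suc n). \<forall>k<Suc n. norm (a k - b k) < \<epsilon>"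
    by (intro bexI[of _ "restrict b {..<Suc n}"]) auto
qed

subsection \<open>Small lifts\<close>

text \<open>
  With \<open>k = \<surd>(1 - b\<^sup>2)\<close> and \<open>c = b / (1 + k)\<close> we have \<open>b = 2c / (1 + c\<^sup>2)\<close>. If \<open>h\<close> is any
  self-adjoint lift of \<open>c\<close>, then \<open>2h / (1 + h\<^sup>2)\<close> is a lift of \<open>b\<close> of norm at most one.
\<close>

lemma selfadjoint_lift_unit:
  assumes b: "selfadjoint b" "norm b < 1"
  obtains e where "selfadjoint e" "\<pi> e = b" "norm e \<le> 1"
proof -
  define X where "X = Adjoin b 0"
  have X: "selfadjoint X" "norm X < 1"
    using b by (simp_all add: X_def selfadjoint_adjoined_iff norm_Adjoin_zero)
  then have lt: "(norm X)\<^sup>2 < 1"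
    by (simp add: power_less_one_iff)
  obtain k where k: "selfadjoint k" "k * k = 1 - X * X" "norm (1 - k) \<le> (norm X)\<^sup>2" "X * k = k * X"
    using X by (meson sqrt_one_minus_square less_imp_le)
  have "norm (2 *\<^sub>R 1 - (1 + k)) < 2"
    unfolding scaleR_2 add_diff_cancel_left using k(3) lt by simp
  then obtain v where v: "(1 + k) * v = 1" "v * (1 + k) = 1"
    using alg_invertible_near_scalar alg_invertible_iff by metis
  have Xv: "X * v = v * X"
    by (rule commute_inverse[OF v]) (simp add: algebra_simps k)
  have kv: "k * v = 1 - v" "v * k = 1 - v"
    using v by (simp_all add: algebra_simps eq_diff_eq)
  define c where "c = X * v"
  have "selfadjoint v"
    by (rule selfadjoint_inverse[OF v]) (use k in \<open>auto intro: selfadjoint_intros\<close>)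
  then have c: "selfadjoint c"
    unfolding c_def using X Xv by (intro selfadjoint_mult_commute)
  have "c * c = (X * X) * v * v"
    unfolding c_def by (metis Xv mult.assoc)
  also have "X * X = (1 - k) * (1 + k)"
    using k(2) by (simp add: algebra_simps)
  also have "(1 - k) * (1 + k) * v * v = (1 - k) * ((1 + k) * v) * v"
    by (simp add: mult.assoc)
  also have "\<dots> = 2 *\<^sub>R v - 1"
    by (simp add: v left_diff_distrib kv scaleR_2)
  finally have cc: "c * c = 2 *\<^sub>R v - 1" .
  have sc: "scalar c = 0"
    by (simp add: c_def X_def)
  obtain h0 where h0: "selfadjoint h0" "\<pi> h0 = body c"
    using surj_selfadjoint_lift[OF hom_\<pi> surj_\<pi>, of "body c"] c
    by (auto simp: selfadjoint_adjoined_iff)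
  define h where "h = Adjoin h0 0"
  have h: "selfadjoint h"
    using h0 by (simp add: h_def selfadjoint_adjoined_iff)
  have Ph: "P h = c"
    by (auto intro: adjoined.expand simp: h_def h0 sc)
  have "alg_invertible (1 + h * h)"
    using h invertible_add_positive[OF positive_one _ positive_square] alg_invertible_iff[of 1]
    by (metis mult_1_left)
  then obtain w where w: "(1 + h * h) * w = 1" "w * (1 + h * h) = 1"
    using alg_invertible_iff by blast
  define E where "E = 2 *\<^sub>R (h * w)"
  have E: "norm E \<le> 1" "selfadjoint E"
    unfolding E_def by (fact norm_double_angle_le[OF h w])+
  \<comment> \<open>Since \<open>1 + c * c = 2 *\<^sub>R v\<close>, the element
    \<open>2 *\<^sub>R v\<close> is cancelled by \<open>P w\<close>, which turns
    \<open>2 *\<^sub>R (c * P w)\<close> into \<open>X\<close>.\<close>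
  have "P ((1 + h * h) * w) = 1"
    by (simp add: w P_one)
  then have "(2 *\<^sub>R v) * P w = 1"
    by (simp add: hom_simps[OF hom_P] P_one Ph cc)
  then have "X = X * ((2 *\<^sub>R v) * P w)"
    by simp
  also have "\<dots> = 2 *\<^sub>R (c * P w)"
    by (simp add: c_def mult.assoc)
  also have "\<dots> = P E"
    by (simp add: E_def hom_scaleR[OF hom_P] hom_mult[OF hom_P] Ph)
  finally have PE: "P E = X" ..
  show ?thesis
  proof (rule that)
    show "\<pi> (body E) = b"
      using arg_cong[OF PE, of body] by (simp add: X_def)
    have "scalar E = 0"
      by (simp add: E_def h_def)
    then have "E = Adjoin (body E) 0"
      by (metis adjoined.collapse)
    then show "norm (body E) \<le> 1"
      using E(1) by (metis norm_Adjoin_zero)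
    show "selfadjoint (body E)"
      using E(2) by (simp add: selfadjoint_adjoined_iff)
  qed
qed

lemma selfadjoint_lift:
  assumes b: "selfadjoint b" "norm b < \<delta>"
  obtains e where "selfadjoint e" "\<pi> e = b" "norm e \<le> \<delta>"
proof -
  have \<delta>: "\<delta> > 0"
    using b(2) norm_ge_zero le_less_trans by blast
  have "selfadjoint (inverse \<delta> *\<^sub>R b)" "norm (inverse \<delta> *\<^sub>R b) < 1"
    using b \<delta> by (simp_all add: selfadjoint_scaleR field_simps)
  then obtain e where e: "selfadjoint e" "\<pi> e = inverse \<delta> *\<^sub>R b" "norm e \<le> 1"
    by (rule selfadjoint_lift_unit)
  show ?thesis
  proof (rule that)
    show "selfadjoint (\<delta> *\<^sub>R e)"
      using e(1) by (rule selfadjoint_scaleR)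
    show "\<pi> (\<delta> *\<^sub>R e) = b"
      using \<delta> by (simp add: hom_scaleR[OF hom_\<pi>] e)
    show "norm (\<delta> *\<^sub>R e) \<le> \<delta>"
      using \<delta> e(3) mult_left_mono[of "norm e" 1 \<delta>] by simp
  qed
qed

text \<open>Of the factor 3, the part 2 comes from \<open>norm_body_le\<close> and 1 from the
  scalar.\<close>

lemma selfadjoint_lift_adjoined:
  assumes b: "selfadjoint b" "norm b < \<delta>"
  obtains e where "selfadjoint e" "P e = b" "norm e \<le> 3 * \<delta>"
proof -
  have "selfadjoint (body b)" "norm (body b) < 2 * \<delta>"
    using b norm_body_le[of b] by (simp_all add: selfadjoint_adjoined_iff)
  then obtain e where e: "selfadjoint e" "\<pi> e = body b" "norm e \<le> 2 * \<delta>"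
    by (rule selfadjoint_lift)
  show ?thesis
  proof (rule that)
    show "selfadjoint (Adjoin e (scalar b))"
      using b(1) e(1) by (simp add: selfadjoint_adjoined_iff)
    show "P (Adjoin e (scalar b)) = b"
      by (auto intro: adjoined.expand simp: e)
    show "norm (Adjoin e (scalar b)) \<le> 3 * \<delta>"
      using norm_adjoined_le[of "Adjoin e (scalar b)"] norm_scalar_le[of b] e(3) b(2) by simp
  qed
qed

subsection \<open>The Busby map\<close>

definition left_action :: "'e adjoined \<Rightarrow> 'a \<Rightarrow> 'a" where
  "left_action x a = inv j (x * j a)"

definition right_action :: "'e adjoined \<Rightarrow> 'a \<Rightarrow> 'a" where
  "right_action x a = inv j (j a * x)"

lemma j_left_action: "j (left_action x a) = x * j a"
  unfolding left_action_def by (rule f_inv_into_f[OF range_j]) (simp add: hom_mult[OF hom_P] P_j)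

lemma j_right_action: "j (right_action x a) = j a * x"
  unfolding right_action_def by (rule f_inv_into_f[OF range_j]) (simp add: hom_mult[OF hom_P] P_j)

lemma hom_j_scaleR: "j (r *\<^sub>R a) = r *\<^sub>R j a"
  by (rule hom_scaleR[OF hom_j])

lemma bounded_linear_left_action: "bounded_linear (left_action x)"
proof (rule bounded_linear_intro[where K = "norm x"])
  show "norm (left_action x a) \<le> norm a * norm x" for a
    using norm_mult_ineq[of x "j a"]
    by (simp add: norm_j[symmetric] j_left_action mult.commute)
qed (rule injD[OF inj_j]; simp add: j_left_action hom_simps[OF hom_j] hom_j_scaleR distrib_left)+

lemma bounded_linear_right_action: "bounded_linear (right_action x)"
proof (rule bounded_linear_intro[where K = "norm x"])
  show "norm (right_action x a) \<le> norm a * norm x" for a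
    using norm_mult_ineq[of "j a" x] by (simp add: norm_j[symmetric] j_right_action)
qed (rule injD[OF inj_j]; simp add: j_right_action hom_simps[OF hom_j] hom_j_scaleR distrib_right)+

text \<open>The action of E^+ on its ideal A. Followed by \<open>corona_proj\<close> it vanishes on
  A and induces the Busby invariant, extended to B^+.\<close>

definition busby :: "'e adjoined \<Rightarrow> 'a multiplier" where
  "busby x = Abs_multiplier (Blinfun (left_action x), Blinfun (right_action x))"

lemma Rep_busby: "Rep_multiplier (busby x) = (Blinfun (left_action x), Blinfun (right_action x))"
  unfolding busby_def
proof (rule Abs_multiplier_inverse)
  show "(Blinfun (left_action x), Blinfun (right_action x)) \<in> double_centralizers"
    unfolding double_centralizers_def
    by (simp add: bounded_linear_Blinfun_apply bounded_linear_left_action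
        bounded_linear_right_action)
      (intro conjI allI; rule injD[OF inj_j]; simp add: j_left_action j_right_action
        hom_simps[OF hom_j] mult_scaleC_left mult_scaleC_right mult.assoc)
qed

lemma mult_left_busby: "mult_left (busby x) a = left_action x a"
  and mult_right_busby: "mult_right (busby x) a = right_action x a"
  by (simp_all add: mult_left.rep_eq mult_right.rep_eq Rep_busby bounded_linear_Blinfun_apply
      bounded_linear_left_action bounded_linear_right_action)

lemma busby_eqI:
  assumes "\<And>a. j (mult_left T a) = x * j a" "\<And>a. j (mult_right T a) = j a * x"
  shows "busby x = T"
  by (rule multiplier_eqI; rule injD[OF inj_j])
    (simp_all add: mult_left_busby mult_right_busby j_left_action j_right_action assms)

lemma hom_busby: "is_star_hom busby"
  unfolding is_star_hom_def
  by (intro conjI allI; rule busby_eqI)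
    (simp_all add: mult_left_plus mult_right_plus mult_left_scaleC_mult mult_right_scaleC_mult
      mult_left_times mult_right_times mult_left_star mult_right_star mult_left_busby
      mult_right_busby hom_simps[OF hom_j] j_left_action j_right_action star_mult star_star
      mult_scaleC_left mult_scaleC_right mult.assoc distrib_left distrib_right)

lemma busby_one: "busby 1 = 1"
  by (rule busby_eqI) (simp_all add: mult_left_one mult_right_one)

lemma busby_j: "busby (j a) = mult_embed a"
  by (rule busby_eqI) (simp_all add: mult_left_embed mult_right_embed hom_mult[OF hom_j])

text \<open>On the kernel of \<open>P\<close>, which is the range of \<open>j\<close>,
  \<open>busby\<close> is the injective map \<open>mult_embed\<close>. So identities in E^+ can be
  checked on the two components of the pullback.\<close>

lemma P_busby_inject:
  assumes "P x = P y" "busby x = busby y"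
  shows "x = y"
proof -
  have "P (x - y) = 0"
    using assms by (simp add: hom_diff[OF hom_P])
  then obtain a where a: "x - y = j a"
    using range_j by blast
  have "mult_embed a = busby (x - y)"
    by (simp add: a busby_j)
  also have "\<dots> = 0"
    using assms by (simp add: hom_diff[OF hom_busby])
  finally have "a = 0"
    by (metis norm_embed norm_eq_zero)
  then have "x - y = 0"
    by (simp add: a hom_zero[OF hom_j])
  then show ?thesis by simp
qed

text \<open>Lift the inverse from B^+ to \<open>v\<close>. Then \<open>busby v\<close> differs from
  the inverse \<open>T\<close> by an element of A, and subtracting that element from
  \<open>v\<close> corrects it without changing its image in B^+.\<close>

lemma invertible_pullback:
  assumes B: "alg_invertible (P x)" and M: "alg_invertible (busby x)"
  shows "alg_invertible x"
proof -
  obtain v0 where v0: "P x * v0 = 1" "v0 * P x = 1"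
    using B alg_invertible_iff by blast
  obtain v where v: "P v = v0"
    using surj_P by (metis surjD)
  obtain T where T: "busby x * T = 1" "T * busby x = 1"
    using M alg_invertible_iff by blast
  have "P (x * v - 1) = 0"
    by (simp add: hom_simps[OF hom_P] P_one v v0)
  then obtain a where a: "x * v - 1 = j a"
    using range_j by blast
  have "busby v - T = T * (busby x * busby v - 1)"
    by (simp add: right_diff_distrib mult.assoc[symmetric] T)
  also have "busby x * busby v - 1 = mult_embed a"
    by (simp add: busby_j[symmetric] a[symmetric] hom_simps[OF hom_busby] busby_one)
  also have "T * mult_embed a = busby (j (mult_left T a))"
    by (simp add: embed_absorb_left busby_j)
  finally have T_eq: "T = busby (v - j (mult_left T a))"
    by (simp add: hom_diff[OF hom_busby] algebra_simps)
  define v' where "v' = v - j (mult_left T a)"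
  have "P v' = v0" "busby v' = T"
    using T_eq by (simp_all add: v'_def hom_diff[OF hom_P] P_j v)
  then have "x * v' = 1" "v' * x = 1"
    using v0 T by (auto intro!: P_busby_inject simp: hom_mult[OF hom_P] hom_mult[OF hom_busby] P_one busby_one)
  then show ?thesis
    using alg_invertible_iff by blast
qed

text \<open>The image in the corona depends only on \<open>P x\<close>, so a lift of the inverse of
  \<open>P x\<close> gives an inverse there. The corona has no \<open>1\<close> as a type;
  \<open>corona_proj 1\<close> is its identity.\<close>

lemma corona_busby_invertible:
  assumes "alg_invertible (P x)"
  shows "alg_invertible (corona_proj (busby x))"
proof -
  obtain v0 where v0: "P x * v0 = 1" "v0 * P x = 1"
    using assms alg_invertible_iff by blast
  obtain v where v: "P v = v0"
    using surj_P by (metis surjD)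
  have one: "corona_proj (busby y) = corona_proj 1" if "P y = 1" for y
  proof -
    have "P (y - 1) = 0"
      using that by (simp add: hom_diff[OF hom_P] P_one)
    then obtain a where a: "y - 1 = j a"
      using range_j by blast
    have "corona_proj (busby (y - 1)) = 0"
      unfolding a by (simp add: busby_j corona_proj_eq_0_iff)
    then show ?thesis
      by (simp add: hom_diff[OF hom_busby] hom_diff[OF is_star_hom_corona_proj] busby_one)
  qed
  have "corona_proj (busby x) * corona_proj (busby v) = corona_proj 1"
      "corona_proj (busby v) * corona_proj (busby x) = corona_proj 1"
    using one[of "x * v"] one[of "v * x"] v0 v
    by (simp_all add: hom_mult[OF hom_P] hom_mult[OF hom_busby] hom_mult[OF is_star_hom_corona_proj])
  moreover have "is_identity (corona_proj 1 :: 'a corona)"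
    unfolding is_identity_def
    using surj_corona_proj hom_mult[OF is_star_hom_corona_proj] by (metis mult_1_left mult_1_right surjD)
  ultimately show ?thesis
    unfolding alg_invertible_def by blast
qed

lemma Lg_dense_extension:
  assumes Lambda: "property_Lambda TYPE('a) n" and dense: "Lg_dense TYPE('b adjoined) (Suc n)"
  shows "Lg_dense TYPE('e adjoined) (Suc n)"
  unfolding Lg_dense_iff
proof (intro ballI allI impI)
  fix y :: "nat \<Rightarrow> 'e adjoined" and \<epsilon> :: real
  assume y_sa: "y \<in> sa_tuples (Suc n)" and \<epsilon>: "\<epsilon> > 0"
  have y: "selfadjoint (y k)" if "k < Suc n" for k
    using y_sa that by (rule sa_tuples_selfadjoint)
  have "restrict (\<lambda>k. P (y k)) {..<Suc n} \<in> sa_tuples (Suc n)"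
    using y by (intro restrict_in_sa_tuples hom_selfadjoint[OF hom_P])
  \<comment> \<open>Lifting costs a factor 3, so \<open>\<epsilon> / 8\<close> leaves room for the
    later change by less than \<open>\<epsilon> / 2\<close>.\<close>
  then obtain b where b_Lg: "b \<in> Lg (Suc n)"
      and near: "\<forall>k<Suc n. norm (restrict (\<lambda>k. P (y k)) {..<Suc n} k - b k) < \<epsilon> / 8"
    using dense \<epsilon> unfolding Lg_dense_iff by (metis divide_pos_pos zero_less_numeral)
  have b: "selfadjoint (b k)" if "k < Suc n" for k
    using b_Lg that by (auto simp: Lg_def sa_tuples_selfadjoint)
  have "\<exists>f. selfadjoint f \<and> P f = b k - P (y k) \<and> norm f \<le> 3 * (\<epsilon> / 8)" if k: "k < Suc n" for k
  proof -
    have "selfadjoint (b k - P (y k))"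
      using b[OF k] y[OF k] by (intro selfadjoint_diff hom_selfadjoint[OF hom_P])
    moreover have "norm (b k - P (y k)) < \<epsilon> / 8"
      using near k by (simp add: norm_minus_commute)
    ultimately show ?thesis
      by (metis selfadjoint_lift_adjoined)
  qed
  then obtain f where f: "\<And>k. k < Suc n \<Longrightarrow> selfadjoint (f k) \<and> P (f k) = b k - P (y k) \<and>
      norm (f k) \<le> 3 * (\<epsilon> / 8)"
    by metis
  define y' where "y' k = y k + f k" for k
  have y': "selfadjoint (y' k)" "P (y' k) = b k" if "k < Suc n" for k
    using y[OF that] f[OF that] by (simp_all add: y'_def selfadjoint_add hom_add[OF hom_P])
  define a where "a = restrict (\<lambda>k. busby (y' k)) {..<Suc n}"
  have "P (\<Sum>k<Suc n. y' k * y' k) = (\<Sum>k<Suc n. b k * b k)"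
    using y' by (simp only: hom_sum[OF hom_P] hom_mult[OF hom_P]) simp
  then have "alg_invertible (P (\<Sum>k<Suc n. y' k * y' k))"
    using b_Lg by (simp add: Lg_def)
  then have "alg_invertible (corona_proj (busby (\<Sum>k<Suc n. y' k * y' k)))"
    by (rule corona_busby_invertible)
  then have "alg_invertible (\<Sum>k<Suc n. corona_proj (a k) * corona_proj (a k))"
    by (simp add: a_def hom_simps[OF hom_busby] hom_simps[OF is_star_hom_corona_proj])
  moreover have a: "a \<in> sa_tuples (Suc n)"
    unfolding a_def using y' by (intro restrict_in_sa_tuples hom_selfadjoint[OF hom_busby])
  ultimately have "(\<lambda>k\<in>{..<Suc n}. corona_proj (a k)) \<in> Lg (Suc n)"
    by (intro restrict_in_Lg hom_selfadjoint[OF is_star_hom_corona_proj] sa_tuples_selfadjoint[OF a])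
  with Lambda a \<epsilon> obtain a' where a'_Lg: "a' \<in> Lg (Suc n)"
      and a': "\<forall>k<Suc n. norm (a k - a' k) < \<epsilon> / 2 \<and> corona_proj (a k) = corona_proj (a' k)"
    unfolding property_Lambda_def by (metis half_gt_zero)
  have "\<exists>u. a' k - a k = mult_embed u" if k: "k < Suc n" for k
  proof -
    have "corona_proj (a' k - a k) = 0"
      using a' k by (simp add: hom_diff[OF is_star_hom_corona_proj])
    then show ?thesis
      by (auto simp: corona_proj_eq_0_iff)
  qed
  then obtain u where u: "\<And>k. k < Suc n \<Longrightarrow> a' k - a k = mult_embed (u k)"
    by metis
  \<comment> \<open>Adding \<open>j (u k)\<close> leaves the image in B^+ at \<open>b k\<close> and
    moves the image in the multiplier algebra to \<open>a' k\<close>.\<close>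
  define z where "z k = y' k + j (u k)" for k
  have Pz: "P (z k) = b k" if "k < Suc n" for k
    using y'[OF that] by (simp add: z_def hom_add[OF hom_P] P_j)
  have bz: "busby (z k) = a' k" if "k < Suc n" for k
    using u[OF that] that by (simp add: z_def hom_add[OF hom_busby] busby_j a_def eq_diff_eq add.commute)
      (metis add.commute diff_add_cancel)
  have "selfadjoint (z k)" if k: "k < Suc n" for k
    unfolding selfadjoint_def
  proof (rule P_busby_inject)
    show "P (star (z k)) = P (z k)"
      using b[OF k] by (simp add: hom_star[OF hom_P] Pz[OF k] selfadjoint_def)
    have "selfadjoint (a' k)"
      using a'_Lg k by (auto simp: Lg_def sa_tuples_selfadjoint)
    then show "busby (star (z k)) = busby (z k)"
      by (simp add: hom_star[OF hom_busby] bz[OF k] selfadjoint_def)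
  qed
  moreover have "alg_invertible (\<Sum>k<Suc n. z k * z k)"
  proof (rule invertible_pullback)
    have "P (\<Sum>k<Suc n. z k * z k) = (\<Sum>k<Suc n. b k * b k)"
      using Pz by (simp only: hom_sum[OF hom_P] hom_mult[OF hom_P]) simp
    then show "alg_invertible (P (\<Sum>k<Suc n. z k * z k))"
      using b_Lg by (simp add: Lg_def)
    have "busby (\<Sum>k<Suc n. z k * z k) = (\<Sum>k<Suc n. a' k * a' k)"
      using bz by (simp only: hom_sum[OF hom_busby] hom_mult[OF hom_busby]) simp
    then show "alg_invertible (busby (\<Sum>k<Suc n. z k * z k))"
      using a'_Lg by (simp add: Lg_def)
  qed
  ultimately have "restrict z {..<Suc n} \<in> Lg (Suc n)"
    by (intro restrict_in_Lg)
  moreover have "norm (y k - z k) < \<epsilon>" if k: "k < Suc n" for k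
  proof -
    have "norm (j (u k)) = norm (a' k - a k)"
      by (simp add: u[OF k] norm_j norm_embed)
    also have "\<dots> = norm (a k - a' k)"
      by (rule norm_minus_commute)
    finally have "norm (j (u k)) < \<epsilon> / 2"
      using a' k by simp
    moreover have "norm (y k - z k) \<le> norm (f k) + norm (j (u k))"
      using norm_triangle_ineq[of "f k" "j (u k)"] norm_minus_commute[of "y k" "z k"]
      by (simp add: z_def y'_def)
    ultimately show ?thesis
      using f[OF k] \<epsilon> by simp
  qed
  ultimately show "\<exists>b\<in>Lg (Suc n). \<forall>k<Suc n. norm (y k - b k) < \<epsilon>"
    by (intro bexI[of _ "restrict z {..<Suc n}"]) auto
qed

end

section \<open>From density statements to inequalities of ranks\<close>

lemma ext_real_rank_le_imp_property_Lambda: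
  assumes le: "ext_real_rank TYPE('a::cstar_algebra) \<le> enat n"
  shows "property_Lambda TYPE('a) n"
proof -
  have ex: "\<exists>n. \<forall>m\<ge>n. property_Lambda TYPE('a) m"
    using le by (auto simp: ext_real_rank_def split: if_splits)
  have "(LEAST n. \<forall>m\<ge>n. property_Lambda TYPE('a) m) \<le> n"
    using le ex by (simp add: ext_real_rank_def)
  with LeastI_ex[OF ex] show ?thesis
    by blast
qed

text \<open>Testing against finite upper bounds turns an inequality of ranks into an implication
  between density statements; the infinite case is vacuous.\<close>

lemma enat_leI: "(\<And>n. y \<le> enat n \<Longrightarrow> x \<le> enat n) \<Longrightarrow> x \<le> y"
  by (cases y) auto

theorem theorem2:
  fixes \<iota> :: "'a::cstar_algebra \<Rightarrow> 'e::cstar_algebra"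
    and \<pi> :: "'e \<Rightarrow> 'b::cstar_algebra"
  assumes "cstar_extension \<iota> \<pi>"
  shows "max (real_rank TYPE('a)) (real_rank TYPE('b)) \<le> real_rank TYPE('e)
    \<and> real_rank TYPE('e) \<le> max (ext_real_rank TYPE('a)) (real_rank TYPE('b))"
proof -
  interpret cstar_ext \<iota> \<pi>
    by unfold_locales (rule assms)
  have "real_rank TYPE('a) \<le> real_rank TYPE('e)"
    by (rule enat_leI) (simp add: real_rank_le_iff Lg_dense_ideal)
  moreover have "real_rank TYPE('b) \<le> real_rank TYPE('e)"
    by (rule enat_leI) (simp add: real_rank_le_iff Lg_dense_surj_hom[OF hom_P surj_P])
  moreover have "real_rank TYPE('e) \<le> max (ext_real_rank TYPE('a)) (real_rank TYPE('b))"
    by (rule enat_leI)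
      (simp add: real_rank_le_iff Lg_dense_extension ext_real_rank_le_imp_property_Lambda)
  ultimately show ?thesis
    by simp
qed

end
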